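(* Let $0<\alpha<1$, $\gamma\ge0$ with $0<\alpha+\gamma\le1$, and consider one of the three Pearson diffusions (Ornstein-Uhlenbeck, Cox-Ingersoll-Ross, Jacobi) with state space $S$, Fokker-Planck operator $\mathcal{L}$, stationary density $\boldsymbol{m}$ and orthonormal polynomials $Q_n$. Let $\boldsymbol{p}_{\alpha,\gamma}(x,t;y)$ be the transition density of the associated stretched non-local Pearson diffusion. Let $h$ be such that $h/\boldsymbol{m}\in L_2(\boldsymbol{m}(x)dx)$ and the series $\sum_na_nQ_n$, where $a_n=\int_Sh(y)Q_n(y)\,dy$, converges to $h/\boldsymbol{m}$ uniformly on finite intervals contained in $S$. Then the function $$p_{\alpha,\gamma}(t,x)=\int_S\boldsymbol{p}_{\alpha,\gamma}(x,t;y)\,h(y)\,dy$$ solves the fractional Cauchy problem $$\mathcal{D}^{(\alpha,\gamma)}_tg(t,x)=\mathcal{L}g(t,x),\qquad g(0,x)=h(x).$$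
   Context: For $0<\alpha<1$, $\gamma\ge0$: $\mathcal{D}^{(\alpha,\gamma)}_t f(t)=\frac{t^{-\gamma}}{\Gamma(1-\alpha)}\int_0^t\frac{f'(s)}{(t-s)^{\alpha}}\,ds$. "Solves" means the equation holds pointwise for $t>0$, $x\in S$, and the initial condition holds, where the value of the function at $t=0$ is that of its series (spectral) form $\boldsymbol{m}(x)\sum_n\operatorname{E}_{\alpha,1+\gamma/\alpha,\gamma/\alpha}(-\lambda_nt^{\alpha+\gamma})Q_n(x)a_n$. Pearson diffusions: drift $\mu(x)$, diffusion coefficient $D(x)$, generator $\mathcal{G}g=\mu g'+Dg''$, Fokker-Planck operator $\mathcal{L}p=-(\mu p)'+(Dp)''$. (OU) $S=\mathbb{R}$, $D(x)=\theta\sigma^2$, $\mu(x)=-\theta(x-\mu_0)$, $\theta,\sigma^2>0$, $\mu_0\in\mathbb{R}$; $\boldsymbol{m}(x)=\frac{1}{\sqrt{2\pi\sigma^2}}e^{-(x-\mu_0)^2/(2\sigma^2)}$; $\lambda_n=\theta n$ (Hermite polynomials). (CIR) $S=(0,\infty)$, $D(x)=\theta x/a$, $\mu(x)=-\theta(x-b/a)$, $\theta,a,b>0$; $\boldsymbol{m}(x)=\frac{a^b}{\Gamma(b)}x^{b-1}e^{-ax}$; $\lambda_n=\theta n$ (Laguerre polynomials $L_n^{b-1}(ax)$). (Jacobi) $S=(-1,1)$, $D(x)=1-x^2$, $\mu(x)=-(a+b+2)x+b-a$, $a,b>-1$; $\boldsymbol{m}(x)=\frac{(1-x)^a(1+x)^b}{B(a+1,b+1)2^{a+b+1}}$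 (here $B(\cdot,\cdot)$ is the beta function); $\lambda_n=n(n+a+b+1)$ (Jacobi polynomials $P_n^{(a,b)}$). In each case $Q_n$ is the corresponding degree-$n$ polynomial, $\mathcal{G}Q_n=-\lambda_nQ_n$, normalized so that $\int_S Q_nQ_k\boldsymbol{m}\,dx=\delta_{nk}$. Stretched non-local Pearson diffusion: $X^{(\alpha,\gamma)}_t=X_{t^{\alpha+\gamma}Z}$, where $X$ is the Pearson diffusion with transition density $\boldsymbol{m}(x)\sum_{n\ge0}e^{-\lambda_nt}Q_n(x)Q_n(y)$ and $Z=\int_0^\infty(1-\sigma^\alpha_s)_+^\gamma ds$ is independent of $X$, $(\sigma_s^\alpha)$ being the $\alpha$-stable subordinator with $\mathbb{E}e^{-\lambda\sigma^\alpha_s}=e^{-s\lambda^\alpha}$ (and $(u)_+^\gamma=u^\gamma$ for $u>0$, $0$ for $u\le 0$). Its transition density for $t>0$ is $$\boldsymbol{p}_{\alpha,\gamma}(x,t;y)=\boldsymbol{m}(x)\sum_{n=0}^{\infty}\operatorname{E}_{\alpha,1+\gamma/\alpha,\gamma/\alpha}\left(-\lambda_nt^{\alpha+\gamma}\right)Q_n(x)Q_n(y),$$ where the Kilbas-Saigo function is $\operatorname{E}_{a,m,l}(z)=\sum_{n\ge0}c_nz^n$, $c_0=1$, $c_n=\prod_{k=0}^{n-1}\frac{\Gamma[1+a(km+l)]}{\Gamma[1+a(km+l+1)]}$. *)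

theory Defs
  imports "HOL-Analysis.Analysis" "HOL-Computational_Algebra.Polynomial"
begin

(* Parameters in order: OU theta (sigma^2) mu0, CIR theta a b, Jacobi a b.
   The second parameter of OU is the variance sigma^2 itself. *)
datatype pearson = OU real real real | CIR real real real | Jacobi real real

fun pearson_params :: "pearson \<Rightarrow> bool" where
  "pearson_params (OU \<theta> v \<mu>0) \<longleftrightarrow> \<theta> > 0 \<and> v > 0"
| "pearson_params (CIR \<theta> a b) \<longleftrightarrow> \<theta> > 0 \<and> a > 0 \<and> b > 0"
| "pearson_params (Jacobi a b) \<longleftrightarrow> a > -1 \<and> b > -1"

fun state_space :: "pearson \<Rightarrow> real set" where
  "state_space (OU \<theta> v \<mu>0) = UNIV"
| "state_space (CIR \<theta> a b) = {0<..}"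
| "state_space (Jacobi a b) = {-1<..<1}"

fun drift :: "pearson \<Rightarrow> real \<Rightarrow> real" where
  "drift (OU \<theta> v \<mu>0) x = - \<theta> * (x - \<mu>0)"
| "drift (CIR \<theta> a b) x = - \<theta> * (x - b / a)"
| "drift (Jacobi a b) x = - (a + b + 2) * x + b - a"

fun diffusion :: "pearson \<Rightarrow> real \<Rightarrow> real" where
  "diffusion (OU \<theta> v \<mu>0) x = \<theta> * v"
| "diffusion (CIR \<theta> a b) x = \<theta> * x / a"
| "diffusion (Jacobi a b) x = 1 - x\<^sup>2"

fun stat_density :: "pearson \<Rightarrow> real \<Rightarrow> real" where
  "stat_density (OU \<theta> v \<mu>0) x = 1 / sqrt (2 * pi * v) * exp (- ((x - \<mu>0)\<^sup>2 / (2 * v)))"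
| "stat_density (CIR \<theta> a b) x = a powr b / Gamma b * x powr (b - 1) * exp (- a * x)"
| "stat_density (Jacobi a b) x =
     (1 - x) powr a * (1 + x) powr b / (Beta (a + 1) (b + 1) * 2 powr (a + b + 1))"

fun eigval :: "pearson \<Rightarrow> nat \<Rightarrow> real" where
  "eigval (OU \<theta> v \<mu>0) n = \<theta> * real n"
| "eigval (CIR \<theta> a b) n = \<theta> * real n"
| "eigval (Jacobi a b) n = real n * (real n + a + b + 1)"

definition generator :: "pearson \<Rightarrow> (real \<Rightarrow> real) \<Rightarrow> real \<Rightarrow> real" where
  "generator P g x = drift P x * deriv g x + diffusion P x * deriv (deriv g) x"

definition fokker_planck :: "pearson \<Rightarrow> (real \<Rightarrow> real) \<Rightarrow> real \<Rightarrow> real" where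
  "fokker_planck P p x =
     - deriv (\<lambda>y. drift P y * p y) x + deriv (deriv (\<lambda>y. diffusion P y * p y)) x"

(* All derivatives occurring in fokker_planck exist at every point of the (open) state space. *)
definition fokker_planck_defined :: "pearson \<Rightarrow> (real \<Rightarrow> real) \<Rightarrow> bool" where
  "fokker_planck_defined P p \<longleftrightarrow>
     (\<forall>x\<in>state_space P.
        (\<lambda>y. drift P y * p y) field_differentiable at x \<and>
        (\<lambda>y. diffusion P y * p y) field_differentiable at x \<and>
        deriv (\<lambda>y. diffusion P y * p y) field_differentiable at x)"

(* The orthonormal Hermite, Laguerre and Jacobi polynomials, respectively. The three conditions
   determine each Q n up to its sign, and only products of two values of Q n (or of a value and
   a coefficient formed with Q n) matter below. *)
definition orthonormal_eigenpolys :: "pearson \<Rightarrow> (nat \<Rightarrow> real poly) \<Rightarrow> bool" where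
  "orthonormal_eigenpolys P Q \<longleftrightarrow>
     (\<forall>n. degree (Q n) = n) \<and>
     (\<forall>n. \<forall>x\<in>state_space P. generator P (poly (Q n)) x = - eigval P n * poly (Q n) x) \<and>
     (\<forall>n k. (LINT x:state_space P|lborel. poly (Q n) x * poly (Q k) x * stat_density P x)
              = (if n = k then 1 else 0))"

definition kilbas_saigo :: "real \<Rightarrow> real \<Rightarrow> real \<Rightarrow> real \<Rightarrow> real" where
  "kilbas_saigo a m l z =
     (\<Sum>n. (\<Prod>k<n. Gamma (1 + a * (real k * m + l)) / Gamma (1 + a * (real k * m + l + 1))) * z ^ n)"

definition time_factor :: "pearson \<Rightarrow> real \<Rightarrow> real \<Rightarrow> nat \<Rightarrow> real \<Rightarrow> real" where
  "time_factor P \<alpha> \<gamma> n t =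
     kilbas_saigo \<alpha> (1 + \<gamma> / \<alpha>) (\<gamma> / \<alpha>) (- eigval P n * t powr (\<alpha> + \<gamma>))"

(* Transition density (from y to x, for t > 0) of the stretched non-local diffusion, that is, of the
   Pearson diffusion run at the independent random time t powr (\<alpha> + \<gamma>) * Z, where Z is the integral
   over s >= 0 of the positive part of 1 - sigma_s, to the power \<gamma>, for an \<alpha>-stable subordinator sigma.
   Densities are only unique almost everywhere; this is the spectral version, in which
   time_factor replaces the factor exp (- eigval P n * t) of the Pearson diffusion itself. *)
definition trans_density ::
  "pearson \<Rightarrow> (nat \<Rightarrow> real poly) \<Rightarrow> real \<Rightarrow> real \<Rightarrow> real \<Rightarrow> real \<Rightarrow> real \<Rightarrow> real" where
  "trans_density P Q \<alpha> \<gamma> x t y =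
     stat_density P x * (\<Sum>n. time_factor P \<alpha> \<gamma> n t * poly (Q n) x * poly (Q n) y)"

definition fourier_coeff :: "pearson \<Rightarrow> (nat \<Rightarrow> real poly) \<Rightarrow> (real \<Rightarrow> real) \<Rightarrow> nat \<Rightarrow> real" where
  "fourier_coeff P Q h n = (LINT y:state_space P|lborel. h y * poly (Q n) y)"

(* The kernel integral makes sense for t > 0 only; at t = 0 the function takes the value of its
   spectral form (recall 0 powr (\<alpha> + \<gamma>) = 0). *)
definition cauchy_solution ::
  "pearson \<Rightarrow> (nat \<Rightarrow> real poly) \<Rightarrow> real \<Rightarrow> real \<Rightarrow> (real \<Rightarrow> real) \<Rightarrow> real \<Rightarrow> real \<Rightarrow> real" where
  "cauchy_solution P Q \<alpha> \<gamma> h t x =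
     (if t = 0
      then stat_density P x *
             (\<Sum>n. time_factor P \<alpha> \<gamma> n 0 * poly (Q n) x * fourier_coeff P Q h n)
      else (LINT y:state_space P|lborel. trans_density P Q \<alpha> \<gamma> x t y * h y))"

(* The integral is a Henstock-Kurzweil integral: for the data considered here the derivative
   need not be absolutely integrable near s = 0, where the integral is in general only an
   improper one. *)
definition stretched_caputo :: "real \<Rightarrow> real \<Rightarrow> (real \<Rightarrow> real) \<Rightarrow> real \<Rightarrow> real" where
  "stretched_caputo \<alpha> \<gamma> f t =
     t powr (- \<gamma>) / Gamma (1 - \<alpha>) * integral {0..t} (\<lambda>s. deriv f s / (t - s) powr \<alpha>)"

definition stretched_caputo_defined :: "real \<Rightarrow> (real \<Rightarrow> real) \<Rightarrow> real \<Rightarrow> bool" where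
  "stretched_caputo_defined \<alpha> f t \<longleftrightarrow>
     (\<forall>s\<in>{0<..<t}. f field_differentiable at s) \<and>
     (\<lambda>s. deriv f s / (t - s) powr \<alpha>) integrable_on {0..t}"

(* Pointwise solution; the existence of all derivatives and integrals in the equation is part of
   the notion. *)
definition solves_cauchy_problem ::
  "pearson \<Rightarrow> real \<Rightarrow> real \<Rightarrow> (real \<Rightarrow> real) \<Rightarrow> (real \<Rightarrow> real \<Rightarrow> real) \<Rightarrow> bool" where
  "solves_cauchy_problem P \<alpha> \<gamma> h g \<longleftrightarrow>
     (\<forall>t>0. fokker_planck_defined P (g t) \<and>
       (\<forall>x\<in>state_space P.
          stretched_caputo_defined \<alpha> (\<lambda>s. g s x) t \<and>
          stretched_caputo \<alpha> \<gamma> (\<lambda>s. g s x) t = fokker_planck P (g t) x)) \<and>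
     (\<forall>x\<in>state_space P. g 0 x = h x)"

end

(*
Every eigenmode decays like u_n(t) = E(-lam_n t^(alpha+gamma)), and termwise the equation is the
fractional relaxation equation of u_n.  The series converge only conditionally, so they are handled
by Abel summation: z -> E(-z), z (d/dz) E(-z) and z E(-z) are differences
of bounded increasing functions, hence multiply uniformly convergent series into uniformly convergent
ones.  For the first two this is monotonicity and convexity of E(-z), which follow from a maximum
principle for the Caputo derivative applied to the equation differentiated in z; for the third the
Volterra form of the equation is used.  In time the Caputo derivative is written in Marchaud form,
which is continuous under these limits and copes with the non-absolutely integrable singularity at 0.
In space, convergence of the series and of its image under the generator forces convergence of the
first two derivatives.  The kernel is summable because point evaluation is bounded in the energy
norm, i.e. the sum of Q_n(x)^2 / (1 + lam_n) is finite.
*)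
theory Submission
  imports Defs "HOL-Real_Asymp.Real_Asymp"
begin

section \<open>The Marchaud form of the Caputo derivative\<close>

text \<open>The hypotheses give locally uniform convergence of the expansion of h/m, with no rate
  and no absolute convergence, so nothing may be estimated term by term. What survives is
  multiplication by a sequence w(lam_n z) whose variation is bounded independently of z; as lam_n is
  nondecreasing, bounded variation of w on the half-line is enough. Three multipliers occur because
  the equation involves three things: the value, the time derivative (t d/dt of E(-lam
  t^(alpha+gamma)) is alpha+gamma times z d/dz E(-z) at z = lam t^(alpha+gamma)), and the operator,
  which multiplies by lam. Including z = 0 gives continuity down to t = 0. The 1/t in the time
  derivative is not compensated near 0, which is why f' must disappear from the fractional
  derivative before limits are taken. Finally, E decays only like 1/(1 + lam_n), not exponentially
  as for the diffusion itself; the energy estimate supplies the matching summability, without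
  asymptotics of the orthogonal polynomials.\<close>

definition marchaud :: "real \<Rightarrow> (real \<Rightarrow> real) \<Rightarrow> real \<Rightarrow> real" where
  "marchaud \<alpha> f t = (f t - f 0) * t powr (- \<alpha>)
     - \<alpha> * integral {0..t} (\<lambda>s. (f s - f t) * (t - s) powr (- \<alpha> - 1))"

text \<open>The kernel \<open>(t - s) powr (- \<alpha> - 1)\<close> is too singular at s = t for a
  merely continuous f; a linear bound at this one endpoint makes the integrand of
  \<open>marchaud\<close> absolutely integrable. Elsewhere only continuity is asked, so f' may be
  unbounded near 0.\<close>

definition lipschitz_end :: "real \<Rightarrow> (real \<Rightarrow> real) \<Rightarrow> real \<Rightarrow> bool" where
  "lipschitz_end C f t \<longleftrightarrow> continuous_on {0..t} f \<and> (\<forall>s\<in>{0..t}. \<bar>f s - f t\<bar> \<le> C * (t - s))"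

lemma has_integral_powr_end:
  fixes \<alpha> t :: real
  assumes "\<alpha> < 1" "0 \<le> t"
  shows "((\<lambda>s. (t - s) powr (- \<alpha>)) has_integral t powr (1 - \<alpha>) / (1 - \<alpha>)) {0..t}"
proof -
  have "((\<lambda>s. (t - s) powr (- \<alpha>)) has_integral
      (- ((t - t) powr (1 - \<alpha>) / (1 - \<alpha>)) - - ((t - 0) powr (1 - \<alpha>) / (1 - \<alpha>)))) {0..t}"
  proof (rule fundamental_theorem_of_calculus_interior)
    show "continuous_on {0..t} (\<lambda>s. - ((t - s) powr (1 - \<alpha>) / (1 - \<alpha>)))"
      using assms by (intro continuous_intros continuous_on_powr') auto
    show "((\<lambda>s. - ((t - s) powr (1 - \<alpha>) / (1 - \<alpha>))) has_vector_derivative (t - s) powr (- \<alpha>)) (at s)"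
      if "s \<in> {0<..<t}" for s
      using that assms
      by (auto intro!: derivative_eq_intros simp: has_real_derivative_iff_has_vector_derivative[symmetric])
  qed (use assms in auto)
  then show ?thesis using assms by simp
qed

lemma marchaud_integrand_bound:
  assumes "lipschitz_end C f t" "s \<in> {0..t}"
  shows "\<bar>(f s - f t) * (t - s) powr (- \<alpha> - 1)\<bar> \<le> C * (t - s) powr (- \<alpha>)"
proof -
  have "\<bar>(f s - f t) * (t - s) powr (- \<alpha> - 1)\<bar> \<le> (C * (t - s)) * (t - s) powr (- \<alpha> - 1)"
    using assms unfolding lipschitz_end_def by (auto simp: abs_mult intro!: mult_right_mono)
  also have "\<dots> = C * (t - s) powr (- \<alpha>)"
    using assms(2) powr_mult_base[of "t - s" "- \<alpha> - 1"] by (simp add: mult.assoc)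
  finally show ?thesis .
qed

lemma marchaud_integrable:
  assumes "lipschitz_end C f t" "\<alpha> < 1" "0 \<le> t"
  shows "(\<lambda>s. (f s - f t) * (t - s) powr (- \<alpha> - 1)) integrable_on {0..t}"
proof (rule measurable_bounded_by_integrable_imp_integrable_real)
  have "continuous_on {0..<t} (\<lambda>s. (f s - f t) * (t - s) powr (- \<alpha> - 1))"
    using assms unfolding lipschitz_end_def
    by (intro continuous_intros continuous_on_powr') (auto intro: continuous_on_subset)
  then have "(\<lambda>s. (f s - f t) * (t - s) powr (- \<alpha> - 1)) \<in> borel_measurable (lebesgue_on {0..<t})"
    by (intro continuous_imp_measurable_on_sets_lebesgue) auto
  then have 1: "(\<lambda>s. if s \<in> {0..<t} then (f s - f t) * (t - s) powr (- \<alpha> - 1) else 0)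
      \<in> borel_measurable lebesgue"
    by (subst borel_measurable_if) auto
  \<comment> \<open>At s = t the factor \<open>f s - f t\<close> is 0, so the extension by 0 already
    covers the closed interval.\<close>
  have eq: "(\<lambda>s. if s \<in> {0..<t} then (f s - f t) * (t - s) powr (- \<alpha> - 1) else 0) =
      (\<lambda>s. if s \<in> {0..t} then (f s - f t) * (t - s) powr (- \<alpha> - 1) else 0)"
    by (auto simp: fun_eq_iff)
  show "(\<lambda>s. (f s - f t) * (t - s) powr (- \<alpha> - 1)) \<in> borel_measurable (lebesgue_on {0..t})"
    by (rule borel_measurable_if[THEN iffD1, OF _ 1[unfolded eq]]) simp
  show "(\<lambda>s. C * (t - s) powr (- \<alpha>)) integrable_on {0..t}"
    using has_integral_mult_right[OF has_integral_powr_end[OF assms(2,3)], of C] by blast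
qed (use marchaud_integrand_bound[OF assms(1)] in auto)

text \<open>Integration by parts with the antiderivative \<open>f s - f t\<close> of f', chosen so
  that the boundary term at s = t vanishes. The value is Gamma(1 - \<alpha>) times the Caputo
  derivative of order \<alpha>. The Henstock-Kurzweil integral asks for f' at interior points only,
  without absolute integrability near 0.\<close>

lemma marchaud_has_integral:
  assumes lip: "lipschitz_end C f t" and a: "0 < \<alpha>" "\<alpha> < 1" and t: "0 < t"
    and deriv: "\<And>s. s \<in> {0<..<t} \<Longrightarrow> (f has_real_derivative f' s) (at s)"
  shows "((\<lambda>s. f' s / (t - s) powr \<alpha>) has_integral marchaud \<alpha> f t) {0..t}"
proof -
  define H where "H = (\<lambda>s. (f s - f t) * (t - s) powr (- \<alpha>))"
  define k where "k = (\<lambda>s. (f s - f t) * (t - s) powr (- \<alpha> - 1))"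
  have C0: "C \<ge> 0"
  proof -
    have "0 \<le> \<bar>f 0 - f t\<bar>" by simp
    also have "\<dots> \<le> C * (t - 0)" using lip t unfolding lipschitz_end_def by (metis atLeastAtMost_iff less_eq_real_def)
    finally show ?thesis using t by (simp add: zero_le_mult_iff)
  qed
  have cont: "continuous_on {0..t} H"
    unfolding continuous_on_eq_continuous_within
  proof (intro ballI)
    fix s assume s: "s \<in> {0..t}"
    show "continuous (at s within {0..t}) H"
    proof (cases "s = t")
      case False
      have "continuous (at s within {0..t}) f"
        using lip s unfolding lipschitz_end_def continuous_on_eq_continuous_within by blast
      then show ?thesis unfolding H_def using False s
        by (intro continuous_intros) auto
    next
      case True
      \<comment> \<open>The Lipschitz bound leaves \<open>(t - s) powr (1 - \<alpha>)\<close>, a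
        positive power.\<close>
      have "(H \<longlongrightarrow> 0) (at t within {0..t})"
      proof (rule Lim_null_comparison)
        show "\<forall>\<^sub>F s in at t within {0..t}. norm (H s) \<le> C * (t - s) powr (1 - \<alpha>)"
        proof (rule eventually_at_filter[THEN iffD2], rule always_eventually, intro allI impI)
          fix s assume "s \<noteq> t" "s \<in> {0..t}"
          then have st: "s \<in> {0..t}" "s < t" by auto
          have "norm (H s) \<le> (C * (t - s)) * (t - s) powr (- \<alpha>)"
            using st lip unfolding lipschitz_end_def H_def by (auto simp: abs_mult intro!: mult_right_mono)
          also have "\<dots> = C * (t - s) powr (1 - \<alpha>)"
            using st powr_mult_base[of "t - s" "- \<alpha>"] by (simp add: mult.assoc)
          finally show "norm (H s) \<le> C * (t - s) powr (1 - \<alpha>)" .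
        qed
        have "continuous_on {0..t} (\<lambda>s. C * (t - s) powr (1 - \<alpha>))"
          using a by (intro continuous_intros continuous_on_powr') auto
        then show "((\<lambda>s. C * (t - s) powr (1 - \<alpha>)) \<longlongrightarrow> 0) (at t within {0..t})"
          unfolding continuous_on_def using t by (drule_tac bspec[of _ _ t]) auto
      qed
      then show ?thesis using True by (simp add: continuous_within H_def)
    qed
  qed
  \<comment> \<open>The sum is integrable as a derivative and its second part by the Lipschitz
    bound, so the first part is integrable as a difference.\<close>
  have "((\<lambda>s. f' s / (t - s) powr \<alpha> + \<alpha> * k s) has_integral (H t - H 0)) {0..t}"
  proof (rule fundamental_theorem_of_calculus_interior[OF _ cont])
    fix s assume s: "s \<in> {0<..<t}"
    have 1: "((\<lambda>s. f s - f t) has_real_derivative f' s) (at s)"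
      using DERIV_diff[OF deriv[OF s] DERIV_const[of "f t"]] by simp
    have 2: "((\<lambda>s. (t - s) powr (- \<alpha>)) has_real_derivative \<alpha> * (t - s) powr (- \<alpha> - 1)) (at s)"
      using s by (auto intro!: derivative_eq_intros)
    have "f' s * (t - s) powr (- \<alpha>) + \<alpha> * (t - s) powr (- \<alpha> - 1) * (f s - f t) =
        f' s / (t - s) powr \<alpha> + \<alpha> * k s"
      by (simp add: powr_minus_divide k_def)
    then show "(H has_vector_derivative f' s / (t - s) powr \<alpha> + \<alpha> * k s) (at s)"
      using DERIV_mult[OF 1 2]
      unfolding H_def has_real_derivative_iff_has_vector_derivative[symmetric] by simp
  qed (use t in auto)
  moreover have "(k has_integral integral {0..t} k) {0..t}"
    unfolding k_def using marchaud_integrable[OF lip a(2)] t by (simp add: integrable_integral)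
  then have "((\<lambda>s. \<alpha> * k s) has_integral \<alpha> * integral {0..t} k) {0..t}"
    by (rule has_integral_mult_right)
  ultimately have "((\<lambda>s. (f' s / (t - s) powr \<alpha> + \<alpha> * k s) - \<alpha> * k s) has_integral
      (H t - H 0) - \<alpha> * integral {0..t} k) {0..t}"
    by (rule has_integral_diff)
  then show ?thesis
    by (simp add: H_def k_def marchaud_def algebra_simps)
qed

text \<open>The boundary term and the integral contribute the factors 1 and \<alpha>/(1 - \<alpha>),
  whose sum is 1/(1 - \<alpha>). The bound is linear in C, so \<open>marchaud\<close> passes to the
  limit once the Lipschitz constants of the differences tend to 0.\<close>

lemma marchaud_bound:
  assumes lip: "lipschitz_end C f t" and a: "0 < \<alpha>" "\<alpha> < 1" and t: "0 < t"
  shows "\<bar>marchaud \<alpha> f t\<bar> \<le> C * (t powr (1 - \<alpha>) / (1 - \<alpha>))"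
proof -
  have "\<bar>integral {0..t} (\<lambda>s. (f s - f t) * (t - s) powr (- \<alpha> - 1))\<bar> \<le> C * (t powr (1 - \<alpha>) / (1 - \<alpha>))"
  proof -
    have I: "((\<lambda>s. C * (t - s) powr (- \<alpha>)) has_integral C * (t powr (1 - \<alpha>) / (1 - \<alpha>))) {0..t}"
      using has_integral_mult_right[OF has_integral_powr_end[OF a(2)]] t by simp
    have "norm (integral {0..t} (\<lambda>s. (f s - f t) * (t - s) powr (- \<alpha> - 1)))
        \<le> integral {0..t} (\<lambda>s. C * (t - s) powr (- \<alpha>))"
      using I t marchaud_integrand_bound[OF lip]
      by (intro integral_norm_bound_integral marchaud_integrable[OF lip a(2)]) auto
    then show ?thesis using integral_unique[OF I] by simp
  qed
  then have 1: "\<alpha> * \<bar>integral {0..t} (\<lambda>s. (f s - f t) * (t - s) powr (- \<alpha> - 1))\<bar>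
      \<le> \<alpha> * (C * (t powr (1 - \<alpha>) / (1 - \<alpha>)))"
    using a by (intro mult_left_mono) auto
  have "\<bar>f 0 - f t\<bar> \<le> C * (t - 0)"
    using lip t unfolding lipschitz_end_def by (metis atLeastAtMost_iff less_eq_real_def)
  then have "\<bar>(f t - f 0) * t powr (- \<alpha>)\<bar> \<le> C * t * t powr (- \<alpha>)"
    using t by (auto simp: abs_mult intro!: mult_right_mono)
  also have "\<dots> = C * t powr (1 - \<alpha>)"
    using t powr_mult_base[of t "- \<alpha>"] by (simp add: mult.assoc)
  finally have 2: "\<bar>(f t - f 0) * t powr (- \<alpha>)\<bar> \<le> C * t powr (1 - \<alpha>)" .
  have "\<bar>marchaud \<alpha> f t\<bar> \<le> C * t powr (1 - \<alpha>) + \<alpha> * (C * (t powr (1 - \<alpha>) / (1 - \<alpha>)))"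
    using 1 2 a abs_triangle_ineq4[of "(f t - f 0) * t powr (- \<alpha>)"]
    unfolding marchaud_def by (fastforce simp: abs_mult intro: order_trans)
  also have "\<dots> = C * (t powr (1 - \<alpha>) / (1 - \<alpha>))"
    using a by (simp add: field_simps)
  finally show ?thesis .
qed

text \<open>The difference quotient at t, completed by D, is continuous on a compact interval and
  hence bounded.\<close>

lemma lipschitz_endI_differentiable:
  assumes cont: "continuous_on {0..t} f" and d: "(f has_real_derivative D) (at t)" and t: "0 < t"
  shows "\<exists>C. lipschitz_end C f t"
proof -
  define q where "q = (\<lambda>s. if s = t then D else (f s - f t) / (s - t))"
  have "continuous_on {0..t} q"
    unfolding continuous_on_eq_continuous_within
  proof (intro ballI)
    fix s assume s: "s \<in> {0..t}"
    show "continuous (at s within {0..t}) q"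
    proof (cases "s = t")
      case True
      have "((\<lambda>s. (f s - f t) / (s - t)) \<longlongrightarrow> D) (at t within {0..t})"
        using d DERIV_subset[OF d subset_UNIV, of "{0..t}"] by (simp add: has_field_derivative_iff)
      then have "(q \<longlongrightarrow> D) (at t within {0..t})"
        by (rule Lim_transform_eventually) (auto simp: q_def eventually_at_filter)
      then show ?thesis using True by (simp add: continuous_within q_def)
    next
      case False
      have "continuous (at s within {0..t}) f"
        using cont s unfolding continuous_on_eq_continuous_within by blast
      then have "continuous (at s within {0..t}) (\<lambda>s. (f s - f t) / (s - t))"
        using False by (intro continuous_intros) auto
      then have "((\<lambda>s. (f s - f t) / (s - t)) \<longlongrightarrow> q s) (at s within {0..t})"
        using False by (simp add: continuous_within q_def)
      moreover have "\<forall>\<^sub>F s' in at s within {0..t}. (f s' - f t) / (s' - t) = q s'"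
        unfolding eventually_at_filter by (rule eventually_mono[OF t1_space_nhds[OF False]]) (simp add: q_def)
      ultimately show ?thesis
        unfolding continuous_within by (rule Lim_transform_eventually)
    qed
  qed
  then have "bounded (q ` {0..t})" by (intro compact_imp_bounded compact_continuous_image) auto
  then obtain C where C: "\<And>s. s \<in> {0..t} \<Longrightarrow> \<bar>q s\<bar> \<le> C" unfolding bounded_iff by fastforce
  have "\<bar>f s - f t\<bar> \<le> C * (t - s)" if s: "s \<in> {0..t}" for s
  proof (cases "s = t")
    case False
    have "\<bar>f s - f t\<bar> = \<bar>q s\<bar> * (t - s)" using False s by (auto simp: q_def abs_mult)
    also have "\<dots> \<le> C * (t - s)" using C[OF s] s by (intro mult_right_mono) auto
    finally show ?thesis .
  qed auto
  then show ?thesis using cont unfolding lipschitz_end_def by blast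
qed

text \<open>On [t/2, t] the mean value estimate gives the slope M; for s < t/2 the difference is at
  most 2M while t - s exceeds t/2, which gives the slope 4M/t. Derivatives are thus needed only away
  from the origin.\<close>

lemma lipschitz_endI_bounds:
  assumes cont: "continuous_on {0..t} f" and t: "0 < t"
    and M: "\<And>s. s \<in> {0..t} \<Longrightarrow> \<bar>f s\<bar> \<le> M"
    and d: "\<And>s. s \<in> {t/2..t} \<Longrightarrow> (f has_real_derivative f' s) (at s)"
    and M': "\<And>s. s \<in> {t/2..t} \<Longrightarrow> \<bar>f' s\<bar> \<le> M"
  shows "lipschitz_end (M + 4 * M / t) f t"
  unfolding lipschitz_end_def
proof (intro conjI ballI cont)
  fix s assume s: "s \<in> {0..t}"
  have M0: "0 \<le> M" using M[OF s] by linarith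
  show "\<bar>f s - f t\<bar> \<le> (M + 4 * M / t) * (t - s)"
  proof (cases "s < t/2")
    case True
    have "\<bar>f s - f t\<bar> \<le> 2 * M" using M[OF s] M[of t] t by auto
    also have "\<dots> = 4 * M / t * (t / 2)" using t by simp
    also have "\<dots> \<le> 4 * M / t * (t - s)" using True M0 t by (intro mult_left_mono) auto
    also have "\<dots> \<le> (M + 4 * M / t) * (t - s)" using M0 s by (intro mult_right_mono) auto
    finally show ?thesis .
  next
    case False
    have "norm (f s - f t) \<le> M * norm (s - t)"
    proof (rule field_differentiable_bound[of "{t/2..t}"])
      show "(f has_field_derivative f' z) (at z within {t/2..t})" if "z \<in> {t/2..t}" for z
        using d[OF that] DERIV_subset by blast
    qed (use False s M' t in auto)
    also have "\<dots> \<le> (M + 4 * M / t) * (t - s)" using M0 s t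
      by (auto intro!: mult_right_mono)
    finally show ?thesis by simp
  qed
qed

lemma marchaud_add_scaled:
  assumes "lipschitz_end C f t" "lipschitz_end C' g t" "\<alpha> < 1" "0 \<le> t"
  shows "marchaud \<alpha> (\<lambda>s. f s + c * g s) t = marchaud \<alpha> f t + c * marchaud \<alpha> g t"
proof -
  have eq: "(\<lambda>s. (f s + c * g s - (f t + c * g t)) * (t - s) powr (- \<alpha> - 1)) =
      (\<lambda>s. (f s - f t) * (t - s) powr (- \<alpha> - 1) + c * ((g s - g t) * (t - s) powr (- \<alpha> - 1)))"
    by (simp add: fun_eq_iff algebra_simps)
  have E: "integral {0..t} (\<lambda>s. (f s + c * g s - (f t + c * g t)) * (t - s) powr (- \<alpha> - 1)) =
      integral {0..t} (\<lambda>s. (f s - f t) * (t - s) powr (- \<alpha> - 1)) +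
      c * integral {0..t} (\<lambda>s. (g s - g t) * (t - s) powr (- \<alpha> - 1))"
    unfolding eq integral_mult_right[symmetric] using assms
    by (intro Henstock_Kurzweil_Integration.integral_add integrable_on_mult_right marchaud_integrable)
  have "((f t + c * g t) - (f 0 + c * g 0)) * p - \<alpha> * (A + c * B) =
      ((f t - f 0) * p - \<alpha> * A) + c * ((g t - g 0) * p - \<alpha> * B)" for p A B
    by (simp add: algebra_simps)
  then show ?thesis unfolding marchaud_def E .
qed

text \<open>The Lipschitz property travels through the induction because additivity of
  \<open>marchaud\<close> requires it of each partial sum.\<close>

lemma marchaud_sum:
  assumes "finite I" "\<And>i. i \<in> I \<Longrightarrow> \<exists>C. lipschitz_end C (u i) t" "\<alpha> < 1" "0 \<le> t"
  shows "marchaud \<alpha> (\<lambda>s. \<Sum>i\<in>I. c i * u i s) t = (\<Sum>i\<in>I. c i * marchaud \<alpha> (u i) t) \<and>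
    (\<exists>C. lipschitz_end C (\<lambda>s. \<Sum>i\<in>I. c i * u i s) t)"
  using assms(1,2)
proof (induction I rule: finite_induct)
  case empty
  show ?case using assms by (auto simp: marchaud_def lipschitz_end_def intro!: exI[of _ 0])
next
  case (insert j I)
  then obtain C where C: "lipschitz_end C (\<lambda>s. \<Sum>i\<in>I. c i * u i s) t" by auto
  obtain C' where C': "lipschitz_end C' (u j) t" using insert.prems by auto
  have "lipschitz_end (C + \<bar>c j\<bar> * C') (\<lambda>s. (\<Sum>i\<in>I. c i * u i s) + c j * u j s) t"
    unfolding lipschitz_end_def
  proof (intro conjI ballI)
    show "continuous_on {0..t} (\<lambda>s. (\<Sum>i\<in>I. c i * u i s) + c j * u j s)"
      using C C' unfolding lipschitz_end_def by (intro continuous_on_add continuous_on_mult_left) auto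
    fix s assume s: "s \<in> {0..t}"
    have 1: "\<bar>(\<Sum>i\<in>I. c i * u i s) - (\<Sum>i\<in>I. c i * u i t)\<bar> \<le> C * (t - s)"
      using C s unfolding lipschitz_end_def by auto
    have 2: "\<bar>c j * (u j s - u j t)\<bar> \<le> \<bar>c j\<bar> * (C' * (t - s))"
      using C' s unfolding lipschitz_end_def by (auto simp: abs_mult intro!: mult_left_mono)
    show "\<bar>(\<Sum>i\<in>I. c i * u i s) + c j * u j s - ((\<Sum>i\<in>I. c i * u i t) + c j * u j t)\<bar>
        \<le> (C + \<bar>c j\<bar> * C') * (t - s)"
      using 1 2 by (auto simp: algebra_simps)
  qed
  moreover have "marchaud \<alpha> (\<lambda>s. (\<Sum>i\<in>I. c i * u i s) + c j * u j s) t =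
      (\<Sum>i\<in>I. c i * marchaud \<alpha> (u i) t) + c j * marchaud \<alpha> (u j) t"
    using marchaud_add_scaled[OF C C' assms(3,4)] insert by auto
  ultimately show ?case using insert.hyps by (auto simp: add.commute)
qed

text \<open>Uniform convergence of derivatives is asked only on [t/2, t], where the kernel is
  singular; near 0, where they may blow up, uniform convergence of the values suffices.\<close>

lemma marchaud_tendsto:
  assumes a: "0 < \<alpha>" "\<alpha> < 1" and t: "0 < t"
    and contN: "\<And>N. continuous_on {0..t} (F N)"
    and dN: "\<And>N s. s \<in> {t/2..t} \<Longrightarrow> (F N has_real_derivative F' N s) (at s)"
    and d: "\<And>s. s \<in> {t/2..t} \<Longrightarrow> (f has_real_derivative f' s) (at s)"
    and lim: "uniform_limit {0..t} F f sequentially"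
    and lim': "uniform_limit {t/2..t} F' f' sequentially"
  shows "(\<lambda>N. marchaud \<alpha> (F N) t) \<longlonglongrightarrow> marchaud \<alpha> f t"
proof (rule LIMSEQ_I)
  fix e :: real assume e: "e > 0"
  have cont: "continuous_on {0..t} f"
    using lim contN by (intro uniform_limit_theorem[of _ F sequentially]) auto
  obtain C where C: "lipschitz_end C f t"
    using lipschitz_endI_differentiable[OF cont d[of t] t] t by auto
  have CN: "\<exists>C. lipschitz_end C (F N) t" for N
    using lipschitz_endI_differentiable[OF contN dN[of t] t] t by auto
  define A where "A = t powr (1 - \<alpha>) / (1 - \<alpha>)"
  have A: "A > 0" using a t by (simp add: A_def)
  \<comment> \<open>Chosen so that the bound \<open>(M + 4 * M / t) * A\<close> from
    \<open>marchaud_bound\<close> equals e/2.\<close>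
  define M where "M = e / (2 * A * (1 + 4 / t))"
  have M: "M > 0" using e A t by (simp add: M_def add_pos_pos)
  have "\<forall>\<^sub>F N in sequentially. (\<forall>s\<in>{0..t}. \<bar>F N s - f s\<bar> \<le> M) \<and> (\<forall>s\<in>{t/2..t}. \<bar>F' N s - f' s\<bar> \<le> M)"
    using uniform_limitD[OF lim M] uniform_limitD[OF lim' M]
    by eventually_elim (auto simp: dist_real_def less_imp_le)
  then obtain N0 where N0: "\<And>N. N \<ge> N0 \<Longrightarrow> (\<forall>s\<in>{0..t}. \<bar>F N s - f s\<bar> \<le> M) \<and>
      (\<forall>s\<in>{t/2..t}. \<bar>F' N s - f' s\<bar> \<le> M)"
    unfolding eventually_sequentially by blast
  show "\<exists>no. \<forall>n\<ge>no. norm (marchaud \<alpha> (F n) t - marchaud \<alpha> f t) < e"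
  proof (intro exI[of _ N0] allI impI)
    fix N assume N: "N \<ge> N0"
    obtain C' where C': "lipschitz_end C' (F N) t" using CN by blast
    have "lipschitz_end (M + 4 * M / t) (\<lambda>s. F N s - f s) t"
      using N0[OF N] t
      by (intro lipschitz_endI_bounds[where f' = "\<lambda>s. F' N s - f' s"] DERIV_diff dN d
            continuous_intros contN cont) auto
    then have "\<bar>marchaud \<alpha> (\<lambda>s. F N s - f s) t\<bar> \<le> (M + 4 * M / t) * A"
      unfolding A_def using a t by (intro marchaud_bound) auto
    also have "\<dots> = M * (1 + 4 / t) * A" by (simp add: algebra_simps)
    also have "\<dots> = e / 2"
    proof -
      have "1 + 4 / t > 0" using t by (simp add: add_pos_pos)
      then show ?thesis using A by (simp add: M_def)
    qed
    also have "\<dots> < e" using e by simp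
    finally show "norm (marchaud \<alpha> (F N) t - marchaud \<alpha> f t) < e"
      using marchaud_add_scaled[OF C' C, of \<alpha> "- 1"] a t by auto
  qed
qed

section \<open>Series in powers of $t^\kappa$\<close>

text \<open>\<open>marchaud_has_integral\<close> turns the left side into the integral of p s^(p-1)
  (t-s)^(-\<alpha>), which s = t r reduces to the Beta function at (p, 1 - \<alpha>). For p < 1 the
  derivative is unbounded at 0, which that lemma permits.\<close>

lemma marchaud_powr:
  fixes \<alpha> p t :: real
  assumes a: "0 < \<alpha>" "\<alpha> < 1" and p: "0 < p" and t: "0 < t"
  shows "marchaud \<alpha> (\<lambda>s. s powr p) t =
    Gamma (p + 1) * Gamma (1 - \<alpha>) / Gamma (p + 1 - \<alpha>) * t powr (p - \<alpha>)"
proof -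
  have d: "((\<lambda>s. s powr p) has_real_derivative p * s powr (p - 1)) (at s)" if "0 < s" for s
    using that by (auto intro!: derivative_eq_intros)
  have "continuous_on {0..t} (\<lambda>s. s powr p)"
    using p by (intro continuous_on_powr' continuous_intros) auto
  then obtain C where "lipschitz_end C (\<lambda>s. s powr p) t"
    using lipschitz_endI_differentiable d t by blast
  then have 1: "((\<lambda>s. p * s powr (p - 1) / (t - s) powr \<alpha>) has_integral marchaud \<alpha> (\<lambda>s. s powr p) t) {0..t}"
    using a t d by (intro marchaud_has_integral) auto
  have "((\<lambda>r. r powr (p - 1) * (1 - r) powr (1 - \<alpha> - 1)) has_integral Beta p (1 - \<alpha>)) (cbox 0 1)"
    using has_integral_Beta_real[OF p, of "1 - \<alpha>"] a by simp
  from has_integral_affinity'[OF this, of "1 / t" 0]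
  have "((\<lambda>s. (s / t) powr (p - 1) * (1 - s / t) powr (- \<alpha>)) has_integral t * Beta p (1 - \<alpha>)) {0..t}"
    using t by (simp add: mult.commute)
  from has_integral_mult_right[OF this, of "p * t powr (p - 1 - \<alpha>)"]
  have 2: "((\<lambda>s. p * t powr (p - 1 - \<alpha>) * ((s / t) powr (p - 1) * (1 - s / t) powr (- \<alpha>))) has_integral
      p * t powr (p - 1 - \<alpha>) * (t * Beta p (1 - \<alpha>))) {0..t}" .
  have "p * t powr (p - 1 - \<alpha>) * ((s / t) powr (p - 1) * (1 - s / t) powr (- \<alpha>)) =
      p * s powr (p - 1) / (t - s) powr \<alpha>" if s: "s \<in> {0..t}" for s
  proof -
    have "1 - s / t = (t - s) / t" using t by (simp add: field_simps)
    then have "(1 - s / t) powr (- \<alpha>) = (t - s) powr (- \<alpha>) / t powr (- \<alpha>)"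
      using s t by (simp add: powr_divide)
    moreover have "(s / t) powr (p - 1) = s powr (p - 1) / t powr (p - 1)"
      using s t by (simp add: powr_divide)
    moreover have "t powr (p - 1 - \<alpha>) = t powr (p - 1) * t powr (- \<alpha>)"
      by (simp add: powr_add[symmetric])
    ultimately show ?thesis using t by (simp add: powr_minus_divide[of "t - s"])
  qed
  then have "((\<lambda>s. p * s powr (p - 1) / (t - s) powr \<alpha>) has_integral
      p * t powr (p - 1 - \<alpha>) * (t * Beta p (1 - \<alpha>))) {0..t}"
    using 2 by (rule has_integral_eq)
  with 1 have "marchaud \<alpha> (\<lambda>s. s powr p) t = p * t powr (p - 1 - \<alpha>) * (t * Beta p (1 - \<alpha>))"
    by (rule has_integral_unique)
  also have "\<dots> = (p * Beta p (1 - \<alpha>)) * (t * t powr (p - 1 - \<alpha>))" by simp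
  also have "t * t powr (p - 1 - \<alpha>) = t powr (p - \<alpha>)"
    using t powr_mult_base[of t "p - 1 - \<alpha>"] by simp
  also have "p * Beta p (1 - \<alpha>) = Gamma (p + 1) * Gamma (1 - \<alpha>) / Gamma (p + 1 - \<alpha>)"
  proof -
    have "p \<notin> \<int>\<^sub>\<le>\<^sub>0" using p by (auto elim!: nonpos_Ints_cases)
    then have "Gamma (p + 1) = p * Gamma p" by (rule Gamma_plus1)
    then show ?thesis by (simp add: Beta_def algebra_simps)
  qed
  finally show ?thesis .
qed

lemma powr_power_real:
  fixes s \<kappa> :: real
  assumes "0 < n"
  shows "(s powr \<kappa>) ^ n = s powr (real n * \<kappa>)"
  using assms by (cases "s = 0") (auto simp: powr_power mult.commute zero_power)

definition power_series :: "(nat \<Rightarrow> real) \<Rightarrow> real \<Rightarrow> real" where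
  "power_series d z = (\<Sum>n. d n * z ^ n)"

text \<open>The second part is the Euler operator z d/dz, which multiplies the n-th coefficient by
  n; this is how derivatives become changes of coefficients below.\<close>

lemma power_series_derivative:
  fixes d :: "nat \<Rightarrow> real"
  assumes d: "\<And>z. summable (\<lambda>n. d n * z ^ n)"
  shows "(power_series d has_real_derivative power_series (diffs d) z) (at z)"
    and "z * power_series (diffs d) z = power_series (\<lambda>n. real n * d n) z"
    and "(\<lambda>n. real n * d n * z ^ (n - 1)) sums power_series (diffs d) z"
    and "isCont (power_series d) z"
proof -
  show 1: "(power_series d has_real_derivative power_series (diffs d) z) (at z)"
    unfolding power_series_def by (rule termdiffs_strong_converges_everywhere[OF d])
  then show "isCont (power_series d) z" by (rule DERIV_isCont)
  have s: "summable (\<lambda>n. diffs d n * z ^ n)" by (rule termdiff_converges_all[OF d])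
  show 2: "(\<lambda>n. real n * d n * z ^ (n - 1)) sums power_series (diffs d) z"
    using diffs_equiv[OF s] by (simp add: power_series_def)
  have "(\<lambda>n. z * (real n * d n * z ^ (n - 1))) sums (z * power_series (diffs d) z)"
    by (rule sums_mult[OF 2])
  moreover have "z * (real n * d n * z ^ (n - 1)) = real n * d n * z ^ n" for n
    by (cases n) auto
  ultimately have "(\<lambda>n. real n * d n * z ^ n) sums (z * power_series (diffs d) z)"
    by (simp only:)
  then show "z * power_series (diffs d) z = power_series (\<lambda>n. real n * d n) z"
    unfolding power_series_def[of "\<lambda>n. real n * d n"] by (rule sums_unique)
qed

lemma power_series_powr:
  fixes d :: "nat \<Rightarrow> real"
  assumes d: "\<And>z. summable (\<lambda>n. d n * z ^ n)" and k: "0 < \<kappa>"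
  shows "continuous_on {0..} (\<lambda>s. power_series d (s powr \<kappa>))"
    and "0 < s \<Longrightarrow> ((\<lambda>s. power_series d (s powr \<kappa>)) has_real_derivative
           \<kappa> * power_series (\<lambda>n. real n * d n) (s powr \<kappa>) / s) (at s)"
    and "0 < t \<Longrightarrow> \<exists>C. lipschitz_end C (\<lambda>s. power_series d (s powr \<kappa>)) t"
proof -
  have "continuous_on UNIV (power_series d)"
    using power_series_derivative(4)[OF d] by (simp add: continuous_at_imp_continuous_on)
  moreover have "continuous_on {0..} (\<lambda>s::real. s powr \<kappa>)"
    using k by (intro continuous_on_powr' continuous_intros) auto
  ultimately show 1: "continuous_on {0..} (\<lambda>s. power_series d (s powr \<kappa>))"
    by (rule continuous_on_compose2) auto
  show 2: "((\<lambda>s. power_series d (s powr \<kappa>)) has_real_derivative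
           \<kappa> * power_series (\<lambda>n. real n * d n) (s powr \<kappa>) / s) (at s)" if s: "0 < s" for s
  proof -
    have "((\<lambda>s. s powr \<kappa>) has_real_derivative \<kappa> * s powr (\<kappa> - 1)) (at s)"
      using s by (auto intro!: derivative_eq_intros)
    from DERIV_chain2[OF power_series_derivative(1)[OF d] this]
    have "((\<lambda>s. power_series d (s powr \<kappa>)) has_real_derivative
        power_series (diffs d) (s powr \<kappa>) * (\<kappa> * s powr (\<kappa> - 1))) (at s)" .
    moreover have "s powr (\<kappa> - 1) = s powr \<kappa> / s" using s by (simp add: powr_diff)
    ultimately show ?thesis
      using power_series_derivative(2)[OF d, of "s powr \<kappa>", symmetric] by (simp add: mult_ac)
  qed
  show "\<exists>C. lipschitz_end C (\<lambda>s. power_series d (s powr \<kappa>)) t" if "0 < t"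
    using that by (intro lipschitz_endI_differentiable[OF continuous_on_subset[OF 1] 2]) auto
qed

text \<open>Partial sums converge uniformly on [0, t] and their derivatives on [t/2, t], so
  \<open>marchaud_tendsto\<close> and \<open>marchaud_powr\<close> apply termwise. The constant term
  is annihilated, which is why the sum starts at \<open>Suc n\<close>.\<close>

lemma marchaud_power_series:
  fixes d :: "nat \<Rightarrow> real"
  assumes d: "\<And>z. summable (\<lambda>n. d n * z ^ n)" and k: "0 < \<kappa>"
    and a: "0 < \<alpha>" "\<alpha> < 1" and t: "0 < t"
  shows "(\<lambda>n. d (Suc n) * (Gamma (real (Suc n) * \<kappa> + 1) * Gamma (1 - \<alpha>) /
      Gamma (real (Suc n) * \<kappa> + 1 - \<alpha>) * t powr (real (Suc n) * \<kappa> - \<alpha>)))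
    sums marchaud \<alpha> (\<lambda>s. power_series d (s powr \<kappa>)) t"
proof -
  define m where "m = (\<lambda>n. \<lambda>s::real. (s powr \<kappa>) ^ n)"
  define m' where "m' = (\<lambda>n. \<lambda>s::real. real n * (s powr \<kappa>) ^ (n - 1) * (\<kappa> * s powr (\<kappa> - 1)))"
  \<comment> \<open>As a function of s, s^(\<kappa>-1) rises or falls according to the sign of
    \<kappa> - 1; the sum of both endpoint values dominates it on [t/2, t] in either case.\<close>
  define K where "K = (t / 2) powr (\<kappa> - 1) + t powr (\<kappa> - 1)"
  have dm: "(m n has_real_derivative m' n s) (at s)" if "0 < s" for n s
  proof -
    have "((\<lambda>s. s powr \<kappa>) has_real_derivative \<kappa> * s powr (\<kappa> - 1)) (at s)"
      using that by (auto intro!: derivative_eq_intros)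
    from DERIV_power[OF this, of n] show ?thesis unfolding m_def m'_def by (simp add: mult_ac)
  qed
  have cm: "continuous_on {0..t} (m n)" for n
    unfolding m_def using k by (intro continuous_intros continuous_on_powr') auto
  have lm: "\<exists>C. lipschitz_end C (m n) t" for n
    using lipschitz_endI_differentiable[OF cm dm[OF t] t] .
  define T where "T = t powr \<kappa>"
  have yT: "norm (s powr \<kappa>) \<le> norm T" "s powr \<kappa> \<le> T" if "s \<in> {0..t}" for s
    using that k by (auto simp: T_def intro: powr_mono2)
  have "(\<lambda>N. marchaud \<alpha> (\<lambda>s. \<Sum>n<N. d n * m n s) t) \<longlonglongrightarrow> marchaud \<alpha> (\<lambda>s. power_series d (s powr \<kappa>)) t"
  proof (rule marchaud_tendsto[OF a t])
    show "continuous_on {0..t} (\<lambda>s. \<Sum>n<N. d n * m n s)" for N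
      by (intro continuous_intros cm)
    show "((\<lambda>s. \<Sum>n<N. d n * m n s) has_real_derivative (\<Sum>n<N. d n * m' n s)) (at s)"
      if "s \<in> {t/2..t}" for N s
      using that t by (intro DERIV_sum DERIV_cmult dm) auto
    show "((\<lambda>s. power_series d (s powr \<kappa>)) has_real_derivative (\<Sum>n. d n * m' n s)) (at s)"
      if "s \<in> {t/2..t}" for s
    proof -
      have s: "0 < s" using that t by auto
      have "((\<lambda>s. s powr \<kappa>) has_real_derivative \<kappa> * s powr (\<kappa> - 1)) (at s)"
        using s by (auto intro!: derivative_eq_intros)
      from DERIV_chain2[OF power_series_derivative(1)[OF d] this]
      have "((\<lambda>s. power_series d (s powr \<kappa>)) has_real_derivative
          power_series (diffs d) (s powr \<kappa>) * (\<kappa> * s powr (\<kappa> - 1))) (at s)" .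
      moreover have "(\<lambda>n. real n * d n * (s powr \<kappa>) ^ (n - 1) * (\<kappa> * s powr (\<kappa> - 1))) sums
          (power_series (diffs d) (s powr \<kappa>) * (\<kappa> * s powr (\<kappa> - 1)))"
        by (rule sums_mult2[OF power_series_derivative(3)[OF d]])
      then have "(\<Sum>n. d n * m' n s) = power_series (diffs d) (s powr \<kappa>) * (\<kappa> * s powr (\<kappa> - 1))"
        by (simp add: sums_iff m'_def mult_ac)
      ultimately show ?thesis by simp
    qed
    show "uniform_limit {0..t} (\<lambda>N s. \<Sum>n<N. d n * m n s) (\<lambda>s. power_series d (s powr \<kappa>)) sequentially"
      unfolding power_series_def m_def
    proof (rule Weierstrass_m_test)
      show "norm (d n * (s powr \<kappa>) ^ n) \<le> norm (d n * T ^ n)" if "s \<in> {0..t}" for n s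
        using yT[OF that] by (simp add: abs_mult power_abs power_mono mult_left_mono)
      \<comment> \<open>Absolute convergence at T follows from convergence at the larger radius |T|
        + 1.\<close>
      show "summable (\<lambda>n. norm (d n * T ^ n))"
        by (rule powser_insidea[OF d, of _ "\<bar>T\<bar> + 1"]) auto
    qed
    show "uniform_limit {t/2..t} (\<lambda>N s. \<Sum>n<N. d n * m' n s) (\<lambda>s. \<Sum>n. d n * m' n s) sequentially"
    proof (rule Weierstrass_m_test)
      have "summable (\<lambda>n. norm (diffs d n * T ^ n))"
        by (rule powser_insidea[OF termdiff_converges_all[OF d], of _ "\<bar>T\<bar> + 1"]) auto
      then have "summable (\<lambda>n. (\<kappa> * K) * norm (real (Suc n) * d (Suc n) * T ^ (Suc n - 1)))"
        unfolding diffs_def by (intro summable_mult) simp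
      then show "summable (\<lambda>n. (\<kappa> * K) * norm (real n * d n * T ^ (n - 1)))"
        by (subst (asm) summable_Suc_iff)
      show "norm (d n * m' n s) \<le> (\<kappa> * K) * norm (real n * d n * T ^ (n - 1))" if s: "s \<in> {t/2..t}" for n s
      proof -
        have "s powr (\<kappa> - 1) \<le> K"
        proof (cases "\<kappa> \<ge> 1")
          case True
          then have "s powr (\<kappa> - 1) \<le> t powr (\<kappa> - 1)" using s t by (intro powr_mono2) auto
          then show ?thesis by (simp add: K_def add_increasing)
        next
          case False
          then have "s powr (\<kappa> - 1) \<le> (t/2) powr (\<kappa> - 1)" using s t by (intro powr_mono2') auto
          then show ?thesis by (simp add: K_def add_increasing2)
        qed
        moreover have "(s powr \<kappa>) ^ (n - 1) \<le> T ^ (n - 1)"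
          using yT(2)[of s] s t by (intro power_mono) auto
        ultimately have "(s powr \<kappa>) ^ (n - 1) * s powr (\<kappa> - 1) \<le> T ^ (n - 1) * K"
          by (intro mult_mono) (auto simp: T_def)
        then have "real n * \<bar>d n\<bar> * \<kappa> * ((s powr \<kappa>) ^ (n - 1) * s powr (\<kappa> - 1)) \<le> real n * \<bar>d n\<bar> * \<kappa> * (T ^ (n - 1) * K)"
          using k by (intro mult_left_mono) auto
        moreover have "T \<ge> 0" by (simp add: T_def)
        ultimately show ?thesis using k
          by (simp add: m'_def abs_mult power_abs mult_ac)
      qed
    qed
  qed
  moreover have "marchaud \<alpha> (\<lambda>s. \<Sum>n<N. d n * m n s) t = (\<Sum>n<N. d n * marchaud \<alpha> (m n) t)" for N
    using marchaud_sum[of "{..<N}" m t \<alpha> d] lm a t by auto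
  ultimately have "(\<lambda>n. d n * marchaud \<alpha> (m n) t) sums marchaud \<alpha> (\<lambda>s. power_series d (s powr \<kappa>)) t"
    by (simp add: sums_def)
  moreover have "marchaud \<alpha> (m 0) t = 0" by (simp add: m_def marchaud_def)
  ultimately have "(\<lambda>n. d (Suc n) * marchaud \<alpha> (m (Suc n)) t) sums marchaud \<alpha> (\<lambda>s. power_series d (s powr \<kappa>)) t"
    by (subst sums_Suc_iff) simp
  moreover have "marchaud \<alpha> (m (Suc n)) t = Gamma (real (Suc n) * \<kappa> + 1) * Gamma (1 - \<alpha>) /
      Gamma (real (Suc n) * \<kappa> + 1 - \<alpha>) * t powr (real (Suc n) * \<kappa> - \<alpha>)" for n
    unfolding m_def powr_power_real[OF zero_less_Suc] using a t k by (intro marchaud_powr) auto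
  ultimately show ?thesis by simp
qed

section \<open>The Kilbas--Saigo function on the negative half-axis\<close>

text \<open>Log-convexity of Gamma at y - \<alpha> = (1 - \<alpha>) y + \<alpha> (y - 1), combined
  with Gamma y = (y - 1) Gamma (y - 1).\<close>

lemma Gamma_real_shift_le:
  fixes y \<alpha> :: real
  assumes y: "1 < y" and a: "0 < \<alpha>" "\<alpha> < 1"
  shows "Gamma (y - \<alpha>) \<le> Gamma y * (y - 1) powr (- \<alpha>)"
proof -
  have "(ln \<circ> Gamma) ((1 - \<alpha>) *\<^sub>R y + \<alpha> *\<^sub>R (y - 1)) \<le> (1 - \<alpha>) * (ln \<circ> Gamma) y + \<alpha> * (ln \<circ> Gamma) (y - 1)"
    using y a by (intro convex_onD[OF log_convex_Gamma_real]) auto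
  moreover have "(1 - \<alpha>) *\<^sub>R y + \<alpha> *\<^sub>R (y - 1) = y - \<alpha>" by (simp add: algebra_simps)
  ultimately have 1: "ln (Gamma (y - \<alpha>)) \<le> (1 - \<alpha>) * ln (Gamma y) + \<alpha> * ln (Gamma (y - 1))"
    by simp
  have "y - 1 \<notin> \<int>\<^sub>\<le>\<^sub>0" using y by (auto elim!: nonpos_Ints_cases)
  then have "Gamma y = (y - 1) * Gamma (y - 1)" using Gamma_plus1[of "y - 1"] by simp
  moreover have "0 < Gamma (y - 1)" using y by (intro Gamma_real_pos) simp
  ultimately have "ln (Gamma y) = ln (y - 1) + ln (Gamma (y - 1))"
    using y by (metis diff_gt_0_iff_gt ln_mult_pos)
  with 1 have "ln (Gamma (y - \<alpha>)) \<le> ln (Gamma y) + (- \<alpha>) * ln (y - 1)"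
    by (simp add: algebra_simps)
  also have "\<dots> = ln (Gamma y * (y - 1) powr (- \<alpha>))"
  proof -
    have "0 < Gamma y" "0 < (y - 1) powr (- \<alpha>)" using y by (auto intro: Gamma_real_pos)
    then show ?thesis using y by (simp add: ln_mult_pos ln_powr)
  qed
  finally show ?thesis
    using y a Gamma_real_pos[of y] Gamma_real_pos[of "y - \<alpha>"] by simp
qed

text \<open>A function whose fractional derivative is positive wherever it is negative cannot become
  negative: at its minimum over an initial interval the Marchaud form is negative.\<close>

lemma marchaud_max_principle:
  assumes a: "0 < \<alpha>" "\<alpha> < 1"
    and lip: "\<And>t. 0 < t \<Longrightarrow> \<exists>C. lipschitz_end C f t"
    and f0: "0 \<le> f 0"
    and pos: "\<And>t. 0 < t \<Longrightarrow> f t < 0 \<Longrightarrow> 0 \<le> marchaud \<alpha> f t"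
    and T: "0 \<le> T"
  shows "0 \<le> f T"
proof (rule ccontr)
  assume neg: "\<not> 0 \<le> f T"
  then have T0: "0 < T" using f0 T by (cases "T = 0") auto
  then have "continuous_on {0..T} f" using lip unfolding lipschitz_end_def by blast
  then obtain t where t: "t \<in> {0..T}" and min: "\<And>s. s \<in> {0..T} \<Longrightarrow> f t \<le> f s"
    using continuous_attains_inf[of "{0..T}" f] T by auto
  have ft: "f t < 0" using min[of T] neg T by auto
  then have t0: "0 < t" using f0 t by (cases "t = 0") auto
  obtain C where C: "lipschitz_end C f t" using lip[OF t0] by blast
  have "0 \<le> integral {0..t} (\<lambda>s. (f s - f t) * (t - s) powr (- \<alpha> - 1))"
    using marchaud_integrable[OF C a(2)] t0 min t by (intro integral_nonneg) auto
  then have "0 \<le> \<alpha> * integral {0..t} (\<lambda>s. (f s - f t) * (t - s) powr (- \<alpha> - 1))"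
    using a by simp
  moreover have "(f t - f 0) * t powr (- \<alpha>) < 0"
    using ft f0 t0 by (intro mult_neg_pos) auto
  ultimately have "marchaud \<alpha> f t < 0" by (simp add: marchaud_def)
  then show False using pos[OF t0 ft] by simp
qed

definition bounded_mono :: "real \<Rightarrow> (real \<Rightarrow> real) \<Rightarrow> bool" where
  "bounded_mono C U \<longleftrightarrow> mono_on {0..} U \<and> (\<forall>z\<ge>0. 0 \<le> U z \<and> U z \<le> C)"

text \<open>A Jordan decomposition: w has bounded variation on the half-line, with an explicit
  bound. For nonnegative nondecreasing L and any z \<ge> 0 the variation of the sequence w(L n z) is
  then controlled by C alone, which is the uniformity that Abel summation needs.\<close>

definition bounded_mono_diff :: "real \<Rightarrow> (real \<Rightarrow> real) \<Rightarrow> bool" where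
  "bounded_mono_diff C w \<longleftrightarrow>
     (\<exists>U V. bounded_mono C U \<and> bounded_mono C V \<and> (\<forall>z\<ge>0. w z = U z - V z))"

lemma bounded_monoI_derivative:
  assumes cont: "continuous_on {0..} U"
    and d: "\<And>z. 0 < z \<Longrightarrow> (U has_real_derivative U' z) (at z)" and d0: "\<And>z. 0 < z \<Longrightarrow> 0 \<le> U' z"
    and "0 \<le> U 0" and up: "\<And>z. 0 \<le> z \<Longrightarrow> U z \<le> C"
  shows "bounded_mono C U"
proof -
  have mono: "U a \<le> U b" if "0 \<le> a" "a \<le> b" for a b
  proof (rule DERIV_nonneg_imp_increasing_open[OF that(2)])
    show "\<exists>y. DERIV U x :> y \<and> 0 \<le> y" if "a < x" "x < b" for x
      using d[of x] d0[of x] that \<open>0 \<le> a\<close> by (intro exI[of _ "U' x"]) auto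
    show "continuous_on {a..b} U" using that by (intro continuous_on_subset[OF cont]) auto
  qed
  have "0 \<le> U z" if "0 \<le> z" for z using mono[OF _ that] assms(4) by force
  then show ?thesis
    using up mono unfolding bounded_mono_def by (auto intro!: mono_onI)
qed

section \<open>Weighted power series with the Kilbas-Saigo coefficients\<close>

locale kilbas_saigo_params =
  fixes \<alpha> \<gamma> :: real
  assumes alpha: "0 < \<alpha>" "\<alpha> < 1" and gamma: "0 \<le> \<gamma>"
begin

definition kappa :: real where "kappa = \<alpha> + \<gamma>"

lemma kappa_pos: "0 < kappa" using alpha gamma by (simp add: kappa_def)

text \<open>The coefficients c_n for a = \<alpha>, m = 1 + \<gamma>/\<alpha>, l = \<gamma>/\<alpha>,
  where a m = kappa and a l = \<gamma>. For p = (k + 1) kappa each factor is Gamma(p + 1 - \<alpha>)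
  / Gamma(p + 1), the inverse of the Gamma quotient that \<open>marchaud_powr\<close>
  produces.\<close>

definition coef :: "nat \<Rightarrow> real" where
  "coef n = (\<Prod>k<n. Gamma (1 + real k * kappa + \<gamma>) / Gamma (1 + real (Suc k) * kappa))"

lemma coef_0 [simp]: "coef 0 = 1" by (simp add: coef_def)

lemma coef_Suc: "coef (Suc n) = coef n * (Gamma (1 + real n * kappa + \<gamma>) / Gamma (1 + real (Suc n) * kappa))"
  by (simp add: coef_def)

lemma coef_pos: "0 < coef n"
  unfolding coef_def using kappa_pos gamma
  by (intro prod_pos divide_pos_pos Gamma_real_pos ballI) (auto intro!: add_pos_nonneg)

text \<open>The ratio of consecutive coefficients is Gamma(y - \<alpha>) / Gamma(y) with y = 1 + (n
  + 1) kappa; its decay makes the series below entire.\<close>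

lemma coef_Suc_le: "coef (Suc n) \<le> coef n * (real (Suc n) * kappa) powr (- \<alpha>)"
proof -
  have k: "1 < 1 + real (Suc n) * kappa" using kappa_pos by simp
  have "1 + real n * kappa + \<gamma> = 1 + real (Suc n) * kappa - \<alpha>"
    by (simp add: kappa_def algebra_simps)
  then have "Gamma (1 + real n * kappa + \<gamma>) \<le> Gamma (1 + real (Suc n) * kappa) * (real (Suc n) * kappa) powr (- \<alpha>)"
    using Gamma_real_shift_le[OF k alpha] by (simp only: add_diff_cancel_left')
  then have "Gamma (1 + real n * kappa + \<gamma>) / Gamma (1 + real (Suc n) * kappa) \<le> (real (Suc n) * kappa) powr (- \<alpha>)"
    using k by (subst pos_divide_le_eq) (auto intro: Gamma_real_pos simp: mult.commute)
  then show ?thesis unfolding coef_Suc using coef_pos[of n] by (intro mult_left_mono) auto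
qed

lemma summable_coef_power: "summable (\<lambda>n. coef n * R ^ n)" if R: "0 \<le> R"
proof -
  have lin: "filterlim (\<lambda>n. real (Suc n) * kappa) at_top sequentially"
    using kappa_pos by real_asymp
  have "((\<lambda>n. R * (real (Suc n) * kappa) powr (- \<alpha>)) \<longlongrightarrow> R * 0) sequentially"
    using alpha by (intro tendsto_mult tendsto_const tendsto_neg_powr lin) auto
  then have "\<forall>\<^sub>F n in sequentially. R * (real (Suc n) * kappa) powr (- \<alpha>) < 1/2"
    by (intro order_tendstoD) auto
  then obtain N where N: "\<And>n. n \<ge> N \<Longrightarrow> R * (real (Suc n) * kappa) powr (- \<alpha>) < 1/2"
    unfolding eventually_sequentially by blast
  show ?thesis
  proof (rule summable_ratio_test[of "1/2" N])
    fix n assume n: "N \<le> n"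
    have "norm (coef (Suc n) * R ^ Suc n) = coef (Suc n) * (R * R ^ n)"
      using coef_pos[of "Suc n"] R by (simp add: abs_mult)
    also have "\<dots> \<le> (coef n * (real (Suc n) * kappa) powr (- \<alpha>)) * (R * R ^ n)"
      using coef_Suc_le R by (intro mult_right_mono) auto
    also have "\<dots> = (R * (real (Suc n) * kappa) powr (- \<alpha>)) * (coef n * R ^ n)" by (simp add: mult_ac)
    also have "\<dots> \<le> 1/2 * (coef n * R ^ n)"
      using N[OF n] coef_pos[of n] R by (intro mult_right_mono) auto
    also have "coef n * R ^ n = norm (coef n * R ^ n)" using coef_pos[of n] R by (simp add: abs_mult)
    finally show "norm (coef (Suc n) * R ^ Suc n) \<le> 1/2 * norm (coef n * R ^ n)" .
  qed simp
qed

text \<open>The weights x encode operators on E(-z): x n = 1 is E itself, z d/dz multiplies x n by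
  n, and the fractional derivative shifts x, see \<open>marchaud_ks\<close>. Weights bounded by
  \<open>4 ^ n\<close> keep the series entire.\<close>

definition ks_coeff :: "(nat \<Rightarrow> real) \<Rightarrow> nat \<Rightarrow> real" where
  "ks_coeff x n = x n * (coef n * (- 1) ^ n)"

lemma summable_ks_coeff:
  assumes x: "\<And>n. \<bar>x n\<bar> \<le> 4 ^ n"
  shows "summable (\<lambda>n. ks_coeff x n * z ^ n)"
proof (rule summable_comparison_test')
  show "summable (\<lambda>n. coef n * (4 * \<bar>z\<bar>) ^ n)" by (rule summable_coef_power) simp
  show "norm (ks_coeff x n * z ^ n) \<le> coef n * (4 * \<bar>z\<bar>) ^ n" for n
  proof -
    have "norm (ks_coeff x n * z ^ n) = \<bar>x n\<bar> * (coef n * \<bar>z\<bar> ^ n)"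
      using coef_pos[of n] by (simp add: ks_coeff_def abs_mult power_abs)
    also have "\<dots> \<le> 4 ^ n * (coef n * \<bar>z\<bar> ^ n)"
      using x coef_pos[of n] by (intro mult_right_mono) auto
    finally show ?thesis by (simp add: power_mult_distrib mult_ac)
  qed
qed

definition ks :: "(nat \<Rightarrow> real) \<Rightarrow> real \<Rightarrow> real" where
  "ks x = power_series (ks_coeff x)"

lemma ks_0 [simp]: "ks x 0 = x 0"
  by (simp add: ks_def power_series_def ks_coeff_def)

lemma ks_add: "ks (\<lambda>n. c * x n + d * y n) z = c * ks x z + d * ks y z"
  if "\<And>n. \<bar>x n\<bar> \<le> 4 ^ n" "\<And>n. \<bar>y n\<bar> \<le> 4 ^ n"
proof -
  have "(\<lambda>n. c * (ks_coeff x n * z ^ n) + d * (ks_coeff y n * z ^ n)) sums (c * ks x z + d * ks y z)"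
    unfolding ks_def power_series_def
    by (intro sums_add sums_mult summable_sums summable_ks_coeff that)
  then have "(\<lambda>n. ks_coeff (\<lambda>n. c * x n + d * y n) n * z ^ n) sums (c * ks x z + d * ks y z)"
    by (simp add: ks_coeff_def algebra_simps)
  then show ?thesis unfolding ks_def power_series_def by (rule sums_unique[symmetric])
qed

text \<open>The Gamma quotient from differentiating the power of order n + 1 turns
  \<open>coef (Suc n)\<close> into \<open>coef n\<close>, so only a shift of the weights and a
  common factor remain. For constant weights this is the fractional relaxation equation; polynomial
  weights give the equations obtained from it by differentiating in z.\<close>

lemma marchaud_ks:
  assumes x: "\<And>n. \<bar>x n\<bar> \<le> 4 ^ n" and y: "\<And>n. \<bar>x (Suc n)\<bar> \<le> 4 ^ n" and l: "0 \<le> L" and t: "0 < t"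
  shows "marchaud \<alpha> (\<lambda>s. ks x (L * s powr kappa)) t =
     - L * Gamma (1 - \<alpha>) * t powr \<gamma> * ks (\<lambda>n. x (Suc n)) (L * t powr kappa)"
proof -
  define d where "d = (\<lambda>n. ks_coeff x n * L ^ n)"
  have d: "summable (\<lambda>n. d n * z ^ n)" for z
    using summable_ks_coeff[of x "L * z"] x by (simp add: d_def power_mult_distrib mult_ac)
  have eq: "(\<lambda>s. ks x (L * s powr kappa)) = (\<lambda>s. power_series d (s powr kappa))"
    by (simp add: fun_eq_iff ks_def power_series_def d_def power_mult_distrib mult_ac)
  have "(\<lambda>n. - L * Gamma (1 - \<alpha>) * t powr \<gamma> * (ks_coeff (\<lambda>n. x (Suc n)) n * (L * t powr kappa) ^ n)) sums
      (- L * Gamma (1 - \<alpha>) * t powr \<gamma> * ks (\<lambda>n. x (Suc n)) (L * t powr kappa))"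
    unfolding ks_def power_series_def by (intro sums_mult summable_sums summable_ks_coeff y)
  moreover have "d (Suc n) * (Gamma (real (Suc n) * kappa + 1) * Gamma (1 - \<alpha>) /
      Gamma (real (Suc n) * kappa + 1 - \<alpha>) * t powr (real (Suc n) * kappa - \<alpha>)) =
      - L * Gamma (1 - \<alpha>) * t powr \<gamma> * (ks_coeff (\<lambda>n. x (Suc n)) n * (L * t powr kappa) ^ n)" for n
  proof -
    \<comment> \<open>Since kappa = \<alpha> + \<gamma>, subtracting \<alpha> from (n + 1) kappa
      leaves n kappa + \<gamma>, the argument in the recursion of \<open>coef\<close>.\<close>
    have 1: "real (Suc n) * kappa + 1 - \<alpha> = 1 + real n * kappa + \<gamma>"
      by (simp add: kappa_def algebra_simps)
    have 2: "real (Suc n) * kappa - \<alpha> = \<gamma> + real n * kappa"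
      by (simp add: kappa_def algebra_simps)
    have g: "Gamma (1 + real n * kappa + \<gamma>) > 0" "Gamma (1 + real (Suc n) * kappa) > 0"
      using kappa_pos gamma by (auto intro!: Gamma_real_pos add_pos_nonneg)
    have c: "coef (Suc n) * (Gamma (real (Suc n) * kappa + 1) / Gamma (1 + real n * kappa + \<gamma>)) = coef n"
      unfolding coef_Suc add.commute[of _ 1] using g by (simp add: add.assoc)
    have p: "t powr (\<gamma> + real n * kappa) = t powr \<gamma> * (t powr kappa) ^ n"
      using t by (simp add: powr_add powr_power mult.commute)
    have "d (Suc n) * (Gamma (real (Suc n) * kappa + 1) * Gamma (1 - \<alpha>) /
        Gamma (real (Suc n) * kappa + 1 - \<alpha>) * t powr (real (Suc n) * kappa - \<alpha>)) =
        x (Suc n) * ((-1) ^ Suc n) * L ^ Suc n * Gamma (1 - \<alpha>) * (t powr \<gamma> * (t powr kappa) ^ n) *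
        (coef (Suc n) * (Gamma (real (Suc n) * kappa + 1) / Gamma (1 + real n * kappa + \<gamma>)))"
      unfolding 1 2 p d_def ks_coeff_def by (simp only: mult_ac times_divide_eq_right times_divide_eq_left)
    then show ?thesis unfolding c by (simp add: ks_coeff_def power_mult_distrib mult_ac)
  qed
  moreover have "(\<lambda>n. d (Suc n) * (Gamma (real (Suc n) * kappa + 1) * Gamma (1 - \<alpha>) /
      Gamma (real (Suc n) * kappa + 1 - \<alpha>) * t powr (real (Suc n) * kappa - \<alpha>)))
    sums marchaud \<alpha> (\<lambda>s. power_series d (s powr kappa)) t"
    by (rule marchaud_power_series[OF d kappa_pos alpha t])
  ultimately show ?thesis unfolding eq using sums_unique2 by auto
qed

lemma ks_powr:
  assumes x: "\<And>n. \<bar>x n\<bar> \<le> 4 ^ n" and y: "\<And>n. \<bar>real n * x n\<bar> \<le> 4 ^ n"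
  shows "continuous_on {0..} (\<lambda>s. ks x (L * s powr kappa))"
    and "0 < s \<Longrightarrow> ((\<lambda>s. ks x (L * s powr kappa)) has_real_derivative
           kappa * ks (\<lambda>n. real n * x n) (L * s powr kappa) / s) (at s)"
    and "0 < t \<Longrightarrow> \<exists>C. lipschitz_end C (\<lambda>s. ks x (L * s powr kappa)) t"
proof -
  define d where "d = (\<lambda>n. ks_coeff x n * L ^ n)"
  have d: "summable (\<lambda>n. d n * z ^ n)" for z
    using summable_ks_coeff[of x "L * z"] x by (simp add: d_def power_mult_distrib mult_ac)
  have eq: "(\<lambda>s. ks x (L * s powr kappa)) = (\<lambda>s. power_series d (s powr kappa))"
    by (simp add: fun_eq_iff ks_def power_series_def d_def power_mult_distrib mult_ac)
  have eq': "power_series (\<lambda>n. real n * d n) z = ks (\<lambda>n. real n * x n) (L * z)" for z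
    by (simp add: ks_def power_series_def d_def ks_coeff_def power_mult_distrib mult_ac)
  show "continuous_on {0..} (\<lambda>s. ks x (L * s powr kappa))"
    unfolding eq by (rule power_series_powr[OF d kappa_pos])
  show "0 < s \<Longrightarrow> ((\<lambda>s. ks x (L * s powr kappa)) has_real_derivative
           kappa * ks (\<lambda>n. real n * x n) (L * s powr kappa) / s) (at s)"
    unfolding eq eq'[symmetric] by (rule power_series_powr[OF d kappa_pos])
  show "0 < t \<Longrightarrow> \<exists>C. lipschitz_end C (\<lambda>s. ks x (L * s powr kappa)) t"
    unfolding eq by (rule power_series_powr[OF d kappa_pos])
qed

lemma ks_derivative:
  assumes x: "\<And>n. \<bar>x n\<bar> \<le> 4 ^ n" and z: "z > 0"
  shows "(ks x has_real_derivative ks (\<lambda>n. real n * x n) z / z) (at z)"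
proof -
  have eq: "power_series (\<lambda>n. real n * ks_coeff x n) z = ks (\<lambda>n. real n * x n) z"
    by (simp add: ks_def power_series_def ks_coeff_def mult_ac)
  have "power_series (diffs (ks_coeff x)) z = ks (\<lambda>n. real n * x n) z / z"
    using power_series_derivative(2)[of "ks_coeff x" z] summable_ks_coeff[of x] x z by (simp add: eq field_simps)
  then show ?thesis
    using power_series_derivative(1)[of "ks_coeff x" z] summable_ks_coeff[of x] x unfolding ks_def by simp
qed

lemma ks_continuous:
  assumes x: "\<And>n. \<bar>x n\<bar> \<le> 4 ^ n"
  shows "continuous_on A (ks x)"
  unfolding ks_def using power_series_derivative(4)[of "ks_coeff x"] summable_ks_coeff[of x] x
  by (auto intro!: continuous_at_imp_continuous_on)

section \<open>Positivity, monotonicity and convexity of E(-z)\<close>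

text \<open>\<open>ks0 z\<close> is $E(-z)$; \<open>ks1\<close> and \<open>ks2\<close> are $z\,\frac{d}{dz}E(-z)$ and $z^2\frac{d^2}{dz^2}E(-z)$.\<close>

definition ks0 where "ks0 = ks (\<lambda>_. 1)"
definition ks1 where "ks1 = ks (\<lambda>n. real n)"
definition ks2 where "ks2 = ks (\<lambda>n. real n * (real n - 1))"

text \<open>All cases follow from n^3 \<le> 4^n and n (n + 1) \<le> 4^n; the cube arises from
  differentiating \<open>ks2\<close>, whose weights are quadratic.\<close>

lemma weight_bounds:
  "\<bar>1\<bar> \<le> (4::real) ^ n" "\<bar>real n\<bar> \<le> 4 ^ n" "\<bar>real n - 1\<bar> \<le> 4 ^ n" "\<bar>real (Suc n)\<bar> \<le> 4 ^ n"
  "\<bar>real n * real n\<bar> \<le> 4 ^ n" "\<bar>real n * (real n - 1)\<bar> \<le> 4 ^ n"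
  "\<bar>real n * (real n * (real n - 1))\<bar> \<le> 4 ^ n" "\<bar>real (Suc n) * (real (Suc n) - 1)\<bar> \<le> 4 ^ n"
proof -
  have sq: "real n * real n * real n \<le> 4 ^ n" for n
  proof (induction n)
    case (Suc n)
    show ?case
    proof (cases "n \<le> 1")
      case True
      then show ?thesis by (cases n) auto
    next
      case False
      then have n: "2 \<le> real n" by simp
      \<comment> \<open>Each induction step then costs at most (3/2)^3 = 27/8, which is below
        4.\<close>
      have "real (Suc n) \<le> 3/2 * real n" using n by simp
      then have "real (Suc n) * real (Suc n) * real (Suc n) \<le> (3/2 * real n) * (3/2 * real n) * (3/2 * real n)"
        by (intro mult_mono) auto
      also have "\<dots> \<le> 4 * (real n * real n * real n)" by simp
      finally show ?thesis using Suc by simp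
    qed
  qed simp
  have pr: "real (Suc n) * real n \<le> 4 ^ n" for n
  proof (induction n)
    case (Suc n)
    show ?case
    proof (cases "n = 0")
      case False
      then have n: "1 \<le> real n" by simp
      have "real (Suc (Suc n)) * real (Suc n) \<le> (4 * real n) * real (Suc n)"
        using n by (intro mult_right_mono) auto
      also have "\<dots> \<le> 4 * 4 ^ n" using Suc by (simp add: algebra_simps)
      finally show ?thesis by simp
    qed auto
  qed simp
  show "\<bar>1\<bar> \<le> (4::real) ^ n" by simp
  have c: "n = 0 \<or> 1 \<le> real n" by (cases n) auto
  have one: "(1::real) \<le> 4 ^ n" by simp
  have le: "y \<le> y * real n" if "1 \<le> real n" "0 \<le> y" for y
    using mult_left_mono[OF that] by simp
  have l': "real n \<le> real n * real n" using c le[of "real n"] by fastforce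
  have q': "real n * real n \<le> real n * real n * real n" using c le[of "real n * real n"] by fastforce
  from q' sq[of n] have q: "real n * real n \<le> 4 ^ n" by linarith
  then show "\<bar>real n * real n\<bar> \<le> 4 ^ n" by simp
  from l' q have l: "real n \<le> 4 ^ n" by linarith
  then show "\<bar>real n\<bar> \<le> 4 ^ n" by simp
  from l one show "\<bar>real n - 1\<bar> \<le> 4 ^ n" by linarith
  have "real (Suc n) \<le> real (Suc n) * real n" if "1 \<le> real n" using le[OF that, of "real (Suc n)"] by simp
  with pr[of n] c one have "real (Suc n) \<le> 4 ^ n" by (metis of_nat_1 One_nat_def order_trans)
  then show "\<bar>real (Suc n)\<bar> \<le> 4 ^ n" by simp
  have "real n * (real n - 1) \<le> real n * real n" "0 \<le> real n * (real n - 1)"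
    using c by (auto intro: mult_left_mono)
  with q show "\<bar>real n * (real n - 1)\<bar> \<le> 4 ^ n" by linarith
  have "real n * (real n * (real n - 1)) \<le> real n * (real n * real n)" "0 \<le> real n * (real n * (real n - 1))"
    using c by (auto intro: mult_left_mono)
  with sq[of n] show "\<bar>real n * (real n * (real n - 1))\<bar> \<le> 4 ^ n" by (simp add: mult.assoc)
  show "\<bar>real (Suc n) * (real (Suc n) - 1)\<bar> \<le> 4 ^ n" using pr[of n] by simp
qed

text \<open>The substitution z = t^kappa with L = 1 carries \<open>marchaud_max_principle\<close>
  over to the variable z: by \<open>marchaud_ks\<close> the fractional derivative is a negative
  multiple of the shifted series.\<close>

lemma ks_nonneg_if:
  assumes x: "\<And>n. \<bar>x n\<bar> \<le> 4 ^ n" "\<And>n. \<bar>x (Suc n)\<bar> \<le> 4 ^ n" "\<And>n. \<bar>real n * x n\<bar> \<le> 4 ^ n"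
    and x0: "0 \<le> x 0" and neg: "\<And>z. 0 \<le> z \<Longrightarrow> ks x z < 0 \<Longrightarrow> ks (\<lambda>n. x (Suc n)) z \<le> 0"
    and z: "0 \<le> z"
  shows "0 \<le> ks x z"
proof -
  define t where "t = z powr (1 / kappa)"
  have "0 \<le> ks x (1 * t powr kappa)"
  proof (rule marchaud_max_principle[OF alpha, where f = "\<lambda>t. ks x (1 * t powr kappa)"])
    show "\<exists>C. lipschitz_end C (\<lambda>t. ks x (1 * t powr kappa)) t" if "0 < t" for t
      using ks_powr(3)[of x t 1] x that by auto
    show "0 \<le> ks x (1 * 0 powr kappa)" using x0 by simp
    show "0 \<le> marchaud \<alpha> (\<lambda>t. ks x (1 * t powr kappa)) t" if t: "0 < t" and n: "ks x (1 * t powr kappa) < 0" for t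
    proof -
      have "ks (\<lambda>n. x (Suc n)) (t powr kappa) \<le> 0" using neg n by simp
      moreover have "0 < Gamma (1 - \<alpha>)" using alpha by (intro Gamma_real_pos) auto
      ultimately show ?thesis
        unfolding marchaud_ks[OF x(1,2) zero_le_one t] by (auto intro: mult_nonneg_nonpos)
    qed
  qed (simp add: t_def)
  then show ?thesis using z kappa_pos by (simp add: t_def powr_powr)
qed

text \<open>Constant weights equal their own shift, so where E(-z) is negative the shifted series is
  negative as well.\<close>

lemma ks0_nonneg: "0 \<le> ks0 z" if "0 \<le> z"
  unfolding ks0_def using weight_bounds that by (intro ks_nonneg_if) auto

text \<open>Shifting the weights -n produces - ks1 - ks0; where - ks1 is negative this is \<le> 0,
  because ks0 \<ge> 0. Hence E(-z) is nonincreasing.\<close>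

lemma ks1_nonpos: "ks1 z \<le> 0" if z: "0 \<le> z"
proof -
  have 1: "ks (\<lambda>n. - real n) z = - ks1 z" for z
    using ks_add[of "\<lambda>n. real n" "\<lambda>n. 0" "-1" 0 z] weight_bounds(2) by (simp add: ks1_def)
  have 2: "ks (\<lambda>n. - real (Suc n)) z = - ks1 z - ks0 z" for z
    using ks_add[of "\<lambda>n. real n" "\<lambda>n. 1" "-1" "-1" z] weight_bounds(1,2) by (simp add: ks1_def ks0_def algebra_simps)
  have "0 \<le> ks (\<lambda>n. - real n) z"
  proof (rule ks_nonneg_if[OF _ _ _ _ _ z])
    show "ks (\<lambda>n. - real (Suc n)) z \<le> 0" if "0 \<le> z" "ks (\<lambda>n. - real n) z < 0" for z
      using that ks0_nonneg[of z] unfolding 1 2 by simp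
  qed (use weight_bounds(2,4,5) in \<open>auto simp: add.commute\<close>)
  then show ?thesis unfolding 1 by simp
qed

text \<open>The shift of n (n - 1) is (n + 1) n = n (n - 1) + 2 n, that is, ks2 + 2 ks1, and ks1
  \<le> 0. Hence E(-z) is convex.\<close>

lemma ks2_nonneg: "0 \<le> ks2 z" if z: "0 \<le> z"
proof -
  have 2: "ks (\<lambda>n. real (Suc n) * (real (Suc n) - 1)) z = ks2 z + 2 * ks1 z" for z
    using ks_add[of "\<lambda>n. real n * (real n - 1)" "\<lambda>n. real n" 1 2 z] weight_bounds(2,6)
    by (simp add: ks1_def ks2_def algebra_simps)
  show ?thesis unfolding ks2_def
  proof (rule ks_nonneg_if[OF _ _ _ _ _ z])
    show "ks (\<lambda>n. real (Suc n) * (real (Suc n) - 1)) z \<le> 0"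
      if "0 \<le> z" "ks (\<lambda>n. real n * (real n - 1)) z < 0" for z
      using that ks1_nonpos[of z] unfolding 2 by (simp add: ks2_def)
  qed (use weight_bounds(6,7,8) in auto)
qed

lemma ks0_0 [simp]: "ks0 0 = 1" by (simp add: ks0_def)

lemma ks1_0 [simp]: "ks1 0 = 0" by (simp add: ks1_def)

lemma ks_continuous_on: "continuous_on A ks0" "continuous_on A ks1"
  unfolding ks0_def ks1_def using weight_bounds by (intro ks_continuous; simp)+

lemma bounded_mono_ks0: "bounded_mono 1 (\<lambda>z. 1 - ks0 z)"
proof (rule bounded_monoI_derivative)
  show "((\<lambda>z. 1 - ks0 z) has_real_derivative (0 - ks1 z / z)) (at z)" if "0 < z" for z
    using ks_derivative[of "\<lambda>_. 1" z] weight_bounds(1) that unfolding ks0_def ks1_def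
    by (intro DERIV_diff DERIV_const) auto
  show "0 \<le> 0 - ks1 z / z" if "0 < z" for z
    using ks1_nonpos[of z] that by (simp add: divide_nonpos_pos)
  show "1 - ks0 z \<le> 1" if "0 \<le> z" for z using ks0_nonneg[OF that] by simp
qed (auto intro!: continuous_intros ks_continuous_on)

lemma ks0_le: "ks0 z \<le> 1" if "0 \<le> z"
  using bounded_mono_ks0 that by (auto simp: bounded_mono_def)

text \<open>Adding 1 - E(-z) to z d/dz E(-z) cancels the first-order terms of the derivative and
  leaves z times the second derivative, which is nonnegative by convexity.\<close>

lemma bounded_mono_ks1: "bounded_mono 1 (\<lambda>z. 1 - ks0 z + ks1 z)"
proof (rule bounded_monoI_derivative)
  have eq: "1 - ks0 z + ks1 z = 1 + ks (\<lambda>n. real n - 1) z" for z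
    using ks_add[of "\<lambda>n. real n" "\<lambda>n. 1" 1 "-1" z] weight_bounds(1,2) by (simp add: ks1_def ks0_def)
  show "((\<lambda>z. 1 - ks0 z + ks1 z) has_real_derivative (0 + ks2 z / z)) (at z)" if "0 < z" for z
    unfolding eq
    using ks_derivative[of "\<lambda>n. real n - 1" z] weight_bounds(3) that unfolding ks2_def
    by (intro DERIV_add DERIV_const) auto
  show "0 \<le> 0 + ks2 z / z" if "0 < z" for z
    using ks2_nonneg[of z] that by simp
  show "1 - ks0 z + ks1 z \<le> 1" if "0 \<le> z" for z using ks0_nonneg[OF that] ks1_nonpos[OF that] by simp
qed (auto intro!: continuous_intros ks_continuous_on)

section \<open>Boundedness and variation of z E(-z)\<close>

text \<open>The integral form of \<open>z * ks0 z\<close> has the kernel $s^{-1}(1-s)^{-\alpha}$, which is not integrable at $0$.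
  Splitting off $s^{-1}$, whose contribution is \<open>1 - ks0 z\<close>, leaves an integrable nonnegative
  kernel, against which bounded monotone functions integrate to bounded monotone functions.\<close>

definition ker :: "real \<Rightarrow> real" where
  "ker s = (if 0 < s \<and> s < 1 then ((1 - s) powr (- \<alpha>) - 1) / s else 0)"

text \<open>The upper bound amounts to (1 - s) (1 - s)^(-\<alpha>) \<le> 1, that is, 1 - s \<le> (1
  - s)^\<alpha>.\<close>

lemma ker_bounds: "0 \<le> ker s" "ker s \<le> (1 - s) powr (- \<alpha>)"
proof -
  have "0 \<le> ker s \<and> ker s \<le> (1 - s) powr (- \<alpha>)"
  proof (cases "0 < s \<and> s < 1")
    case True
    have ge: "1 \<le> (1 - s) powr (- \<alpha>)"
      using True alpha powr_mono2'[of "- \<alpha>" "1 - s" 1] by auto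
    have "(1 - s) powr 1 \<le> (1 - s) powr \<alpha>"
      using True alpha by (intro powr_mono') auto
    then have "(1 - s) * (1 - s) powr (- \<alpha>) \<le> (1 - s) powr \<alpha> * (1 - s) powr (- \<alpha>)"
      using True by (intro mult_right_mono) auto
    also have "\<dots> = 1" using True by (simp add: powr_add[symmetric])
    finally have "(1 - s) powr (- \<alpha>) - 1 \<le> s * (1 - s) powr (- \<alpha>)" by (simp add: algebra_simps)
    then show ?thesis using True ge by (simp add: ker_def field_simps)
  qed (auto simp: ker_def)
  then show "0 \<le> ker s" "ker s \<le> (1 - s) powr (- \<alpha>)" by blast+
qed

lemma ker_integrable:
  assumes cont: "continuous_on {0..} g" and b: "\<And>z. 0 \<le> z \<Longrightarrow> 0 \<le> g z \<and> g z \<le> 1" and l: "0 \<le> L"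
  shows "(\<lambda>s. g (L * s powr kappa) * ker s) integrable_on {0..1}"
    and "0 \<le> integral {0..1} (\<lambda>s. g (L * s powr kappa) * ker s)"
    and "integral {0..1} (\<lambda>s. g (L * s powr kappa) * ker s) \<le> 1 / (1 - \<alpha>)"
proof -
  have bd: "0 \<le> g (L * s powr kappa) * ker s \<and> g (L * s powr kappa) * ker s \<le> (1 - s) powr (- \<alpha>)" for s
    using b[of "L * s powr kappa"] l ker_bounds[of s] mult_left_le_one_le[of "ker s" "g (L * s powr kappa)"] by auto
  have I: "((\<lambda>s. (1 - s) powr (- \<alpha>)) has_integral 1 / (1 - \<alpha>)) {0..1}"
    using has_integral_powr_end[of \<alpha> 1] alpha by simp
  have "continuous_on {0<..<1} (\<lambda>s. g (L * s powr kappa) * (((1 - s) powr (- \<alpha>) - 1) / s))"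
    using l by (intro continuous_intros continuous_on_compose2[OF cont]) auto
  then have "(\<lambda>s. g (L * s powr kappa) * (((1 - s) powr (- \<alpha>) - 1) / s)) \<in> borel_measurable (lebesgue_on {0<..<1})"
    by (intro continuous_imp_measurable_on_sets_lebesgue) auto
  then have 1: "(\<lambda>s. if s \<in> {0<..<1} then g (L * s powr kappa) * (((1 - s) powr (- \<alpha>) - 1) / s) else 0)
      \<in> borel_measurable lebesgue"
    by (subst borel_measurable_if) auto
  have eq: "(\<lambda>s. if s \<in> {0<..<1} then g (L * s powr kappa) * (((1 - s) powr (- \<alpha>) - 1) / s) else 0) =
      (\<lambda>s. if s \<in> {0..1} then g (L * s powr kappa) * ker s else 0)"
    by (auto simp: fun_eq_iff ker_def)
  have m: "(\<lambda>s. g (L * s powr kappa) * ker s) \<in> borel_measurable (lebesgue_on {0..1})"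
    by (rule borel_measurable_if[THEN iffD1, OF _ 1[unfolded eq]]) simp
  show i: "(\<lambda>s. g (L * s powr kappa) * ker s) integrable_on {0..1}"
    using bd by (intro measurable_bounded_by_integrable_imp_integrable_real[OF m has_integral_integrable[OF I]]) auto
  show "0 \<le> integral {0..1} (\<lambda>s. g (L * s powr kappa) * ker s)"
    using bd by (intro integral_nonneg i) auto
  have "integral {0..1} (\<lambda>s. g (L * s powr kappa) * ker s) \<le> integral {0..1} (\<lambda>s. (1 - s) powr (- \<alpha>))"
    using bd by (intro integral_le i has_integral_integrable[OF I]) auto
  then show "integral {0..1} (\<lambda>s. g (L * s powr kappa) * ker s) \<le> 1 / (1 - \<alpha>)"
    using integral_unique[OF I] by simp
qed

text \<open>For fixed s the integrand is nondecreasing in z because \<open>ker\<close> is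
  nonnegative; the constant is the integral of the majorant (1 - s)^(-\<alpha>).\<close>

lemma bounded_mono_ker_integral:
  assumes cont: "continuous_on {0..} g" and bm: "bounded_mono 1 g"
  shows "bounded_mono (1 / (1 - \<alpha>)) (\<lambda>z. integral {0..1} (\<lambda>s. g (z * s powr kappa) * ker s))"
proof -
  have b: "\<And>z. 0 \<le> z \<Longrightarrow> 0 \<le> g z \<and> g z \<le> 1" and mono: "mono_on {0..} g"
    using bm by (auto simp: bounded_mono_def)
  show ?thesis unfolding bounded_mono_def
  proof (intro conjI mono_onI allI impI)
    fix r s :: real assume "r \<in> {0..}" "s \<in> {0..}" "r \<le> s"
    then show "integral {0..1} (\<lambda>u. g (r * u powr kappa) * ker u) \<le> integral {0..1} (\<lambda>u. g (s * u powr kappa) * ker u)"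
      using ker_bounds(1)
      by (intro integral_le ker_integrable[OF cont b] mult_right_mono mono_onD[OF mono]) auto
  qed (use ker_integrable[OF cont b] in auto)
qed

text \<open>The fractional derivative of E(-L s^kappa) at time 1 is evaluated twice: by
  \<open>marchaud_ks\<close>, and as the integral of u' against (1 - s)^(-\<alpha>). Comparing with
  the integral of u' alone leaves ks1 against \<open>ker\<close>, and ks1 = (1 - ks0 + ks1) - (1 -
  ks0) makes both parts bounded and monotone.\<close>

lemma ks0_integral_form:
  assumes l: "0 \<le> L"
  shows "L * Gamma (1 - \<alpha>) * ks0 L = (1 - ks0 L)
     + kappa * integral {0..1} (\<lambda>s. (1 - ks0 (L * s powr kappa)) * ker s)
     - kappa * integral {0..1} (\<lambda>s. (1 - ks0 (L * s powr kappa) + ks1 (L * s powr kappa)) * ker s)"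
proof -
  define u' where "u' = (\<lambda>s. kappa * ks1 (L * s powr kappa) / s)"
  have d: "((\<lambda>s. ks0 (L * s powr kappa)) has_real_derivative u' s) (at s)" if "0 < s" for s
    using ks_powr(2)[of "\<lambda>_. 1" s L] weight_bounds(1,2) that unfolding ks0_def ks1_def u'_def by simp
  obtain C where C: "lipschitz_end C (\<lambda>s. ks0 (L * s powr kappa)) 1"
    using ks_powr(3)[of "\<lambda>_. 1" 1 L] weight_bounds(1,2) unfolding ks0_def by auto
  have "((\<lambda>s. u' s / (1 - s) powr \<alpha>) has_integral marchaud \<alpha> (\<lambda>s. ks0 (L * s powr kappa)) 1) {0..1}"
    using d by (intro marchaud_has_integral[OF C alpha]) auto
  moreover have "marchaud \<alpha> (\<lambda>s. ks0 (L * s powr kappa)) 1 = - L * Gamma (1 - \<alpha>) * ks0 L"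
    using marchaud_ks[of "\<lambda>_. 1" L 1] weight_bounds(1) l by (simp add: ks0_def)
  moreover have "(u' has_integral (ks0 (L * 1 powr kappa) - ks0 (L * 0 powr kappa))) {0..1}"
    using C d unfolding lipschitz_end_def
    by (intro fundamental_theorem_of_calculus_interior)
       (auto simp: has_real_derivative_iff_has_vector_derivative[symmetric])
  ultimately have "((\<lambda>s. u' s - u' s / (1 - s) powr \<alpha>) has_integral (ks0 L - 1) - (- L * Gamma (1 - \<alpha>) * ks0 L)) {0..1}"
    by (intro has_integral_diff) auto
  then have 1: "((\<lambda>s. - kappa * (ks1 (L * s powr kappa) * ker s)) has_integral
      (ks0 L - 1) - (- L * Gamma (1 - \<alpha>) * ks0 L)) {0..1}"
  \<comment> \<open>The quotient in \<open>ker\<close> is used on the open interval only; the two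
    endpoints do not affect the integral.\<close>
  proof (rule has_integral_spike_finite[of "{0,1}", rotated -1])
    show "- kappa * (ks1 (L * s powr kappa) * ker s) = u' s - u' s / (1 - s) powr \<alpha>"
      if "s \<in> {0..1} - {0, 1}" for s
      using that by (simp add: u'_def ker_def powr_minus_divide field_simps)
  qed simp
  have i1: "(\<lambda>s. (1 - ks0 (L * s powr kappa)) * ker s) integrable_on {0..1}"
    using bounded_mono_ks0 unfolding bounded_mono_def
    by (intro ker_integrable(1)[of "\<lambda>z. 1 - ks0 z"] continuous_intros ks_continuous_on l) auto
  have i2: "(\<lambda>s. (1 - ks0 (L * s powr kappa) + ks1 (L * s powr kappa)) * ker s) integrable_on {0..1}"
    using bounded_mono_ks1 unfolding bounded_mono_def
    by (intro ker_integrable(1)[of "\<lambda>z. 1 - ks0 z + ks1 z"] continuous_intros ks_continuous_on l) auto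
  have "((\<lambda>s. kappa * ((1 - ks0 (L * s powr kappa)) * ker s)
        - kappa * ((1 - ks0 (L * s powr kappa) + ks1 (L * s powr kappa)) * ker s)) has_integral
      kappa * integral {0..1} (\<lambda>s. (1 - ks0 (L * s powr kappa)) * ker s)
     - kappa * integral {0..1} (\<lambda>s. (1 - ks0 (L * s powr kappa) + ks1 (L * s powr kappa)) * ker s)) {0..1}"
    by (intro has_integral_diff has_integral_mult_right integrable_integral i1 i2)
  moreover have "(\<lambda>s. kappa * ((1 - ks0 (L * s powr kappa)) * ker s)
        - kappa * ((1 - ks0 (L * s powr kappa) + ks1 (L * s powr kappa)) * ker s)) =
      (\<lambda>s. - kappa * (ks1 (L * s powr kappa) * ker s))"
    by (simp add: fun_eq_iff algebra_simps)
  ultimately show ?thesis using has_integral_unique[OF 1] by fastforce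
qed

lemma bounded_mono_enlarge: "bounded_mono C U \<Longrightarrow> C \<le> C' \<Longrightarrow> bounded_mono C' U"
  by (force simp: bounded_mono_def)

text \<open>The third claim is \<open>ks0_integral_form\<close> divided by Gamma(1 - \<alpha>). It
  contains the boundedness of z E(-z), which is the decay rate used for the transition
  kernel.\<close>

lemma bounded_mono_diff_ks:
  shows "\<exists>C. bounded_mono_diff C ks0" "\<exists>C. bounded_mono_diff C ks1" "\<exists>C. bounded_mono_diff C (\<lambda>z. z * ks0 z)"
proof -
  have "bounded_mono 1 (\<lambda>_. 1)" by (simp add: bounded_mono_def mono_on_def)
  then show "\<exists>C. bounded_mono_diff C ks0"
    unfolding bounded_mono_diff_def using bounded_mono_ks0
    by (intro exI[of _ 1] exI[of _ "\<lambda>_. 1"] exI[of _ "\<lambda>z. 1 - ks0 z"]) auto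
  show "\<exists>C. bounded_mono_diff C ks1"
    unfolding bounded_mono_diff_def using bounded_mono_ks0 bounded_mono_ks1
    by (intro exI[of _ 1] exI[of _ "\<lambda>z. 1 - ks0 z + ks1 z"] exI[of _ "\<lambda>z. 1 - ks0 z"]) auto
  define U where "U = (\<lambda>z. (1 - ks0 z) + kappa * integral {0..1} (\<lambda>s. (1 - ks0 (z * s powr kappa)) * ker s))"
  define V where "V = (\<lambda>z. kappa * integral {0..1} (\<lambda>s. (1 - ks0 (z * s powr kappa) + ks1 (z * s powr kappa)) * ker s))"
  define G where "G = Gamma (1 - \<alpha>)"
  define C where "C = 1 + kappa * (1 / (1 - \<alpha>))"
  have G: "0 < G" unfolding G_def using alpha by (intro Gamma_real_pos) auto
  have I1: "bounded_mono (1 / (1 - \<alpha>)) (\<lambda>z. integral {0..1} (\<lambda>s. (1 - ks0 (z * s powr kappa)) * ker s))"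
    by (intro bounded_mono_ker_integral bounded_mono_ks0 continuous_intros ks_continuous_on)
  have I2: "bounded_mono (1 / (1 - \<alpha>))
      (\<lambda>z. integral {0..1} (\<lambda>s. (1 - ks0 (z * s powr kappa) + ks1 (z * s powr kappa)) * ker s))"
    by (intro bounded_mono_ker_integral[of "\<lambda>z. 1 - ks0 z + ks1 z"] bounded_mono_ks1 continuous_intros ks_continuous_on)
  have scale: "bounded_mono (c * D) (\<lambda>z. c * W z)" if "bounded_mono D W" "0 \<le> c" for W c D
    using that unfolding bounded_mono_def mono_on_def by (auto intro: mult_left_mono)
  have plus: "bounded_mono (D + D') (\<lambda>z. W z + W' z)" if "bounded_mono D W" "bounded_mono D' W'" for W W' D D'
    using that unfolding bounded_mono_def mono_on_def by (auto intro: add_mono)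
  have U: "bounded_mono C U"
    unfolding U_def C_def using kappa_pos by (intro plus scale bounded_mono_ks0 I1) auto
  have "bounded_mono (kappa * (1 / (1 - \<alpha>))) V"
    unfolding V_def using kappa_pos by (intro scale I2) auto
  then have V: "bounded_mono C V"
    by (rule bounded_mono_enlarge) (simp add: C_def)
  have "bounded_mono (1 / G * C) (\<lambda>z. 1 / G * U z)" "bounded_mono (1 / G * C) (\<lambda>z. 1 / G * V z)"
    using U V G by (auto intro!: scale simp del: times_divide_eq_left)
  moreover have "z * ks0 z = 1 / G * U z - 1 / G * V z" if "0 \<le> z" for z
  proof -
    have "z * G * ks0 z = U z - V z"
      using ks0_integral_form[OF that] unfolding U_def V_def G_def by linarith
    then show ?thesis using G by (simp add: field_simps)
  qed
  ultimately show "\<exists>C. bounded_mono_diff C (\<lambda>z. z * ks0 z)"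
    unfolding bounded_mono_diff_def by blast
qed

end

section \<open>Abel summation for eigenfunction expansions\<close>

text \<open>Summation by parts: the boundary term is at most e C, and the increments of U are
  nonnegative and telescope to at most C, which gives the second e C.\<close>

lemma abel_sum_bound:
  fixes b U :: "nat \<Rightarrow> real"
  assumes mono: "\<And>i j. i \<le> j \<Longrightarrow> U i \<le> U j" and U: "\<And>i. 0 \<le> U i" "\<And>i. U i \<le> C"
    and S: "\<And>k. \<bar>\<Sum>i<k. b i\<bar> \<le> e"
  shows "\<bar>\<Sum>i<n. b i * U i\<bar> \<le> 2 * C * e"
proof -
  have e: "0 \<le> e" using S[of 0] by simp
  have C: "0 \<le> C" using U[of 0] by linarith
  have parts: "(\<Sum>i<Suc n. b i * U i) = (\<Sum>i<Suc n. b i) * U n - (\<Sum>i<n. (\<Sum>j<Suc i. b j) * (U (Suc i) - U i))" for n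
    by (induction n) (simp_all add: algebra_simps)
  show ?thesis
  proof (cases n)
    case 0
    then show ?thesis using e C by simp
  next
    case (Suc m)
    have "\<bar>(\<Sum>i<Suc m. b i) * U m\<bar> \<le> e * C"
      unfolding abs_mult using S[of "Suc m"] U[of m] e by (intro mult_mono) auto
    moreover have "\<bar>\<Sum>i<m. (\<Sum>j<Suc i. b j) * (U (Suc i) - U i)\<bar> \<le> (\<Sum>i<m. e * (U (Suc i) - U i))"
    proof (rule order_trans[OF sum_abs sum_mono])
      fix i
      show "\<bar>(\<Sum>j<Suc i. b j) * (U (Suc i) - U i)\<bar> \<le> e * (U (Suc i) - U i)"
        unfolding abs_mult using S[of "Suc i"] mono[of i "Suc i"] by (intro mult_mono) (auto simp: e)
    qed
    moreover have "(\<Sum>i<m. e * (U (Suc i) - U i)) = e * (U m - U 0)"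
      by (simp add: sum_distrib_left[symmetric] sum_lessThan_telescope)
    moreover have "e * (U m - U 0) \<le> e * C" using U[of m] U[of 0] e by (intro mult_left_mono) auto
    moreover have "2 * C * e = e * C + e * C" by simp
    ultimately show ?thesis unfolding Suc parts by linarith
  qed
qed

text \<open>After shifting the start to m, each of the two monotone parts of w contributes 2 C e.
  Monotone L keeps the multipliers monotone in the index, for every z with the same bound.\<close>

lemma abel_tail_bound:
  fixes b L :: "nat \<Rightarrow> real"
  assumes w: "bounded_mono_diff C w" and L: "mono L" "\<And>i. 0 \<le> L i" and z: "0 \<le> z"
    and S: "\<And>k. m \<le> k \<Longrightarrow> \<bar>\<Sum>i=m..<k. b i\<bar> \<le> e"
  shows "\<bar>\<Sum>i=m..<n. b i * w (L i * z)\<bar> \<le> 4 * C * e"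
proof -
  obtain U V where UV: "bounded_mono C U" "bounded_mono C V" and w: "\<And>z. 0 \<le> z \<Longrightarrow> w z = U z - V z"
    using w unfolding bounded_mono_diff_def by blast
  have sh: "(\<Sum>i=m..<m+k. f i) = (\<Sum>i<k. f (m + i))" for f :: "nat \<Rightarrow> real" and k
    using sum.atLeastLessThan_shift_0[of f m "m + k"] by (simp add: atLeast0LessThan add.commute)
  have Lz: "L i * z \<le> L j * z" if "i \<le> j" for i j using L z that by (intro mult_right_mono monoD[of L]) auto
  have bd: "\<bar>\<Sum>i<k. b (m + i) * W (L (m + i) * z)\<bar> \<le> 2 * C * e" if W: "bounded_mono C W" for W k
  proof (rule abel_sum_bound)
    show "W (L (m + i) * z) \<le> W (L (m + j) * z)" if "i \<le> j" for i j
      using W Lz[of "m + i" "m + j"] that L z unfolding bounded_mono_def by (auto intro: mono_onD)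
    show "\<bar>\<Sum>i<k. b (m + i)\<bar> \<le> e" for k using S[of "m + k"] sh[of b k] by simp
  qed (use W L z in \<open>auto simp: bounded_mono_def\<close>)
  show ?thesis
  proof (cases "m \<le> n")
    case True
    then obtain k where k: "n = m + k" by (auto simp: le_iff_add)
    have "(\<Sum>i=m..<n. b i * w (L i * z)) = (\<Sum>i<k. b (m + i) * U (L (m + i) * z)) - (\<Sum>i<k. b (m + i) * V (L (m + i) * z))"
      unfolding k sh using w L z by (simp add: sum_subtractf[symmetric] right_diff_distrib)
    then show ?thesis using bd[OF UV(1), of k] bd[OF UV(2), of k] by linarith
  next
    case False
    have "0 \<le> e" using S[of m] by simp
    moreover have "0 \<le> C" using UV(1) by (auto simp: bounded_mono_def intro: order_trans)
    ultimately show ?thesis using False by simp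
  qed
qed

text \<open>The tail bound depends neither on x nor on z, so the convergence is uniform jointly over
  X and the whole half-line, z = 0 included.\<close>

lemma abel_uniform_limit:
  fixes b :: "nat \<Rightarrow> 'a \<Rightarrow> real" and L :: "nat \<Rightarrow> real"
  assumes w: "bounded_mono_diff C w" and L: "mono L" "\<And>i. 0 \<le> L i"
    and lim: "uniform_limit X (\<lambda>N x. \<Sum>n<N. b n x) B sequentially"
  shows "uniform_limit (X \<times> {0..}) (\<lambda>N p. \<Sum>n<N. b n (fst p) * w (L n * snd p))
           (\<lambda>p. \<Sum>n. b n (fst p) * w (L n * snd p)) sequentially"
proof -
  have C: "0 \<le> C" using w unfolding bounded_mono_diff_def bounded_mono_def by (auto intro: order_trans)
  have split: "(\<Sum>i<n. f i) - (\<Sum>i<m. f i) = (\<Sum>i=m..<n. f i)" if "m \<le> n" for f :: "nat \<Rightarrow> real" and m n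
    using sum_diff_nat_ivl[of 0 m n f] that by (simp add: atLeast0LessThan)
  have "uniformly_Cauchy_on (X \<times> {0..}) (\<lambda>N p. \<Sum>n<N. b n (fst p) * w (L n * snd p))"
  proof (rule uniformly_Cauchy_onI')
    fix e :: real assume e: "0 < e"
    \<comment> \<open>Blocks of the b-series are below 2 d; \<open>abel_tail_bound\<close>
      multiplies this by 4 C, and 8 C d < e.\<close>
    define d where "d = e / (8 * (C + 1))"
    have d: "0 < d" using e C by (simp add: d_def)
    from uniform_limitD[OF lim d] obtain M where M: "\<And>n x. n \<ge> M \<Longrightarrow> x \<in> X \<Longrightarrow> \<bar>(\<Sum>i<n. b i x) - B x\<bar> < d"
      unfolding eventually_sequentially dist_real_def by blast
    show "\<exists>M. \<forall>p\<in>X \<times> {0..}. \<forall>m\<ge>M. \<forall>n>m. dist (\<Sum>i<m. b i (fst p) * w (L i * snd p)) (\<Sum>i<n. b i (fst p) * w (L i * snd p)) < e"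
    proof (intro exI[of _ M] ballI allI impI)
      fix p :: "'a \<times> real" and m n assume p: "p \<in> X \<times> {0..}" and mn: "M \<le> m" "m < n"
      have "\<bar>\<Sum>i=m..<n. b i (fst p) * w (L i * snd p)\<bar> \<le> 4 * C * (2 * d)"
      proof (rule abel_tail_bound[OF w L])
        show "\<bar>\<Sum>i=m..<k. b i (fst p)\<bar> \<le> 2 * d" if "m \<le> k" for k
          using M[of m "fst p"] M[of k "fst p"] split[OF that, of "\<lambda>i. b i (fst p)"] mn that p by auto
      qed (use p in auto)
      also have "\<dots> < e" using e C by (simp add: d_def field_simps)
      finally show "dist (\<Sum>i<m. b i (fst p) * w (L i * snd p)) (\<Sum>i<n. b i (fst p) * w (L i * snd p)) < e"
        using split[of m n "\<lambda>i. b i (fst p) * w (L i * snd p)"] mn by (simp add: dist_real_def abs_minus_commute)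
    qed
  qed
  then have "uniformly_convergent_on (X \<times> {0..}) (\<lambda>N p. \<Sum>n<N. b n (fst p) * w (L n * snd p))"
    by (rule Cauchy_uniformly_convergent)
  then show ?thesis
    unfolding uniformly_convergent_uniform_limit_iff suminf_eq_lim .
qed

lemma uniform_limit_reparametrize:
  assumes "uniform_limit A f l F" "\<And>x. x \<in> B \<Longrightarrow> h x \<in> A"
  shows "uniform_limit B (\<lambda>n x. f n (h x)) (\<lambda>x. l (h x)) F"
  unfolding uniform_limit_iff
proof (intro allI impI)
  fix e :: real assume "0 < e"
  from uniform_limitD[OF assms(1) this] show "\<forall>\<^sub>F n in F. \<forall>x\<in>B. dist (f n (h x)) (l (h x)) < e"
    by eventually_elim (use assms(2) in auto)
qed

lemma uniform_limit_mult_bounded: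
  fixes f :: "'b \<Rightarrow> 'a \<Rightarrow> real"
  assumes lim: "uniform_limit A f l F" and c: "\<And>x. x \<in> A \<Longrightarrow> \<bar>c x\<bar> \<le> K"
  shows "uniform_limit A (\<lambda>n x. f n x * c x) (\<lambda>x. l x * c x) F"
  unfolding uniform_limit_iff
proof (intro allI impI)
  fix e :: real assume e: "0 < e"
  define d where "d = e / (\<bar>K\<bar> + 1)"
  have d: "0 < d" using e by (simp add: d_def add_nonneg_pos)
  from uniform_limitD[OF lim d] show "\<forall>\<^sub>F n in F. \<forall>x\<in>A. dist (f n x * c x) (l x * c x) < e"
  proof eventually_elim
    case (elim n)
    show ?case
    proof
      fix x assume x: "x \<in> A"
      have "dist (f n x * c x) (l x * c x) = \<bar>f n x - l x\<bar> * \<bar>c x\<bar>"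
        by (simp add: dist_real_def left_diff_distrib[symmetric] abs_mult)
      also have "\<dots> \<le> d * \<bar>K\<bar>"
        using elim x c[OF x] by (intro mult_mono) (auto simp: dist_real_def less_imp_le d)
      also have "\<dots> < d * (\<bar>K\<bar> + 1)" using d by simp
      also have "\<dots> = e" using e by (simp add: d_def)
      finally show "dist (f n x * c x) (l x * c x) < e" .
    qed
  qed
qed

lemma has_real_derivative_uniform_limit:
  fixes f :: "nat \<Rightarrow> real \<Rightarrow> real"
  assumes d: "\<And>n x. x \<in> {a<..<b} \<Longrightarrow> (f n has_real_derivative f' n x) (at x)"
    and lim: "\<And>x. x \<in> {a<..<b} \<Longrightarrow> (\<lambda>n. f n x) \<longlonglongrightarrow> g x"
    and lim': "uniform_limit {a<..<b} f' g' sequentially" and x: "x \<in> {a<..<b}"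
  shows "(g has_real_derivative g' x) (at x)"
proof -
  have "\<exists>h. \<forall>x\<in>{a<..<b}. (\<lambda>n. f n x) \<longlonglongrightarrow> h x \<and> (h has_derivative (\<lambda>y. g' x * y)) (at x within {a<..<b})"
  proof (rule has_derivative_sequence)
    show "(f n has_derivative (\<lambda>y. f' n x * y)) (at x within {a<..<b})" if "x \<in> {a<..<b}" for n x
      using d[OF that, of n] by (simp add: has_field_derivative_def has_derivative_at_withinI)
    show "\<forall>\<^sub>F n in sequentially. \<forall>x\<in>{a<..<b}. \<forall>h. norm (f' n x * h - g' x * h) \<le> e * norm h" if "0 < e" for e
      using uniform_limitD[OF lim' that]
    proof eventually_elim
      case (elim n)
      show ?case
      proof (intro ballI allI)
        fix x h assume "x \<in> {a<..<b}"
        with elim have "\<bar>f' n x - g' x\<bar> * \<bar>h\<bar> \<le> e * \<bar>h\<bar>"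
          by (intro mult_right_mono) (auto simp: dist_real_def less_imp_le)
        then show "norm (f' n x * h - g' x * h) \<le> e * norm h"
          by (simp add: left_diff_distrib[symmetric] abs_mult)
      qed
    qed
  qed (use x lim in auto)
  then obtain h where h: "\<And>x. x \<in> {a<..<b} \<Longrightarrow> (\<lambda>n. f n x) \<longlonglongrightarrow> h x"
      "\<And>x. x \<in> {a<..<b} \<Longrightarrow> (h has_derivative (\<lambda>y. g' x * y)) (at x within {a<..<b})" by blast
  have hg: "h x = g x" if "x \<in> {a<..<b}" for x
    using h(1)[OF that] lim[OF that] by (rule LIMSEQ_unique)
  have "(h has_real_derivative g' x) (at x)"
    using h(2)[OF x] x at_within_open[OF x open_greaterThanLessThan] unfolding has_field_derivative_def by (simp only:)
  moreover have "\<forall>\<^sub>F y in nhds x. h y = g y"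
    by (rule eventually_mono[OF eventually_nhds_in_open[of "{a<..<b}" x]]) (use x hg in auto)
  ultimately show ?thesis by (simp only: DERIV_cong_ev[OF refl _ refl])
qed

context kilbas_saigo_params
begin

text \<open>With b n = a_n Q_n(x) at a fixed x, this is the solution divided by the stationary
  density, as a function of time.\<close>

definition eigensum :: "(nat \<Rightarrow> real) \<Rightarrow> (nat \<Rightarrow> real) \<Rightarrow> real \<Rightarrow> real" where
  "eigensum L b t = (\<Sum>n. b n * ks0 (L n * t powr kappa))"

text \<open>The multiplier ks0 yields continuity up to t = 0, ks1 the time derivative, and z ks0 the
  convergence of the right-hand side; \<open>marchaud_tendsto\<close> then carries the termwise
  relaxation equation to the limit.\<close>

lemma eigensum_properties:
  fixes b L :: "nat \<Rightarrow> real"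
  assumes b: "summable b" and L: "mono L" "\<And>i. 0 \<le> L i"
  shows "continuous_on {0..} (eigensum L b)"
    and "0 < t \<Longrightarrow> (eigensum L b has_real_derivative
            (\<Sum>n. b n * ks1 (L n * t powr kappa)) * (kappa / t)) (at t)"
    and "0 < t \<Longrightarrow> summable (\<lambda>n. b n * (L n * ks0 (L n * t powr kappa)))"
    and "0 < t \<Longrightarrow> \<exists>C. lipschitz_end C (eigensum L b) t"
    and "0 < t \<Longrightarrow> marchaud \<alpha> (eigensum L b) t =
           - Gamma (1 - \<alpha>) * t powr \<gamma> * (\<Sum>n. b n * (L n * ks0 (L n * t powr kappa)))"
proof -
  \<comment> \<open>A one-point parameter space: for fixed b only uniformity in time is
    wanted.\<close>
  have unif: "uniform_limit UNIV (\<lambda>N (x::unit). \<Sum>n<N. b n) (\<lambda>_. suminf b) sequentially"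
    unfolding uniform_limit_iff using summable_LIMSEQ[OF b] by (auto dest: tendstoD)
  have lim: "uniform_limit {0..} (\<lambda>N s. \<Sum>n<N. b n * w (L n * s powr kappa))
      (\<lambda>s. \<Sum>n. b n * w (L n * s powr kappa)) sequentially" if w: "bounded_mono_diff C w" for w C
    using uniform_limit_reparametrize[OF abel_uniform_limit[OF w L unif], of "{0..}" "\<lambda>s. ((), s powr kappa)"]
    by simp
  obtain C0 C1 C2 where C: "bounded_mono_diff C0 ks0" "bounded_mono_diff C1 ks1" "bounded_mono_diff C2 (\<lambda>z. z * ks0 z)"
    using bounded_mono_diff_ks by blast
  have lim0: "uniform_limit {0..} (\<lambda>N s. \<Sum>n<N. b n * ks0 (L n * s powr kappa)) (eigensum L b) sequentially"
    using lim[OF C(1)] unfolding eigensum_def .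
  have term_cont: "continuous_on {0..} (\<lambda>s. ks0 (l * s powr kappa))" for l
    using ks_powr(1)[of "\<lambda>_. 1" l] weight_bounds(1,2) unfolding ks0_def by simp
  have term_deriv: "((\<lambda>s. ks0 (l * s powr kappa)) has_real_derivative
      ks1 (l * s powr kappa) * (kappa / s)) (at s)" if "0 < s" for l s
    using ks_powr(2)[of "\<lambda>_. 1" s l] weight_bounds(1,2) that unfolding ks0_def ks1_def by (simp add: mult.commute)
  have term_lip: "\<exists>C. lipschitz_end C (\<lambda>s. ks0 (l * s powr kappa)) t" if "0 < t" for l t
    using ks_powr(3)[of "\<lambda>_. 1" t l] weight_bounds(1,2) that unfolding ks0_def by simp
  have sum_deriv: "((\<lambda>s. \<Sum>n<N. b n * ks0 (L n * s powr kappa)) has_real_derivative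
      (\<Sum>n<N. b n * ks1 (L n * s powr kappa)) * (kappa / s)) (at s)" if "0 < s" for N s
    unfolding sum_distrib_right mult.assoc
    by (intro DERIV_sum DERIV_cmult term_deriv that)
  \<comment> \<open>The factor kappa / s from the chain rule is unbounded at 0, so the derivatives
    are handled only on sets bounded away from 0.\<close>
  have lim1: "uniform_limit A (\<lambda>N s. (\<Sum>n<N. b n * ks1 (L n * s powr kappa)) * (kappa / s))
      (\<lambda>s. (\<Sum>n. b n * ks1 (L n * s powr kappa)) * (kappa / s)) sequentially"
    if A: "\<And>s. s \<in> A \<Longrightarrow> r \<le> s" and r: "0 < r" for A r
  proof (rule uniform_limit_mult_bounded[of _ _ _ _ _ "kappa / r"])
    show "uniform_limit A (\<lambda>N s. \<Sum>n<N. b n * ks1 (L n * s powr kappa))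
        (\<lambda>s. \<Sum>n. b n * ks1 (L n * s powr kappa)) sequentially"
      using A r by (intro uniform_limit_on_subset[OF lim[OF C(2)]]) force
    show "\<bar>kappa / s\<bar> \<le> kappa / r" if "s \<in> A" for s
      using A[OF that] r kappa_pos by (auto simp: abs_div intro!: divide_left_mono)
  qed
  show cont: "continuous_on {0..} (eigensum L b)"
    by (rule uniform_limit_theorem[OF always_eventually lim0])
       (intro allI continuous_intros term_cont, simp)
  show deriv: "(eigensum L b has_real_derivative (\<Sum>n. b n * ks1 (L n * t powr kappa)) * (kappa / t)) (at t)"
    if t: "0 < t" for t
  proof (rule has_real_derivative_uniform_limit[where a = "t/2" and b = "2*t"])
    show "((\<lambda>s. \<Sum>n<N. b n * ks0 (L n * s powr kappa)) has_real_derivative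
      (\<Sum>n<N. b n * ks1 (L n * s powr kappa)) * (kappa / s)) (at s)" if "s \<in> {t/2<..<2*t}" for N s
      using that t by (intro sum_deriv) auto
    show "(\<lambda>N. \<Sum>n<N. b n * ks0 (L n * s powr kappa)) \<longlonglongrightarrow> eigensum L b s" if "s \<in> {t/2<..<2*t}" for s
      using that t by (intro tendsto_uniform_limitI[OF lim0]) auto
    show "uniform_limit {t/2<..<2*t} (\<lambda>N s. (\<Sum>n<N. b n * ks1 (L n * s powr kappa)) * (kappa / s))
        (\<lambda>s. (\<Sum>n. b n * ks1 (L n * s powr kappa)) * (kappa / s)) sequentially"
      using t by (intro lim1[where r = "t/2"]) auto
  qed (use t in auto)
  show lip: "\<exists>C. lipschitz_end C (eigensum L b) t" if t: "0 < t" for t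
    by (rule lipschitz_endI_differentiable[OF continuous_on_subset[OF cont] deriv[OF t] t]) auto
  have lim2: "(\<lambda>N. \<Sum>n<N. b n * (L n * ks0 (L n * t powr kappa))) \<longlonglongrightarrow> (\<Sum>n. b n * (L n * ks0 (L n * t powr kappa)))
     \<and> summable (\<lambda>n. b n * (L n * ks0 (L n * t powr kappa)))" if t: "0 < t" for t
  proof -
    \<comment> \<open>The multiplier theorem controls L n z ks0(L n z); the factor z > 0 is then
      divided out.\<close>
    define z where "z = t powr kappa"
    have z: "0 < z" using t by (simp add: z_def)
    have "(\<lambda>N. \<Sum>n<N. b n * (L n * z * ks0 (L n * z))) \<longlonglongrightarrow> (\<Sum>n. b n * (L n * z * ks0 (L n * z)))"
      using tendsto_uniform_limitI[OF lim[OF C(3)], of t] t unfolding z_def by simp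
    then have "summable (\<lambda>n. b n * (L n * z * ks0 (L n * z)))"
      using sums_def[of "\<lambda>n. b n * (L n * z * ks0 (L n * z))"] sums_summable by blast
    then have "summable (\<lambda>n. (1 / z) * (b n * (L n * z * ks0 (L n * z))))"
      by (rule summable_mult)
    then have s: "summable (\<lambda>n. b n * (L n * ks0 (L n * z)))" using z by simp
    show ?thesis using s summable_LIMSEQ[OF s] unfolding z_def by simp
  qed
  then show "summable (\<lambda>n. b n * (L n * ks0 (L n * t powr kappa)))" if "0 < t" using that by blast
  show "marchaud \<alpha> (eigensum L b) t =
           - Gamma (1 - \<alpha>) * t powr \<gamma> * (\<Sum>n. b n * (L n * ks0 (L n * t powr kappa)))" if t: "0 < t"
  proof -
    have "(\<lambda>N. marchaud \<alpha> (\<lambda>s. \<Sum>n<N. b n * ks0 (L n * s powr kappa)) t) \<longlonglongrightarrow> marchaud \<alpha> (eigensum L b) t"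
    proof (rule marchaud_tendsto[OF alpha t])
      show "continuous_on {0..t} (\<lambda>s. \<Sum>n<N. b n * ks0 (L n * s powr kappa))" for N
        by (intro continuous_intros continuous_on_subset[OF term_cont]) auto
      show "((\<lambda>s. \<Sum>n<N. b n * ks0 (L n * s powr kappa)) has_real_derivative
        (\<Sum>n<N. b n * ks1 (L n * s powr kappa)) * (kappa / s)) (at s)" if "s \<in> {t/2..t}" for N s
        using that t by (intro sum_deriv) auto
      show "(eigensum L b has_real_derivative (\<Sum>n. b n * ks1 (L n * s powr kappa)) * (kappa / s)) (at s)"
        if "s \<in> {t/2..t}" for s
        using that t by (intro deriv) auto
      show "uniform_limit {0..t} (\<lambda>N s. \<Sum>n<N. b n * ks0 (L n * s powr kappa)) (eigensum L b) sequentially"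
        by (rule uniform_limit_on_subset[OF lim0]) auto
      show "uniform_limit {t/2..t} (\<lambda>N s. (\<Sum>n<N. b n * ks1 (L n * s powr kappa)) * (kappa / s))
          (\<lambda>s. (\<Sum>n. b n * ks1 (L n * s powr kappa)) * (kappa / s)) sequentially"
        using t by (intro lim1[where r = "t/2"]) auto
    qed
    moreover have "marchaud \<alpha> (\<lambda>s. \<Sum>n<N. b n * ks0 (L n * s powr kappa)) t =
        (- Gamma (1 - \<alpha>) * t powr \<gamma>) * (\<Sum>n<N. b n * (L n * ks0 (L n * t powr kappa)))" for N
    proof -
      have each: "marchaud \<alpha> (\<lambda>s. ks0 (L n * s powr kappa)) t =
          - L n * Gamma (1 - \<alpha>) * t powr \<gamma> * ks0 (L n * t powr kappa)" for n
        using marchaud_ks[of "\<lambda>_. 1" "L n" t] weight_bounds(1) L t unfolding ks0_def by simp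
      have "marchaud \<alpha> (\<lambda>s. \<Sum>n<N. b n * ks0 (L n * s powr kappa)) t =
          (\<Sum>n<N. b n * marchaud \<alpha> (\<lambda>s. ks0 (L n * s powr kappa)) t)"
        using marchaud_sum[of "{..<N}" "\<lambda>n s. ks0 (L n * s powr kappa)" t \<alpha> b] term_lip[OF t] alpha t by auto
      then show ?thesis by (simp add: each sum_distrib_left mult_ac)
    qed
    moreover have "(\<lambda>N. (- Gamma (1 - \<alpha>) * t powr \<gamma>) * (\<Sum>n<N. b n * (L n * ks0 (L n * t powr kappa)))) \<longlonglongrightarrow>
        (- Gamma (1 - \<alpha>) * t powr \<gamma>) * (\<Sum>n. b n * (L n * ks0 (L n * t powr kappa)))"
      using lim2[OF t] by (intro tendsto_mult tendsto_const) auto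
    ultimately show ?thesis using LIMSEQ_unique by auto
  qed
qed

end

section \<open>Expansions in an orthonormal system\<close>

lemma abs_mult_le_weighted_squares:
  fixes a b c :: real
  assumes "0 < c"
  shows "\<bar>a * b\<bar> \<le> c * a\<^sup>2 + b\<^sup>2 / c"
proof -
  have "0 \<le> (sqrt c * \<bar>a\<bar> - \<bar>b\<bar> / sqrt c)\<^sup>2" by simp
  also have "\<dots> = c * a\<^sup>2 + b\<^sup>2 / c - 2 * \<bar>a * b\<bar>"
    using assms by (simp add: power2_diff power_mult_distrib power_divide abs_mult)
  finally show ?thesis using abs_ge_zero[of "a * b"] by linarith
qed

lemma integrable_mult_of_squares:
  fixes f g :: "'a \<Rightarrow> real"
  assumes [measurable]: "f \<in> borel_measurable M" "g \<in> borel_measurable M"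
    and "integrable M (\<lambda>x. (f x)\<^sup>2)" "integrable M (\<lambda>x. (g x)\<^sup>2)"
  shows "integrable M (\<lambda>x. f x * g x)"
proof (rule Bochner_Integration.integrable_bound)
  show "integrable M (\<lambda>x. 1 * (f x)\<^sup>2 + (g x)\<^sup>2 / 1)" using assms by simp
  show "AE x in M. norm (f x * g x) \<le> norm (1 * (f x)\<^sup>2 + (g x)\<^sup>2 / 1)"
    using abs_mult_le_weighted_squares[of 1] by (intro AE_I2) (auto intro: order_trans)
qed simp

text \<open>Cauchy-Schwarz in weighted form: in |u f| \<le> c u^2 + f^2 / c the weight c is fixed
  first, to make the part with f small, before n grows.\<close>

lemma integral_mult_tendsto_0:
  fixes u :: "nat \<Rightarrow> 'a \<Rightarrow> real"
  assumes u: "\<And>n. u n \<in> borel_measurable M" "\<And>n. integrable M (\<lambda>x. (u n x)\<^sup>2)"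
    and lim: "(\<lambda>n. \<integral>x. (u n x)\<^sup>2 \<partial>M) \<longlonglongrightarrow> 0"
    and f: "f \<in> borel_measurable M" "integrable M (\<lambda>x. (f x)\<^sup>2)"
  shows "(\<lambda>n. \<integral>x. u n x * f x \<partial>M) \<longlonglongrightarrow> 0"
proof (rule LIMSEQ_I)
  fix e :: real assume e: "0 < e"
  define F where "F = (\<integral>x. (f x)\<^sup>2 \<partial>M)"
  have F: "0 \<le> F" by (simp add: F_def)
  \<comment> \<open>This makes F / c < e / 2, also for F = 0.\<close>
  define c where "c = (2 * F + 1) / e"
  have c: "0 < c" using e F by (simp add: c_def)
  have "F / c < e / 2 \<or> F = 0" using e F by (simp add: c_def field_simps)
  then have Fc: "F / c < e / 2" using e by auto
  have "\<forall>\<^sub>F n in sequentially. (\<integral>x. (u n x)\<^sup>2 \<partial>M) < e / 2 / c"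
    using lim e c by (intro order_tendstoD) auto
  then obtain N where N: "\<And>n. N \<le> n \<Longrightarrow> (\<integral>x. (u n x)\<^sup>2 \<partial>M) < e / 2 / c"
    unfolding eventually_sequentially by blast
  show "\<exists>no. \<forall>n\<ge>no. norm ((\<integral>x. u n x * f x \<partial>M) - 0) < e"
  proof (intro exI[of _ N] allI impI)
    fix n assume n: "N \<le> n"
    have i: "integrable M (\<lambda>x. u n x * f x)" by (intro integrable_mult_of_squares u f)
    have "norm (\<integral>x. u n x * f x \<partial>M) \<le> (\<integral>x. \<bar>u n x * f x\<bar> \<partial>M)"
      using integral_norm_bound[of M "\<lambda>x. u n x * f x"] by simp
    also have "\<dots> \<le> (\<integral>x. c * (u n x)\<^sup>2 + (f x)\<^sup>2 / c \<partial>M)"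
      using i u f c by (intro integral_mono abs_mult_le_weighted_squares) auto
    also have "\<dots> = c * (\<integral>x. (u n x)\<^sup>2 \<partial>M) + F / c"
      using u f by (simp add: F_def)
    also have "\<dots> < c * (e / 2 / c) + e / 2"
      using N[OF n] c Fc by (intro add_strict_mono mult_strict_left_mono) auto
    finally show "norm ((\<integral>x. u n x * f x \<partial>M) - 0) < e" using c by simp
  qed
qed

lemma integrable_integral_le_of_nn_integral:
  fixes f :: "'a \<Rightarrow> real"
  assumes [measurable]: "f \<in> borel_measurable M" and "\<And>x. 0 \<le> f x"
    and "(\<integral>\<^sup>+x. ennreal (f x) \<partial>M) \<le> ennreal c" "0 \<le> c"
  shows "integrable M f" "(\<integral>x. f x \<partial>M) \<le> c"
proof -
  show "integrable M f"
    using assms by (intro integrableI_bounded) (auto simp: top.not_eq_extremum intro: le_less_trans)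
  show "(\<integral>x. f x \<partial>M) \<le> c"
    using assms by (subst integral_eq_nn_integral) (auto intro: enn2real_leI)
qed

text \<open>The series converges in $L^2$ by orthogonality and to \<open>S\<close> pointwise; Fatou's lemma shows
  that the two limits agree.\<close>

lemma orthonormal_series_integral:
  fixes \<phi> :: "nat \<Rightarrow> 'a \<Rightarrow> real"
  assumes m\<phi>: "\<And>n. \<phi> n \<in> borel_measurable M"
    and i\<phi>: "\<And>n. integrable M (\<lambda>x. (\<phi> n x)\<^sup>2)"
    and orth: "\<And>n k. (\<integral>x. \<phi> n x * \<phi> k x \<partial>M) = (if n = k then 1 else 0)"
    and \<beta>: "summable (\<lambda>n. (\<beta> n)\<^sup>2)"
    and S: "\<And>x. (\<lambda>n. \<beta> n * \<phi> n x) sums S x"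
    and f: "f \<in> borel_measurable M" "integrable M (\<lambda>x. (f x)\<^sup>2)"
  shows "integrable M (\<lambda>x. S x * f x)"
    and "(\<lambda>n. \<beta> n * (\<integral>x. \<phi> n x * f x \<partial>M)) sums (\<integral>x. S x * f x \<partial>M)"
proof -
  define T where "T = (\<lambda>N x. \<Sum>n<N. \<beta> n * \<phi> n x)"
  \<comment> \<open>The tail of the squared coefficients bounds the squared L2 distance from S to
    its N-th partial sum.\<close>
  define \<tau> where "\<tau> = (\<lambda>N. (\<Sum>n. (\<beta> n)\<^sup>2) - (\<Sum>n<N. (\<beta> n)\<^sup>2))"
  have mT [measurable]: "T N \<in> borel_measurable M" for N unfolding T_def using m\<phi> by measurable
  have TS: "(\<lambda>N. T N x) \<longlonglongrightarrow> S x" for x using S[of x] unfolding sums_def T_def .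
  have mS [measurable]: "S \<in> borel_measurable M"
    by (rule borel_measurable_LIMSEQ_real[OF TS]) simp
  have \<tau>: "\<tau> \<longlonglongrightarrow> 0"
    unfolding \<tau>_def using tendsto_diff[OF tendsto_const summable_LIMSEQ[OF \<beta>], of "\<Sum>n. (\<beta> n)\<^sup>2"] by simp
  have \<tau>0: "0 \<le> \<tau> N" for N unfolding \<tau>_def using sum_le_suminf[OF \<beta>, of "{..<N}"] by simp
  have ip: "integrable M (\<lambda>x. \<phi> n x * \<phi> k x)" for n k
    by (intro integrable_mult_of_squares m\<phi> i\<phi>)
  have sq: "integrable M (\<lambda>x. (\<Sum>n\<in>I. \<beta> n * \<phi> n x)\<^sup>2) \<and> (\<integral>x. (\<Sum>n\<in>I. \<beta> n * \<phi> n x)\<^sup>2 \<partial>M) = (\<Sum>n\<in>I. (\<beta> n)\<^sup>2)"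
    if I: "finite I" for I
  proof -
    have eq: "(\<lambda>x. (\<Sum>n\<in>I. \<beta> n * \<phi> n x)\<^sup>2) = (\<lambda>x. \<Sum>n\<in>I. \<Sum>k\<in>I. (\<beta> n * \<beta> k) * (\<phi> n x * \<phi> k x))"
      by (simp add: fun_eq_iff power2_eq_square sum_product mult_ac)
    have "(\<integral>x. (\<Sum>n\<in>I. \<Sum>k\<in>I. (\<beta> n * \<beta> k) * (\<phi> n x * \<phi> k x)) \<partial>M) =
        (\<Sum>n\<in>I. \<Sum>k\<in>I. (\<beta> n * \<beta> k) * (if n = k then 1 else 0))"
      by (simp add: Bochner_Integration.integral_sum ip orth)
    also have "\<dots> = (\<Sum>n\<in>I. (\<beta> n)\<^sup>2)"
      using I by (intro sum.cong) (auto simp: power2_eq_square if_distrib sum.delta cong: if_cong)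
    finally show ?thesis unfolding eq by (simp add: ip)
  qed
  have diff: "T K x - T N x = (\<Sum>n\<in>{N..<K}. \<beta> n * \<phi> n x)" if "N \<le> K" for N K x
    unfolding T_def using sum_diff_nat_ivl[of 0 N K "\<lambda>n. \<beta> n * \<phi> n x"] that by (simp add: atLeast0LessThan)
  have tail: "(\<integral>\<^sup>+x. ennreal ((T K x - T N x)\<^sup>2) \<partial>M) \<le> ennreal (\<tau> N)" if NK: "N \<le> K" for N K
  proof -
    have "(\<integral>\<^sup>+x. ennreal ((T K x - T N x)\<^sup>2) \<partial>M) = ennreal (\<Sum>n\<in>{N..<K}. (\<beta> n)\<^sup>2)"
      unfolding diff[OF NK] using sq[of "{N..<K}"] by (subst nn_integral_eq_integral) auto
    moreover have "(\<Sum>n\<in>{N..<K}. (\<beta> n)\<^sup>2) \<le> \<tau> N"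
      using sum_diff_nat_ivl[of 0 N K "\<lambda>n. (\<beta> n)\<^sup>2"] NK sum_le_suminf[OF \<beta>, of "{..<K}"]
      unfolding \<tau>_def by (simp add: atLeast0LessThan)
    ultimately show ?thesis by (simp add: ennreal_leI)
  qed
  have fatou: "(\<integral>\<^sup>+x. ennreal ((S x - T N x)\<^sup>2) \<partial>M) \<le> ennreal (\<tau> N)" for N
  proof -
    have "(\<lambda>K. ennreal ((T K x - T N x)\<^sup>2)) \<longlonglongrightarrow> ennreal ((S x - T N x)\<^sup>2)" for x
      by (intro tendsto_intros TS tendsto_ennrealI)
    then have "liminf (\<lambda>K. ennreal ((T K x - T N x)\<^sup>2)) = ennreal ((S x - T N x)\<^sup>2)" for x
      by (intro lim_imp_Liminf) auto
    then have "(\<integral>\<^sup>+x. ennreal ((S x - T N x)\<^sup>2) \<partial>M) = (\<integral>\<^sup>+x. liminf (\<lambda>K. ennreal ((T K x - T N x)\<^sup>2)) \<partial>M)"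
      by simp
    also have "\<dots> \<le> liminf (\<lambda>K. \<integral>\<^sup>+x. ennreal ((T K x - T N x)\<^sup>2) \<partial>M)"
      by (rule nn_integral_liminf) simp
    also have "\<dots> \<le> limsup (\<lambda>K. \<integral>\<^sup>+x. ennreal ((T K x - T N x)\<^sup>2) \<partial>M)"
      by (rule Liminf_le_Limsup) simp
    also have "\<dots> \<le> ennreal (\<tau> N)"
      by (rule Limsup_bounded) (auto simp: eventually_sequentially intro!: exI[of _ N] tail)
    finally show ?thesis .
  qed
  have iD: "integrable M (\<lambda>x. (S x - T N x)\<^sup>2)" and bD: "(\<integral>x. (S x - T N x)\<^sup>2 \<partial>M) \<le> \<tau> N" for N
    using integrable_integral_le_of_nn_integral[OF _ _ fatou \<tau>0, of N] by auto
  have "(\<lambda>N. \<integral>x. (S x - T N x)\<^sup>2 \<partial>M) \<longlonglongrightarrow> 0"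
    by (rule real_tendsto_sandwich[OF _ _ tendsto_const \<tau>]) (auto simp: bD)
  then have lim: "(\<lambda>N. \<integral>x. (S x - T N x) * f x \<partial>M) \<longlonglongrightarrow> 0"
    by (intro integral_mult_tendsto_0 iD f) auto
  have i\<phi>f: "integrable M (\<lambda>x. \<phi> n x * f x)" for n by (intro integrable_mult_of_squares m\<phi> i\<phi> f)
  have Tf: "(\<lambda>x. T N x * f x) = (\<lambda>x. \<Sum>n<N. \<beta> n * (\<phi> n x * f x))" for N
    by (simp add: fun_eq_iff T_def sum_distrib_right mult.assoc)
  have iT: "integrable M (\<lambda>x. T N x * f x)" for N unfolding Tf using i\<phi>f by auto
  have iDf: "integrable M (\<lambda>x. (S x - T N x) * f x)" for N
    by (intro integrable_mult_of_squares iD f) auto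
  show iS: "integrable M (\<lambda>x. S x * f x)"
    using Bochner_Integration.integrable_add[OF iT[of 0] iDf[of 0]] by (simp add: T_def)
  have "(\<integral>x. (S x - T N x) * f x \<partial>M) = (\<integral>x. S x * f x \<partial>M) - (\<Sum>n<N. \<beta> n * (\<integral>x. \<phi> n x * f x \<partial>M))" for N
    unfolding left_diff_distrib using iS iT[of N] i\<phi>f
    by (subst Bochner_Integration.integral_diff) (auto simp: Tf)
  with lim have "(\<lambda>N. (\<integral>x. S x * f x \<partial>M) - (\<Sum>n<N. \<beta> n * (\<integral>x. \<phi> n x * f x \<partial>M))) \<longlonglongrightarrow> 0" by simp
  from tendsto_diff[OF tendsto_const this, of "\<integral>x. S x * f x \<partial>M"]
  show "(\<lambda>n. \<beta> n * (\<integral>x. \<phi> n x * f x \<partial>M)) sums (\<integral>x. S x * f x \<partial>M)" by (simp add: sums_def)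
qed

section \<open>Pearson diffusions\<close>

text \<open>With polynomial coefficients the generator maps polynomials to polynomials, so on
  partial sums of expansions it is pure algebra with \<open>pderiv\<close>.\<close>

fun drift_poly :: "pearson \<Rightarrow> real poly" where
  "drift_poly (OU \<theta> v \<mu>0) = [:\<theta> * \<mu>0, - \<theta>:]"
| "drift_poly (CIR \<theta> a b) = [:\<theta> * (b / a), - \<theta>:]"
| "drift_poly (Jacobi a b) = [:b - a, - (a + b + 2):]"

fun diffusion_poly :: "pearson \<Rightarrow> real poly" where
  "diffusion_poly (OU \<theta> v \<mu>0) = [:\<theta> * v:]"
| "diffusion_poly (CIR \<theta> a b) = [:0, \<theta> / a:]"
| "diffusion_poly (Jacobi a b) = [:1, 0, - 1:]"

lemma drift_eq_poly: "drift P = poly (drift_poly P)"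
  by (cases P) (auto simp: fun_eq_iff algebra_simps)

lemma diffusion_eq_poly: "diffusion P = poly (diffusion_poly P)"
  by (cases P) (auto simp: fun_eq_iff algebra_simps power2_eq_square)

text \<open>Endpoints in the extended reals present all three state spaces as an
  \<open>einterval\<close>, so that a single integration by parts with limits at the ends covers
  every case.\<close>

fun left_end :: "pearson \<Rightarrow> ereal" where
  "left_end (OU \<theta> v \<mu>0) = - \<infinity>"
| "left_end (CIR \<theta> a b) = ereal 0"
| "left_end (Jacobi a b) = ereal (- 1)"

fun right_end :: "pearson \<Rightarrow> ereal" where
  "right_end (OU \<theta> v \<mu>0) = \<infinity>"
| "right_end (CIR \<theta> a b) = \<infinity>"
| "right_end (Jacobi a b) = ereal 1"

lemma state_space_eq: "state_space P = einterval (left_end P) (right_end P)"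
  by (cases P) (auto simp: einterval_def)

lemma ends_less: "left_end P < right_end P"
  by (cases P) auto

lemma open_state_space: "open (state_space P)"
  by (simp add: state_space_eq)

lemma diffusion_pos: "pearson_params P \<Longrightarrow> x \<in> state_space P \<Longrightarrow> 0 < diffusion P x"
  by (cases P) (auto simp: abs_square_less_1)

lemma stat_density_pos:
  assumes "pearson_params P" "x \<in> state_space P"
  shows "0 < stat_density P x"
proof (cases P)
  case (CIR \<theta> a b)
  have "0 < Gamma b" using assms CIR by (intro Gamma_real_pos) simp
  then show ?thesis using assms CIR by simp
next
  case (Jacobi a b)
  have "0 < Beta (a + 1) (b + 1)"
    using assms Jacobi unfolding Beta_def by (intro divide_pos_pos mult_pos_pos Gamma_real_pos) auto
  then show ?thesis using assms Jacobi by simp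
qed (use assms in simp)

lemma eigval_0 [simp]: "eigval P 0 = 0"
  by (cases P) auto

text \<open>Ordered eigenvalues are what turns a monotone function of z into a monotone sequence of
  multipliers.\<close>

lemma mono_eigval: assumes "pearson_params P" shows "mono (eigval P)"
proof (rule incseq_SucI)
  fix n
  show "eigval P n \<le> eigval P (Suc n)"
  proof (cases P)
    case (Jacobi a b)
    have "eigval P (Suc n) - eigval P n = 2 * real n + (a + b + 2)"
      by (simp add: Jacobi algebra_simps)
    then show ?thesis using assms Jacobi by simp
  qed (use assms in auto)
qed

lemma eigval_nonneg: "pearson_params P \<Longrightarrow> 0 \<le> eigval P n"
  using monoD[OF mono_eigval, of P 0 n] by simp

text \<open>The weight in the Sturm-Liouville form m G g = (D m g')'; up to a constant it is the
  reciprocal of the derivative of the scale function.\<close>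

definition scale_density :: "pearson \<Rightarrow> real \<Rightarrow> real" where
  "scale_density P x = diffusion P x * stat_density P x"

lemma scale_density_pos: "pearson_params P \<Longrightarrow> x \<in> state_space P \<Longrightarrow> 0 < scale_density P x"
  by (simp add: scale_density_def diffusion_pos stat_density_pos)

lemma scale_density_Jacobi:
  assumes y: "y \<in> {-1<..<1}"
  shows "scale_density (Jacobi a b) y =
    1 / (Beta (a + 1) (b + 1) * 2 powr (a + b + 1)) * ((1 - y) powr (a + 1) * (1 + y) powr (b + 1))"
proof -
  have 1: "(1 - y) powr (a + 1) = (1 - y) * (1 - y) powr a" "(1 + y) powr (b + 1) = (1 + y) * (1 + y) powr b"
    using y powr_mult_base[of "1 - y" a] powr_mult_base[of "1 + y" b] by (auto simp: add.commute)
  have 2: "diffusion (Jacobi a b) y = (1 - y) * (1 + y)" by (simp add: power2_eq_square algebra_simps)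
  show ?thesis unfolding scale_density_def 1 2 by simp
qed

text \<open>Pearson's equation (D m)' = \<mu> m, the vanishing of the stationary probability flux.
  It makes the generator symmetric with respect to m and converts the Fokker-Planck operator on m f
  into m times the generator of f.\<close>

lemma scale_density_deriv:
  assumes P: "pearson_params P" and x: "x \<in> state_space P"
  shows "(scale_density P has_real_derivative drift P x * stat_density P x) (at x)"
proof (cases P)
  case (OU \<theta> v \<mu>0)
  have v: "v > 0" using P OU by simp
  define K where "K = 1 / sqrt (2 * pi * v)"
  have "((\<lambda>x. exp (- ((x - \<mu>0)\<^sup>2 / (2 * v)))) has_real_derivative
      exp (- ((x - \<mu>0)\<^sup>2 / (2 * v))) * - ((x - \<mu>0) / v)) (at x)"
    using v by (auto intro!: derivative_eq_intros simp: field_simps)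
  from DERIV_cmult[OF this, of "\<theta> * v * K"]
  have "((\<lambda>x. \<theta> * v * K * exp (- ((x - \<mu>0)\<^sup>2 / (2 * v)))) has_real_derivative
      \<theta> * v * K * (exp (- ((x - \<mu>0)\<^sup>2 / (2 * v))) * - ((x - \<mu>0) / v))) (at x)" .
  moreover have "\<theta> * v * K * (exp (- ((x - \<mu>0)\<^sup>2 / (2 * v))) * - ((x - \<mu>0) / v)) = drift P x * stat_density P x"
    using v by (simp add: OU K_def[symmetric] del: divide_inverse)
  moreover have "scale_density P = (\<lambda>x. \<theta> * v * K * exp (- ((x - \<mu>0)\<^sup>2 / (2 * v))))"
    by (simp add: fun_eq_iff scale_density_def OU K_def)
  ultimately show ?thesis by simp
next
  case (CIR \<theta> a b)
  have p: "\<theta> > 0" "a > 0" "b > 0" "x > 0" using P x CIR by auto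
  define K where "K = a powr b / Gamma b"
  have d: "((\<lambda>x. \<theta> / a * K * (x powr b * exp (- a * x))) has_real_derivative
      \<theta> / a * K * (b * x powr (b - 1) * exp (- a * x) + exp (- a * x) * (- a) * x powr b)) (at x)"
    using p by (auto intro!: derivative_eq_intros)
  have xb: "x powr b = x * x powr (b - 1)" using p powr_mult_base[of x "b - 1"] by simp
  have "\<theta> / a * K * (b * x powr (b - 1) * exp (- a * x) + exp (- a * x) * (- a) * x powr b) =
      drift P x * stat_density P x"
    unfolding xb CIR using p by (simp add: K_def field_simps)
  moreover have "\<forall>\<^sub>F y in nhds x. scale_density P y = \<theta> / a * K * (y powr b * exp (- a * y))"
  proof (rule eventually_mono[OF eventually_nhds_in_open[of "{0<..}" x]])
    fix y :: real assume "y \<in> {0<..}"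
    then have "y powr b = y * y powr (b - 1)" using powr_mult_base[of y "b - 1"] by simp
    then show "scale_density P y = \<theta> / a * K * (y powr b * exp (- a * y))"
      by (simp add: scale_density_def CIR K_def)
  qed (use p in auto)
  ultimately show ?thesis using d by (simp only: DERIV_cong_ev[OF refl _ refl])
next
  case (Jacobi a b)
  have p: "- 1 < x" "x < 1" using x Jacobi by auto
  define K where "K = 1 / (Beta (a + 1) (b + 1) * 2 powr (a + b + 1))"
  have d: "((\<lambda>x. K * ((1 - x) powr (a + 1) * (1 + x) powr (b + 1))) has_real_derivative
      K * (- (a + 1) * (1 - x) powr a * (1 + x) powr (b + 1) + (b + 1) * (1 + x) powr b * (1 - x) powr (a + 1))) (at x)"
    using p by (auto intro!: derivative_eq_intros simp: algebra_simps)
  have e: "(1 - y) powr (a + 1) = (1 - y) * (1 - y) powr a" "(1 + y) powr (b + 1) = (1 + y) * (1 + y) powr b"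
    if "- 1 < y" "y < 1" for y
    using that powr_mult_base[of "1 - y" a] powr_mult_base[of "1 + y" b] by (auto simp: add.commute)
  have "K * (- (a + 1) * (1 - x) powr a * (1 + x) powr (b + 1) + (b + 1) * (1 + x) powr b * (1 - x) powr (a + 1)) =
      K * ((1 - x) powr a * (1 + x) powr b) * drift P x"
    unfolding e[OF p] Jacobi by (simp add: algebra_simps)
  also have "\<dots> = drift P x * stat_density P x"
    by (simp add: Jacobi K_def)
  finally have 1: "K * (- (a + 1) * (1 - x) powr a * (1 + x) powr (b + 1) + (b + 1) * (1 + x) powr b * (1 - x) powr (a + 1)) =
      drift P x * stat_density P x" .
  have "\<forall>\<^sub>F y in nhds x. scale_density P y = K * ((1 - y) powr (a + 1) * (1 + y) powr (b + 1))"
    by (rule eventually_mono[OF eventually_nhds_in_open[of "{-1<..<1}" x]])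
       (use p in \<open>auto simp: Jacobi K_def scale_density_Jacobi\<close>)
  with d show ?thesis unfolding 1 by (simp only: DERIV_cong_ev[OF refl _ refl])
qed

text \<open>For integrating by parts without boundary terms. At infinite ends the exponential beats
  every polynomial; at finite ends the factor D raises the exponents of the density to b,
  respectively a + 1 and b + 1, all positive even where m itself is unbounded.\<close>

lemma scale_density_poly_vanishes:
  assumes P: "pearson_params P"
  shows "(((\<lambda>x. scale_density P x * poly p x) \<circ> real_of_ereal) \<longlongrightarrow> 0) (at_right (left_end P))"
    and "(((\<lambda>x. scale_density P x * poly p x) \<circ> real_of_ereal) \<longlongrightarrow> 0) (at_left (right_end P))"
proof -
  have mono: "((\<lambda>x. scale_density P x * poly p x) \<longlongrightarrow> 0) F"
    if "\<And>k. ((\<lambda>x. scale_density P x * x ^ k) \<longlongrightarrow> 0) F" for F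
  proof -
    have "((\<lambda>x. \<Sum>k\<le>degree p. coeff p k * (scale_density P x * x ^ k)) \<longlongrightarrow> (\<Sum>k\<le>degree p. coeff p k * 0)) F"
      by (intro tendsto_sum tendsto_mult tendsto_const that)
    then show ?thesis by (simp add: poly_altdef sum_distrib_left mult_ac)
  qed
  \<comment> \<open>At a finite end p has a limit, so it is enough that
    \<open>scale_density P\<close> tends to 0.\<close>
  have bdd: "((\<lambda>x. scale_density P x * poly p x) \<longlongrightarrow> 0) (at c within A)"
    if "(scale_density P \<longlongrightarrow> 0) (at c within A)" for c A
  proof -
    have "((\<lambda>x. scale_density P x * poly p x) \<longlongrightarrow> 0 * poly p c) (at c within A)"
      by (intro tendsto_mult that isCont_tendsto_compose[OF _ tendsto_ident_at]) simp
    then show ?thesis by simp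
  qed
  have "(((\<lambda>x. scale_density P x * poly p x) \<circ> real_of_ereal) \<longlongrightarrow> 0) (at_right (left_end P)) \<and>
    (((\<lambda>x. scale_density P x * poly p x) \<circ> real_of_ereal) \<longlongrightarrow> 0) (at_left (right_end P))"
  proof (cases P)
    case (OU \<theta> v \<mu>0)
    have v: "v > 0" using P OU by simp
    have "((\<lambda>x. exp (- ((x - \<mu>0)\<^sup>2 / (2 * v))) * x ^ k) \<longlongrightarrow> 0) at_top"
         "((\<lambda>x. exp (- ((x - \<mu>0)\<^sup>2 / (2 * v))) * x ^ k) \<longlongrightarrow> 0) at_bot" for k
      using v by real_asymp+
    from this[THEN tendsto_mult[OF tendsto_const[of "\<theta> * v * (1 / sqrt (2 * pi * v))"]]]
    show ?thesis
      unfolding OU left_end.simps right_end.simps ereal_tendsto_simps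
      by (intro conjI mono[unfolded OU]) (simp_all add: scale_density_def mult.assoc)
  next
    case (CIR \<theta> a b)
    have p: "\<theta> > 0" "a > 0" "b > 0" using P CIR by auto
    define K where "K = a powr b / Gamma b"
    have eq: "scale_density P x = \<theta> / a * K * (x powr b * exp (- a * x))" if "0 < x" for x
      using that powr_mult_base[of x "b - 1"] by (simp add: scale_density_def CIR K_def)
    have "((\<lambda>x. x powr b * exp (- a * x) * x ^ k) \<longlongrightarrow> 0) at_top" for k
      using p by real_asymp
    from tendsto_mult_right_zero[OF this, of "\<theta> / a * K"]
    have t: "((\<lambda>x. scale_density P x * x ^ k) \<longlongrightarrow> 0) at_top" for k
      by (rule Lim_transform_eventually)
         (auto simp: eq mult.assoc intro!: eventually_mono[OF eventually_gt_at_top[of 0]])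
    have "((\<lambda>x. x powr b * exp (- a * x)) \<longlongrightarrow> 0) (at_right 0)"
      using p by real_asymp
    from tendsto_mult_right_zero[OF this, of "\<theta> / a * K"]
    have "(scale_density P \<longlongrightarrow> 0) (at_right 0)"
      by (rule Lim_transform_eventually)
         (auto simp: eq intro!: eventually_mono[OF eventually_at_right_less[of 0]])
    then show ?thesis
      using mono[OF t] bdd unfolding CIR left_end.simps right_end.simps ereal_tendsto_simps by blast
  next
    case (Jacobi a b)
    have ab: "0 < a + 1" "0 < b + 1" using P Jacobi by auto
    define K where "K = 1 / (Beta (a + 1) (b + 1) * 2 powr (a + b + 1))"
    define s where "s = (\<lambda>y::real. K * ((1 - y) powr (a + 1) * (1 + y) powr (b + 1)))"
    have e: "scale_density P y = s y" if "- 1 < y" "y < 1" for y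
      using that by (simp add: s_def Jacobi K_def scale_density_Jacobi)
    have cont: "continuous_on {-1..1} s"
      unfolding s_def using ab by (intro continuous_intros continuous_on_powr') auto
    have "(s \<longlongrightarrow> s (-1)) (at_right (-1))" "(s \<longlongrightarrow> s 1) (at_left 1)"
      using continuous_on_Icc_at_rightD[OF cont] continuous_on_Icc_at_leftD[OF cont] by auto
    then have "(s \<longlongrightarrow> 0) (at_right (-1))" "(s \<longlongrightarrow> 0) (at_left 1)"
      by (simp_all add: s_def)
    moreover have "\<forall>\<^sub>F y in at_right (-1). s y = scale_density P y"
      by (rule eventually_mono[OF eventually_at_right_real[of "-1" 1]]) (auto simp: e)
    moreover have "\<forall>\<^sub>F y in at_left 1. s y = scale_density P y"
      by (rule eventually_mono[OF eventually_at_left_real[of "-1" 1]]) (auto simp: e)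
    ultimately have "(scale_density P \<longlongrightarrow> 0) (at_right (-1))" "(scale_density P \<longlongrightarrow> 0) (at_left 1)"
      by (blast intro: Lim_transform_eventually)+
    then show ?thesis
      using bdd unfolding Jacobi left_end.simps right_end.simps ereal_tendsto_simps by blast
  qed
  then show "(((\<lambda>x. scale_density P x * poly p x) \<circ> real_of_ereal) \<longlongrightarrow> 0) (at_right (left_end P))"
    and "(((\<lambda>x. scale_density P x * poly p x) \<circ> real_of_ereal) \<longlongrightarrow> 0) (at_left (right_end P))" by auto
qed

section \<open>Integrating polynomials against the stationary density\<close>

locale pearson_basis =
  fixes P :: pearson and Q :: "nat \<Rightarrow> real poly"
  assumes params: "pearson_params P" and basis: "orthonormal_eigenpolys P Q"
begin

abbreviation "S \<equiv> state_space P"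
abbreviation "m \<equiv> stat_density P"
abbreviation "lam \<equiv> eigval P"

lemma degree_Q: "degree (Q n) = n"
  using basis by (simp add: orthonormal_eigenpolys_def)

lemma Q_eigen: "x \<in> S \<Longrightarrow> generator P (poly (Q n)) x = - lam n * poly (Q n) x"
  using basis by (simp add: orthonormal_eigenpolys_def)

lemma Q_orthonormal: "(LINT x:S|lborel. poly (Q n) x * poly (Q k) x * m x) = (if n = k then 1 else 0)"
  using basis by (simp add: orthonormal_eigenpolys_def)

lemma m_eq: "x \<in> S \<Longrightarrow> m x = scale_density P x / diffusion P x"
  using diffusion_pos[OF params, of x] by (simp add: scale_density_def)

lemma continuous_on_scale_density: "continuous_on S (scale_density P)"
  using scale_density_deriv[OF params] by (meson DERIV_isCont continuous_at_imp_continuous_on)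

text \<open>Writing m as (D m) / D lets continuity follow from \<open>scale_density_deriv\<close>,
  without treating the three families again.\<close>

lemma continuous_on_m: "continuous_on S m"
proof -
  have "continuous_on S (diffusion P)" unfolding diffusion_eq_poly by (intro continuous_intros)
  moreover have "\<forall>x\<in>S. diffusion P x \<noteq> 0" using diffusion_pos[OF params] by force
  ultimately have "continuous_on S (\<lambda>x. scale_density P x / diffusion P x)"
    by (intro continuous_on_divide continuous_on_scale_density)
  then show ?thesis by (rule continuous_on_eq) (simp add: m_eq)
qed

lemma sets_S [measurable]: "S \<in> sets borel"
  by (simp add: open_state_space)

lemma measurable_m: "(\<lambda>x. indicator S x * m x) \<in> borel_measurable borel"
  using borel_measurable_continuous_on_indicator[OF sets_S continuous_on_m] by simp

lemma measurable_poly [measurable]: "poly p \<in> borel_measurable borel" for p :: "real poly"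
  by (intro borel_measurable_continuous_onI continuous_intros)

lemma set_measurable_poly: "set_borel_measurable lborel S (\<lambda>x. poly p x * m x)"
proof -
  have "(\<lambda>x. poly p x * (indicator S x * m x)) \<in> borel_measurable borel"
    using measurable_m by measurable
  then show ?thesis by (simp add: set_borel_measurable_def mult_ac)
qed

text \<open>The normalization makes the integral of \<open>(poly (Q n) x)\<^sup>2 * m x\<close> nonzero, so this
  function is integrable; hence so is the product of any polynomial with \<open>m\<close>.\<close>

lemma integrable_Q_square: "set_integrable lborel S (\<lambda>x. poly (Q n * Q n) x * m x)"
proof (rule ccontr)
  assume "\<not> ?thesis"
  then have "(LINT x:S|lborel. poly (Q n * Q n) x * m x) = 0"
    unfolding set_integrable_def set_lebesgue_integral_def by (rule not_integrable_integral_eq)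
  then show False using Q_orthonormal[of n n] by simp
qed

lemma Q_0: obtains q where "q \<noteq> 0" "Q 0 = [:q:]"
proof -
  obtain q where q: "Q 0 = [:q:]" using degree_Q[of 0] by (rule degree_eq_zeroE)
  have "q \<noteq> 0"
  proof
    assume "q = 0"
    then show False using Q_orthonormal[of 0 0] q by (simp add: set_lebesgue_integral_def)
  qed
  then show ?thesis using q that by blast
qed

lemma integrable_m: "set_integrable lborel S (\<lambda>x. poly 1 x * m x)"
proof -
  obtain q where q: "q \<noteq> 0" "Q 0 = [:q:]" by (rule Q_0)
  have "set_integrable lborel S (\<lambda>x. (1 / q\<^sup>2) * (poly (Q 0 * Q 0) x * m x))"
    using integrable_Q_square[of 0] by (rule set_integrable_mult_right)
  then show ?thesis using q by (simp add: power2_eq_square)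
qed

lemma integrable_Q: "set_integrable lborel S (\<lambda>x. poly (Q n) x * m x)"
proof (rule set_integrable_bound)
  show "set_integrable lborel S (\<lambda>x. poly 1 x * m x + poly (Q n * Q n) x * m x)"
    by (intro set_integral_add integrable_m integrable_Q_square)
  show "AE x in lborel. x \<in> S \<longrightarrow> norm (poly (Q n) x * m x) \<le> norm (poly 1 x * m x + poly (Q n * Q n) x * m x)"
  proof (intro AE_I2 impI)
    fix x assume x: "x \<in> S"
    have "\<bar>poly (Q n) x\<bar> \<le> 1 + poly (Q n) x * poly (Q n) x"
      using abs_mult_le_weighted_squares[of 1 1 "poly (Q n) x"] by (simp add: power2_eq_square)
    then have "\<bar>poly (Q n) x\<bar> * m x \<le> (1 + poly (Q n) x * poly (Q n) x) * m x"
      using stat_density_pos[OF params x] by (intro mult_right_mono) auto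
    then show "norm (poly (Q n) x * m x) \<le> norm (poly 1 x * m x + poly (Q n * Q n) x * m x)"
      using stat_density_pos[OF params x] by (simp add: abs_mult distrib_right)
  qed
qed (rule set_measurable_poly)

text \<open>Induction on a degree bound: Q n has exact degree n, so subtracting a multiple of it
  lowers the degree. The moments of the three densities need not be computed.\<close>

lemma integrable_poly: "set_integrable lborel S (\<lambda>x. poly p x * m x)"
proof -
  have "degree p < n \<Longrightarrow> set_integrable lborel S (\<lambda>x. poly p x * m x)" for n p
  proof (induction n arbitrary: p)
    case (Suc n)
    define c where "c = coeff p n / coeff (Q n) n"
    have "coeff (Q n) n \<noteq> 0"
    proof (cases n)
      case 0
      then show ?thesis using Q_0 by (metis coeff_pCons_0)
    next
      case (Suc k)
      then show ?thesis using degree_Q[of n] by (metis leading_coeff_0_iff degree_0 nat.distinct(1))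
    qed
    then have c: "coeff (p - smult c (Q n)) n = 0" by (simp add: c_def)
    have le: "degree (p - smult c (Q n)) \<le> n"
      using Suc.prems degree_Q[of n] by (intro degree_diff_le) (auto intro: order_trans[OF degree_smult_le])
    have "set_integrable lborel S (\<lambda>x. poly (p - smult c (Q n)) x * m x)"
    proof (cases "p - smult c (Q n) = 0")
      case True
      then show ?thesis by (simp add: set_integrable_def)
    next
      case False
      then have "degree (p - smult c (Q n)) \<noteq> n" using c by (metis leading_coeff_0_iff)
      then show ?thesis using le by (intro Suc.IH) simp
    qed
    moreover have "set_integrable lborel S (\<lambda>x. c * (poly (Q n) x * m x))"
      by (intro set_integrable_mult_right integrable_Q)
    ultimately have "set_integrable lborel S (\<lambda>x. poly (p - smult c (Q n)) x * m x + c * (poly (Q n) x * m x))"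
      by (rule set_integral_add)
    then show ?case by (simp add: algebra_simps)
  qed simp
  then show ?thesis by blast
qed

definition mean :: "real poly \<Rightarrow> real" where
  "mean p = (LINT x:S|lborel. poly p x * m x)"

lemma mean_add: "mean (p + q) = mean p + mean q"
  unfolding mean_def poly_add distrib_right by (rule set_integral_add(2)[OF integrable_poly integrable_poly])

lemma mean_smult: "mean (smult c p) = c * mean p"
  unfolding mean_def by (simp add: mult.assoc)

lemma mean_sum: "mean (\<Sum>i\<in>I. f i) = (\<Sum>i\<in>I. mean (f i))"
proof -
  have 0: "mean 0 = 0" by (simp add: mean_def set_lebesgue_integral_def)
  show ?thesis
    by (induction I rule: infinite_finite_induct) (simp_all add: 0 mean_add)
qed

lemma mean_cong: "(\<And>x. x \<in> S \<Longrightarrow> poly p x = poly q x) \<Longrightarrow> mean p = mean q"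
  unfolding mean_def by (intro set_lebesgue_integral_cong) auto

lemma mean_Q: "mean (Q n * Q k) = (if n = k then 1 else 0)"
  using Q_orthonormal[of n k] by (simp add: mean_def)

lemma mean_combination:
  assumes "finite I"
  shows "mean ((\<Sum>n\<in>I. smult (b n) (Q n)) * (\<Sum>n\<in>I. smult (c n) (Q n))) = (\<Sum>n\<in>I. b n * c n)"
proof -
  have "mean ((\<Sum>n\<in>I. smult (b n) (Q n)) * (\<Sum>n\<in>I. smult (c n) (Q n))) =
      (\<Sum>n\<in>I. \<Sum>k\<in>I. b n * (c k * (if n = k then 1 else 0)))"
    by (simp add: sum_product mean_sum mean_smult mean_Q mult_ac)
  also have "\<dots> = (\<Sum>n\<in>I. b n * c n)"
    using assms by (intro sum.cong) (auto simp: if_distrib sum.delta cong: if_cong)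
  finally show ?thesis .
qed

section \<open>The generator on polynomials and its Dirichlet form\<close>

definition gen_poly :: "real poly \<Rightarrow> real poly" where
  "gen_poly g = drift_poly P * pderiv g + diffusion_poly P * pderiv (pderiv g)"

lemma deriv_poly: "deriv (poly p) = poly (pderiv p)" for p :: "real poly"
  by (rule ext) (rule DERIV_imp_deriv[OF poly_DERIV])

lemma generator_poly: "generator P (poly g) x = poly (gen_poly g) x"
  by (simp add: generator_def gen_poly_def deriv_poly drift_eq_poly diffusion_eq_poly)

lemma gen_poly_sum: "gen_poly (\<Sum>n\<in>I. smult (b n) (Q n)) = (\<Sum>n\<in>I. smult (b n) (gen_poly (Q n)))"
proof -
  have "gen_poly 0 = 0" by (simp add: gen_poly_def)
  moreover have "gen_poly (smult c p + q) = smult c (gen_poly p) + gen_poly q" for c p q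
    by (simp add: gen_poly_def pderiv_add pderiv_smult algebra_simps smult_add_right)
  ultimately show ?thesis
    by (induction I rule: infinite_finite_induct) simp_all
qed

lemma gen_poly_Q: "x \<in> S \<Longrightarrow> poly (gen_poly (Q n)) x = - lam n * poly (Q n) x"
  using Q_eigen generator_poly by metis

text \<open>The product rule and Pearson's equation give (D m g g')' = m r for the polynomial r
  below, and D m g g' vanishes at both ends of the state space.\<close>

lemma mean_parts: "mean (diffusion_poly P * (pderiv g)\<^sup>2) = - mean (g * gen_poly g)"
proof -
  define r where "r = diffusion_poly P * (pderiv g)\<^sup>2 + g * gen_poly g"
  have "(LBINT x=left_end P..right_end P. poly r x * m x) = 0 - 0"
  proof (rule interval_integral_FTC_integrable[OF ends_less])
    fix x assume "left_end P < ereal x" "ereal x < right_end P"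
    then have x: "x \<in> S" by (simp add: state_space_eq einterval_def)
    have "((\<lambda>x. scale_density P x * poly (g * pderiv g) x) has_real_derivative
        (drift P x * m x) * poly (g * pderiv g) x + poly (pderiv (g * pderiv g)) x * scale_density P x) (at x)"
      by (rule DERIV_mult[OF scale_density_deriv[OF params x] poly_DERIV])
    moreover have "(drift P x * m x) * poly (g * pderiv g) x + poly (pderiv (g * pderiv g)) x * scale_density P x =
        poly r x * m x"
      by (simp add: r_def gen_poly_def scale_density_def drift_eq_poly diffusion_eq_poly pderiv_mult
          power2_eq_square algebra_simps)
    ultimately show "((\<lambda>x. scale_density P x * poly (g * pderiv g) x) has_vector_derivative poly r x * m x) (at x)"
      by (simp add: has_real_derivative_iff_has_vector_derivative)
    show "isCont (\<lambda>x. poly r x * m x) x"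
      using continuous_on_m x open_state_space by (auto simp: continuous_on_eq_continuous_at)
  next
    show "set_integrable lborel (einterval (left_end P) (right_end P)) (\<lambda>x. poly r x * m x)"
      using integrable_poly by (simp add: state_space_eq)
  qed (rule scale_density_poly_vanishes[OF params])+
  then have "mean r = 0"
    using ends_less[of P] by (simp add: mean_def interval_lebesgue_integral_def state_space_eq less_imp_le)
  then show ?thesis by (simp add: r_def mean_add)
qed

lemma compact_lower_bound:
  assumes "{a..b} \<subseteq> S" "a \<le> b"
  shows "\<exists>c>0. \<forall>y\<in>{a..b}. c \<le> m y \<and> c \<le> scale_density P y"
proof -
  have "continuous_on {a..b} m" "continuous_on {a..b} (scale_density P)"
    using continuous_on_subset[OF continuous_on_m] continuous_on_subset[OF continuous_on_scale_density] assms by auto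
  then obtain u v where u: "u \<in> {a..b}" "\<And>y. y \<in> {a..b} \<Longrightarrow> m u \<le> m y"
      and v: "v \<in> {a..b}" "\<And>y. y \<in> {a..b} \<Longrightarrow> scale_density P v \<le> scale_density P y"
    using assms continuous_attains_inf[of "{a..b}" m] continuous_attains_inf[of "{a..b}" "scale_density P"] by auto
  have "u \<in> S" "v \<in> S" using u(1) v(1) assms(1) by auto
  then have "0 < min (m u) (scale_density P v)"
    using stat_density_pos[OF params] scale_density_pos[OF params] by simp
  moreover have "\<forall>y\<in>{a..b}. min (m u) (scale_density P v) \<le> m y \<and> min (m u) (scale_density P v) \<le> scale_density P y"
    using u(2) v(2) by (auto simp: min.coboundedI1 min.coboundedI2)
  ultimately show ?thesis by blast
qed

section \<open>Point evaluation in the energy norm\<close>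

text \<open>Point evaluation is bounded in the energy norm: integrate the derivative of
  $(x_0+\delta-y)\,g(y)^2$ over $[x_0, x_0+\delta]$.\<close>

lemma energy_bound:
  assumes x0: "x0 \<in> S"
  shows "\<exists>C\<ge>0. \<forall>g. (poly g x0)\<^sup>2 \<le> C * (mean (g * g) - mean (g * gen_poly g))"
proof -
  obtain d where d: "0 < d" "cball x0 d \<subseteq> S" using open_contains_cball open_state_space x0 by blast
  define I where "I = {x0..x0+d}"
  have IS: "I \<subseteq> S" using d by (auto simp: I_def cball_def dist_real_def subset_iff)
  then obtain c where c: "0 < c" "\<And>y. y \<in> I \<Longrightarrow> c \<le> m y \<and> c \<le> scale_density P y"
    using compact_lower_bound[of x0 "x0+d"] d unfolding I_def by auto
  \<comment> \<open>The factor (1 + d) / c comes from the pointwise estimate \<open>le\<close>, and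
    1 / d from the weight x0 + d - y, which equals d at y = x0.\<close>
  define C where "C = (1 + d) / (c * d)"
  have "(poly g x0)\<^sup>2 \<le> C * (mean (g * g) - mean (g * gen_poly g))" for g
  proof -
    \<comment> \<open>By \<open>mean_parts\<close>, \<open>mean r\<close> is the energy on the
      right-hand side of the claim.\<close>
    define r where "r = g * g + diffusion_poly P * (pderiv g)\<^sup>2"
    define f where "f = (\<lambda>y. 2 * (poly g y * poly (pderiv g) y) * (x0 + d - y) - (poly g y)\<^sup>2)"
    have "(f has_integral ((poly g (x0 + d))\<^sup>2 * (x0 + d - (x0 + d)) - (poly g x0)\<^sup>2 * (x0 + d - x0))) I"
      unfolding I_def
    proof (rule fundamental_theorem_of_calculus)
      fix y
      have "((\<lambda>y. (poly g y)\<^sup>2 * (x0 + d - y)) has_real_derivative f y) (at y)"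
        unfolding f_def by (auto intro!: derivative_eq_intros poly_DERIV)
      then show "((\<lambda>y. (poly g y)\<^sup>2 * (x0 + d - y)) has_vector_derivative f y) (at y within {x0..x0+d})"
        by (simp add: has_real_derivative_iff_has_vector_derivative has_vector_derivative_at_within)
    qed (use d in auto)
    from has_integral_neg[OF this] have f: "((\<lambda>y. - f y) has_integral (d * (poly g x0)\<^sup>2)) I"
      by (simp add: mult.commute)
    have "set_integrable lborel S (\<lambda>y. poly r y * m y)" by (rule integrable_poly)
    then have rS: "(\<lambda>y. poly r y * m y) integrable_on S" "integral S (\<lambda>y. poly r y * m y) = mean r"
      using set_borel_integral_eq_integral[of S "\<lambda>y. poly r y * m y"] by (simp_all add: mean_def)
    have rm: "poly r y * m y = (poly g y)\<^sup>2 * m y + (poly (pderiv g) y)\<^sup>2 * scale_density P y" for y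
      by (simp add: r_def scale_density_def diffusion_eq_poly power2_eq_square algebra_simps)
    have nonneg: "0 \<le> poly r y * m y" if "y \<in> S" for y
      unfolding rm using stat_density_pos[OF params that] scale_density_pos[OF params that] by simp
    have rI: "(\<lambda>y. poly r y * m y) integrable_on I"
      unfolding I_def using IS continuous_on_subset[OF continuous_on_m]
      by (intro integrable_continuous_real continuous_intros) (auto simp: I_def)
    have le: "- f y \<le> (1 + d) / c * (poly r y * m y)" if y: "y \<in> I" for y
    proof -
      define u v w where "u = poly g y" and "v = poly (pderiv g) y" and "w = x0 + d - y"
      have w: "0 \<le> w" "w \<le> d" using y by (auto simp: I_def w_def)
      have "2 * - (u * v) \<le> u\<^sup>2 + v\<^sup>2"
        using sum_squares_bound[of u "- v"] by simp
      then have "2 * - (u * v) * w \<le> (u\<^sup>2 + v\<^sup>2) * w" using w by (intro mult_right_mono) auto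
      also have "\<dots> \<le> (u\<^sup>2 + v\<^sup>2) * d" using w by (intro mult_left_mono) auto
      finally have "- f y \<le> (u\<^sup>2 + v\<^sup>2) * d + u\<^sup>2"
        unfolding f_def u_def[symmetric] v_def[symmetric] w_def[symmetric] by simp
      also have "\<dots> \<le> (u\<^sup>2 + v\<^sup>2) * (1 + d)" by (simp add: algebra_simps)
      finally have "- f y \<le> ((poly g y)\<^sup>2 + (poly (pderiv g) y)\<^sup>2) * (1 + d)"
        by (simp only: u_def v_def)
      also have "\<dots> = (1 + d) / c * ((poly g y)\<^sup>2 * c + (poly (pderiv g) y)\<^sup>2 * c)"
        using c(1) by (simp add: distrib_right[symmetric])
      also have "\<dots> \<le> (1 + d) / c * (poly r y * m y)"
        unfolding rm using c(2)[OF y] c(1) d by (intro mult_left_mono add_mono) auto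
      finally show ?thesis .
    qed
    have "d * (poly g x0)\<^sup>2 = integral I (\<lambda>y. - f y)" using f by (rule integral_unique[symmetric])
    also have "\<dots> \<le> integral I (\<lambda>y. (1 + d) / c * (poly r y * m y))"
      using f rI le by (intro integral_le integrable_on_mult_right) auto
    also have "\<dots> = (1 + d) / c * integral I (\<lambda>y. poly r y * m y)" by simp
    also have "\<dots> \<le> (1 + d) / c * mean r"
      using integral_subset_le[OF IS rI rS(1)] nonneg rS(2) c d by (intro mult_left_mono) auto
    finally have "(poly g x0)\<^sup>2 \<le> C * mean r"
      using d c by (simp add: C_def field_simps)
    then show ?thesis by (simp add: r_def mean_add mean_parts)
  qed
  moreover have "0 \<le> C" using c d by (simp add: C_def)
  ultimately show ?thesis by blast
qed

text \<open>\<open>energy_bound\<close> is tested on the truncated Riesz representer of evaluation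
  at x0, with coefficients Q_n(x0) / (1 + lam n). Its value at x0 and its energy are the same
  partial sum s, so s^2 \<le> C s gives s \<le> C.\<close>

lemma summable_Q_squared:
  assumes x0: "x0 \<in> S"
  shows "summable (\<lambda>n. (poly (Q n) x0)\<^sup>2 / (1 + lam n))"
proof -
  obtain C where C: "0 \<le> C" "\<And>g. (poly g x0)\<^sup>2 \<le> C * (mean (g * g) - mean (g * gen_poly g))"
    using energy_bound[OF x0] by blast
  have l: "0 < 1 + lam n" for n using eigval_nonneg[OF params, of n] by simp
  have bound: "(\<Sum>n<N. (poly (Q n) x0)\<^sup>2 / (1 + lam n)) \<le> C" for N
  proof -
    define b where "b = (\<lambda>n. poly (Q n) x0 / (1 + lam n))"
    define g where "g = (\<Sum>n<N. smult (b n) (Q n))"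
    define s where "s = (\<Sum>n<N. (poly (Q n) x0)\<^sup>2 / (1 + lam n))"
    have gx: "poly g x0 = s"
      unfolding g_def b_def s_def by (simp add: poly_sum power2_eq_square mult.commute)
    have "mean (g * gen_poly g) = mean (g * (\<Sum>n<N. smult (- (b n * lam n)) (Q n)))"
      by (rule mean_cong) (simp add: g_def gen_poly_sum poly_sum gen_poly_Q mult.assoc sum_negf)
    also have "\<dots> = (\<Sum>n<N. b n * (- (b n * lam n)))"
      unfolding g_def by (rule mean_combination) simp
    finally have "mean (g * g) - mean (g * gen_poly g) = (\<Sum>n<N. (b n)\<^sup>2 * (1 + lam n))"
      unfolding g_def mean_combination[OF finite_lessThan]
      by (simp add: sum_subtractf[symmetric] sum.distrib[symmetric] sum_negf power2_eq_square algebra_simps)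
    also have "\<dots> = s"
      unfolding s_def b_def using l by (intro sum.cong) (auto simp: power2_eq_square less_imp_neq[symmetric])
    finally have "s\<^sup>2 \<le> C * s" using C(2)[of g] gx by simp
    moreover have "0 \<le> s" unfolding s_def using l by (intro sum_nonneg) (simp add: less_imp_le)
    ultimately have "s \<le> C" using C(1) by (cases "s = 0") (auto simp: power2_eq_square)
    then show ?thesis by (simp add: s_def)
  qed
  show ?thesis
  proof (rule bounded_imp_summable)
    show "0 \<le> (poly (Q n) x0)\<^sup>2 / (1 + lam n)" for n using l[of n] by simp
    show "(\<Sum>k\<le>n. (poly (Q k) x0)\<^sup>2 / (1 + lam k)) \<le> C" for n
      using bound[of "Suc n"] unfolding lessThan_Suc_atMost .
  qed
qed

end

section \<open>Termwise application of the generator and of the Fokker--Planck operator\<close>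

context pearson_basis
begin

text \<open>Since $(Dm\,g')' = m\,\mathcal{G}g$ and, by the mean value theorem, $g'$ is controlled by \<open>g\<close>
  somewhere in the interval, \<open>g\<close> and $\mathcal{G}g$ together control $g'$ and $g''$.\<close>

lemma generator_controls_derivatives:
  assumes ab: "{a..b} \<subseteq> S" "a < b"
  shows "\<exists>C>0. \<forall>g M. (\<forall>y\<in>{a..b}. \<bar>poly g y\<bar> \<le> M \<and> \<bar>poly (gen_poly g) y\<bar> \<le> M) \<longrightarrow>
     (\<forall>y\<in>{a..b}. \<bar>poly (pderiv g) y\<bar> \<le> C * M \<and> \<bar>poly (pderiv (pderiv g)) y\<bar> \<le> C * M)"
proof -
  obtain c where c: "0 < c" "\<And>y. y \<in> {a..b} \<Longrightarrow> c \<le> m y \<and> c \<le> scale_density P y"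
    using compact_lower_bound[OF ab(1)] ab by auto
  have "continuous_on {a..b} m" "continuous_on {a..b} (scale_density P)"
    "continuous_on {a..b} (drift P)" "continuous_on {a..b} (diffusion P)"
    using continuous_on_subset[OF continuous_on_m ab(1)] continuous_on_subset[OF continuous_on_scale_density ab(1)]
    unfolding drift_eq_poly diffusion_eq_poly by (auto intro!: continuous_intros)
  then have "bounded (m ` {a..b})" "bounded (scale_density P ` {a..b})" "bounded (drift P ` {a..b})"
      "bounded (diffusion P ` {a..b})"
    by (auto intro!: compact_imp_bounded compact_continuous_image)
  then obtain K1 K2 K3 K4 where K: "\<And>y. y \<in> {a..b} \<Longrightarrow> \<bar>m y\<bar> \<le> K1" "\<And>y. y \<in> {a..b} \<Longrightarrow> \<bar>scale_density P y\<bar> \<le> K2"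
      "\<And>y. y \<in> {a..b} \<Longrightarrow> \<bar>drift P y\<bar> \<le> K3" "\<And>y. y \<in> {a..b} \<Longrightarrow> \<bar>diffusion P y\<bar> \<le> K4"
    unfolding bounded_iff by (metis image_eqI real_norm_def)
  have K0: "0 \<le> K1" "0 \<le> K2" "0 \<le> K3" "0 \<le> K4"
    using K[of a] ab by (auto intro: order_trans[OF abs_ge_zero])
  \<comment> \<open>At a mean value point g' is at most 2 M / (b - a); from there D m g' changes by
    at most K1 M (b - a), its derivative being m G g. Division by c \<le> D m bounds g'.\<close>
  define C1 where "C1 = (K2 * (2 / (b - a)) + K1 * (b - a)) / c"
  \<comment> \<open>From D g'' = G g - \<mu> g', where D \<ge> c / K1 because c \<le> D m and m
    \<le> K1.\<close>
  define C2 where "C2 = (1 + K3 * C1) * (K1 / c)"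
  have C1: "0 \<le> C1" using K0 ab c by (simp add: C1_def)
  have C2: "0 \<le> C2" using K0 C1 c by (simp add: C2_def)
  have main: "\<bar>poly (pderiv g) y\<bar> \<le> C1 * M \<and> \<bar>poly (pderiv (pderiv g)) y\<bar> \<le> C2 * M"
    if g: "\<And>y. y \<in> {a..b} \<Longrightarrow> \<bar>poly g y\<bar> \<le> M" "\<And>y. y \<in> {a..b} \<Longrightarrow> \<bar>poly (gen_poly g) y\<bar> \<le> M"
      and y: "y \<in> {a..b}" for g M y
  proof -
    have M: "0 \<le> M" using g(1)[OF y] by linarith
    define s where "s = (\<lambda>x. scale_density P x * poly (pderiv g) x)"
    have ds: "(s has_real_derivative m x * poly (gen_poly g) x) (at x)" if x: "x \<in> {a..b}" for x
    proof -
      have "(s has_real_derivative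
          (drift P x * m x) * poly (pderiv g) x + poly (pderiv (pderiv g)) x * scale_density P x) (at x)"
        unfolding s_def using x ab by (intro DERIV_mult[OF scale_density_deriv[OF params] poly_DERIV]) auto
      moreover have "(drift P x * m x) * poly (pderiv g) x + poly (pderiv (pderiv g)) x * scale_density P x =
          m x * poly (gen_poly g) x"
        by (simp add: gen_poly_def scale_density_def drift_eq_poly diffusion_eq_poly algebra_simps)
      ultimately show ?thesis by simp
    qed
    obtain \<xi> where \<xi>: "a < \<xi>" "\<xi> < b" "poly g b - poly g a = (b - a) * poly (pderiv g) \<xi>"
      using MVT2[OF ab(2), of "poly g" "poly (pderiv g)"] poly_DERIV by blast
    have "\<bar>poly (pderiv g) \<xi>\<bar> * (b - a) = \<bar>poly g b - poly g a\<bar>"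
      using \<xi>(3) ab by (simp add: abs_mult)
    also have "\<dots> \<le> 2 * M" using g(1)[of a] g(1)[of b] ab by auto
    finally have "\<bar>poly (pderiv g) \<xi>\<bar> \<le> 2 / (b - a) * M" using ab by (simp add: field_simps)
    then have s\<xi>: "\<bar>s \<xi>\<bar> \<le> K2 * (2 / (b - a) * M)"
      unfolding s_def abs_mult using K(2)[of \<xi>] \<xi> K0 by (intro mult_mono) auto
    have "norm (s y - s \<xi>) \<le> (K1 * M) * norm (y - \<xi>)"
    proof (rule field_differentiable_bound[of "{a..b}"])
      show "(s has_field_derivative m x * poly (gen_poly g) x) (at x within {a..b})" if "x \<in> {a..b}" for x
        using ds[OF that] DERIV_subset by blast
      show "norm (m x * poly (gen_poly g) x) \<le> K1 * M" if "x \<in> {a..b}" for x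
        using K(1)[OF that] g(2)[OF that] K0 by (auto simp: abs_mult intro!: mult_mono)
    qed (use y \<xi> in auto)
    also have "\<dots> \<le> (K1 * M) * (b - a)"
      using y \<xi> K0 M by (intro mult_left_mono) auto
    finally have "\<bar>s y\<bar> \<le> K2 * (2 / (b - a) * M) + K1 * M * (b - a)" using s\<xi> unfolding real_norm_def by linarith
    also have "\<dots> = (c * C1) * M"
    proof -
      have "c * C1 = K2 * (2 / (b - a)) + K1 * (b - a)" using c(1) by (simp add: C1_def)
      moreover have "K2 * (u * M) + K1 * M * v = (K2 * u + K1 * v) * M" for u v
        by (simp add: algebra_simps)
      ultimately show ?thesis by (simp only:)
    qed
    also have "\<dots> = c * (C1 * M)" by simp
    finally have "\<bar>s y\<bar> \<le> c * (C1 * M)" .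
    moreover have "c * \<bar>poly (pderiv g) y\<bar> \<le> \<bar>s y\<bar>"
      unfolding s_def abs_mult using c(2)[OF y] by (intro mult_right_mono) auto
    ultimately have 1: "\<bar>poly (pderiv g) y\<bar> \<le> C1 * M"
      using c(1) by (meson mult_le_cancel_left_pos order_trans)
    have yS: "y \<in> S" using y ab by auto
    have D: "c / K1 \<le> diffusion P y" "0 < K1"
    proof -
      have "c \<le> diffusion P y * m y" using c(2)[OF y] by (simp add: scale_density_def)
      also have "\<dots> \<le> diffusion P y * K1"
        using K(1)[OF y] diffusion_pos[OF params yS] by (intro mult_left_mono) auto
      finally have *: "c \<le> diffusion P y * K1" .
      show K1: "0 < K1" using K(1)[OF y] c(2)[OF y] c(1) by linarith
      show "c / K1 \<le> diffusion P y" using * K1 by (simp add: divide_le_eq)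
    qed
    have "diffusion P y * poly (pderiv (pderiv g)) y = poly (gen_poly g) y - drift P y * poly (pderiv g) y"
      by (simp add: gen_poly_def drift_eq_poly diffusion_eq_poly)
    then have "diffusion P y * \<bar>poly (pderiv (pderiv g)) y\<bar> = \<bar>poly (gen_poly g) y - drift P y * poly (pderiv g) y\<bar>"
      using diffusion_pos[OF params yS] by (metis abs_mult abs_of_pos)
    also have "\<dots> \<le> \<bar>poly (gen_poly g) y\<bar> + \<bar>drift P y\<bar> * \<bar>poly (pderiv g) y\<bar>"
      by (metis abs_mult abs_triangle_ineq4)
    also have "\<dots> \<le> M + K3 * (C1 * M)"
      using g(2)[OF y] K(3)[OF y] 1 K0 by (intro add_mono mult_mono) auto
    finally have "diffusion P y * \<bar>poly (pderiv (pderiv g)) y\<bar> \<le> (1 + K3 * C1) * M" by (simp add: algebra_simps)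
    moreover have "c / K1 * \<bar>poly (pderiv (pderiv g)) y\<bar> \<le> diffusion P y * \<bar>poly (pderiv (pderiv g)) y\<bar>"
      using D by (intro mult_right_mono) auto
    ultimately have "c / K1 * \<bar>poly (pderiv (pderiv g)) y\<bar> \<le> (1 + K3 * C1) * M" by linarith
    then have "\<bar>poly (pderiv (pderiv g)) y\<bar> \<le> C2 * M"
      using c(1) D(2) by (simp add: C2_def field_simps)
    with 1 show ?thesis by blast
  qed
  have "\<bar>poly (pderiv g) y\<bar> \<le> (C1 + C2 + 1) * M \<and> \<bar>poly (pderiv (pderiv g)) y\<bar> \<le> (C1 + C2 + 1) * M"
    if "\<And>y. y \<in> {a..b} \<Longrightarrow> \<bar>poly g y\<bar> \<le> M \<and> \<bar>poly (gen_poly g) y\<bar> \<le> M" "y \<in> {a..b}" for g M y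
  proof -
    have "0 \<le> M" using that(1)[OF that(2)] by linarith
    then have "C1 * M \<le> (C1 + C2 + 1) * M" "C2 * M \<le> (C1 + C2 + 1) * M"
      using C1 C2 by (auto intro!: mult_right_mono)
    then show ?thesis using main[of g M y] that by force
  qed
  moreover have "0 < C1 + C2 + 1" using C1 C2 by simp
  ultimately show ?thesis by blast
qed

lemma gen_poly_diff: "gen_poly (p - q) = gen_poly p - gen_poly q"
  by (simp add: gen_poly_def pderiv_diff algebra_simps)

text \<open>Closedness of the generator under locally uniform limits.
  \<open>generator_controls_derivatives\<close> is applied to the differences g i - g j, so no
  candidates for the derivatives have to be known beforehand.\<close>

lemma generator_limit:
  fixes g :: "nat \<Rightarrow> real poly"
  assumes lim: "\<And>a b. {a..b} \<subseteq> S \<Longrightarrow> uniformly_Cauchy_on {a..b} (\<lambda>N. poly (g N))"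
    and limG: "\<And>a b. {a..b} \<subseteq> S \<Longrightarrow> uniformly_Cauchy_on {a..b} (\<lambda>N. poly (gen_poly (g N)))"
  obtains f f1 f2 where
    "\<And>x. x \<in> S \<Longrightarrow> (\<lambda>N. poly (g N) x) \<longlonglongrightarrow> f x"
    "\<And>x. x \<in> S \<Longrightarrow> (f has_real_derivative f1 x) (at x)"
    "\<And>x. x \<in> S \<Longrightarrow> (f1 has_real_derivative f2 x) (at x)"
    "\<And>x. x \<in> S \<Longrightarrow> (\<lambda>N. poly (gen_poly (g N)) x) \<longlonglongrightarrow> drift P x * f1 x + diffusion P x * f2 x"
proof -
  have cauchy: "uniformly_Cauchy_on {a..b} (\<lambda>N. poly (pderiv (g N))) \<and>
      uniformly_Cauchy_on {a..b} (\<lambda>N. poly (pderiv (pderiv (g N))))" if ab: "{a..b} \<subseteq> S" "a < b" for a b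
  proof -
    obtain C where C: "0 < C" and bd: "\<And>g M y. (\<And>y. y \<in> {a..b} \<Longrightarrow> \<bar>poly g y\<bar> \<le> M \<and> \<bar>poly (gen_poly g) y\<bar> \<le> M) \<Longrightarrow>
        y \<in> {a..b} \<Longrightarrow> \<bar>poly (pderiv g) y\<bar> \<le> C * M \<and> \<bar>poly (pderiv (pderiv g)) y\<bar> \<le> C * M"
      using generator_controls_derivatives[OF ab] by blast
    have "\<exists>K. \<forall>y\<in>{a..b}. \<forall>i\<ge>K. \<forall>j\<ge>K. dist (poly (pderiv (g i)) y) (poly (pderiv (g j)) y) < e \<and>
        dist (poly (pderiv (pderiv (g i))) y) (poly (pderiv (pderiv (g j))) y) < e" if e: "0 < e" for e
    proof -
      define d where "d = e / (2 * C)"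
      have d: "0 < d" using e C by (simp add: d_def)
      obtain K1 where K1: "\<And>y i j. y \<in> {a..b} \<Longrightarrow> K1 \<le> i \<Longrightarrow> K1 \<le> j \<Longrightarrow> dist (poly (g i) y) (poly (g j) y) < d"
        using lim[OF ab(1)] d unfolding uniformly_Cauchy_on_def by meson
      obtain K2 where K2: "\<And>y i j. y \<in> {a..b} \<Longrightarrow> K2 \<le> i \<Longrightarrow> K2 \<le> j \<Longrightarrow>
          dist (poly (gen_poly (g i)) y) (poly (gen_poly (g j)) y) < d"
        using limG[OF ab(1)] d unfolding uniformly_Cauchy_on_def by meson
      have Cd: "C * d < e" using e C by (simp add: d_def)
      show ?thesis
      proof (intro exI[of _ "max K1 K2"] ballI allI impI)
        fix y i j assume y: "y \<in> {a..b}" and i: "max K1 K2 \<le> i" and j: "max K1 K2 \<le> j"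
        have "\<bar>poly (pderiv (g i - g j)) y\<bar> \<le> C * d \<and> \<bar>poly (pderiv (pderiv (g i - g j))) y\<bar> \<le> C * d"
        proof (rule bd[OF _ y])
          fix y assume "y \<in> {a..b}"
          then show "\<bar>poly (g i - g j) y\<bar> \<le> d \<and> \<bar>poly (gen_poly (g i - g j)) y\<bar> \<le> d"
            using K1[of y i j] K2[of y i j] i j by (auto simp: gen_poly_diff dist_real_def)
        qed
        then show "dist (poly (pderiv (g i)) y) (poly (pderiv (g j)) y) < e \<and>
            dist (poly (pderiv (pderiv (g i))) y) (poly (pderiv (pderiv (g j))) y) < e"
          using Cd by (simp add: pderiv_diff dist_real_def)
      qed
    qed
    then show ?thesis unfolding uniformly_Cauchy_on_def by meson
  qed
  define f where "f = (\<lambda>x. lim (\<lambda>N. poly (g N) x))"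
  define f1 where "f1 = (\<lambda>x. lim (\<lambda>N. poly (pderiv (g N)) x))"
  define f2 where "f2 = (\<lambda>x. lim (\<lambda>N. poly (pderiv (pderiv (g N))) x))"
  have "\<exists>a b. a < x \<and> x < b \<and> {a..b} \<subseteq> S" if "x \<in> S" for x
  proof -
    obtain d where d: "0 < d" "cball x d \<subseteq> S" using open_contains_cball open_state_space \<open>x \<in> S\<close> by blast
    then have "{x - d..x + d} \<subseteq> S" by (auto simp: cball_def dist_real_def subset_iff)
    then show ?thesis using d by (intro exI[of _ "x - d"] exI[of _ "x + d"]) auto
  qed
  note nbhd = this
  have ul: "uniform_limit X u (\<lambda>x. lim (\<lambda>n. u n x)) sequentially" if "uniformly_Cauchy_on X u"
    for X :: "real set" and u :: "nat \<Rightarrow> real \<Rightarrow> real"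
    using Cauchy_uniformly_convergent[OF that] unfolding uniformly_convergent_uniform_limit_iff .
  have loc: "(\<lambda>N. poly (g N) x) \<longlonglongrightarrow> f x \<and> (f has_real_derivative f1 x) (at x) \<and> (f1 has_real_derivative f2 x) (at x) \<and>
      (\<lambda>N. poly (gen_poly (g N)) x) \<longlonglongrightarrow> drift P x * f1 x + diffusion P x * f2 x" if "x \<in> S" for x
  proof -
    obtain a b where ab: "a < x" "x < b" "{a..b} \<subseteq> S" using nbhd \<open>x \<in> S\<close> by blast
    then have "a < b" by simp
    have u: "uniform_limit {a..b} (\<lambda>N. poly (g N)) f sequentially"
      unfolding f_def by (rule ul[OF lim[OF ab(3)]])
    have u1: "uniform_limit {a..b} (\<lambda>N. poly (pderiv (g N))) f1 sequentially"
      unfolding f1_def by (rule ul[OF conjunct1[OF cauchy[OF ab(3) \<open>a < b\<close>]]])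
    have u2: "uniform_limit {a..b} (\<lambda>N. poly (pderiv (pderiv (g N)))) f2 sequentially"
      unfolding f2_def by (rule ul[OF conjunct2[OF cauchy[OF ab(3) \<open>a < b\<close>]]])
    have l: "(\<lambda>N. poly (g N) y) \<longlonglongrightarrow> f y" "(\<lambda>N. poly (pderiv (g N)) y) \<longlonglongrightarrow> f1 y"
        "(\<lambda>N. poly (pderiv (pderiv (g N))) y) \<longlonglongrightarrow> f2 y" if "y \<in> {a..b}" for y
      using tendsto_uniform_limitI[OF u that] tendsto_uniform_limitI[OF u1 that] tendsto_uniform_limitI[OF u2 that] by auto
    have "(f has_real_derivative f1 x) (at x)"
      by (rule has_real_derivative_uniform_limit[where f = "\<lambda>N. poly (g N)" and a = a and b = b,
            OF poly_DERIV _ uniform_limit_on_subset[OF u1]]) (use ab l in auto)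
    moreover have "(f1 has_real_derivative f2 x) (at x)"
      by (rule has_real_derivative_uniform_limit[where f = "\<lambda>N. poly (pderiv (g N))" and a = a and b = b,
            OF poly_DERIV _ uniform_limit_on_subset[OF u2]]) (use ab l in auto)
    moreover have "(\<lambda>N. poly (gen_poly (g N)) x) \<longlonglongrightarrow> drift P x * f1 x + diffusion P x * f2 x"
      unfolding gen_poly_def drift_eq_poly diffusion_eq_poly poly_add poly_mult
      using ab by (intro tendsto_intros l) auto
    ultimately show ?thesis using l(1)[of x] ab by auto
  qed
  show ?thesis by (rule that[of f f1 f2]) (use loc in auto)
qed

lemma m_differentiable: assumes "x \<in> S" shows "m field_differentiable at x"
proof -
  have "(\<lambda>x. scale_density P x / diffusion P x) field_differentiable at x"
    using scale_density_deriv[OF params assms] diffusion_pos[OF params assms] unfolding diffusion_eq_poly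
    by (intro field_differentiable_divide) (auto simp: field_differentiable_def intro: poly_DERIV)
  moreover have "\<forall>\<^sub>F y in nhds x. scale_density P y / diffusion P y = m y"
    by (rule eventually_mono[OF eventually_nhds_in_open[OF open_state_space assms]]) (simp add: m_eq)
  ultimately show ?thesis
    unfolding field_differentiable_def by (simp only: DERIV_cong_ev[OF refl _ refl])
qed

text \<open>By Pearson's equation the derivative of D m f is \<mu> m f + D m f1. On differentiating
  again, the derivative of \<mu> m f cancels the drift term of the operator.\<close>

lemma fokker_planck_density:
  assumes p: "\<And>x. x \<in> S \<Longrightarrow> p x = m x * f x"
    and f: "\<And>x. x \<in> S \<Longrightarrow> (f has_real_derivative f1 x) (at x)"
    and f1: "\<And>x. x \<in> S \<Longrightarrow> (f1 has_real_derivative f2 x) (at x)"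
  shows "fokker_planck_defined P p"
    and "x \<in> S \<Longrightarrow> fokker_planck P p x = m x * (drift P x * f1 x + diffusion P x * f2 x)"
proof -
  have near: "\<forall>\<^sub>F y in nhds x. y \<in> S" if "x \<in> S" for x
    by (rule eventually_nhds_in_open[OF open_state_space that])
  have drift_f: "\<exists>E. ((\<lambda>y. drift P y * m y * f y) has_real_derivative E) (at x)" if x: "x \<in> S" for x
  proof -
    have "(\<lambda>y. drift P y * m y * f y) field_differentiable at x"
      unfolding drift_eq_poly
      using f[OF x] by (intro field_differentiable_mult m_differentiable[OF x])
        (auto simp: field_differentiable_def intro: poly_DERIV)
    then show ?thesis by (simp add: field_differentiable_def)
  qed
  \<comment> \<open>E is never computed: it occurs in both terms of the operator and
    cancels.\<close>
  then obtain E where E: "\<And>x. x \<in> S \<Longrightarrow> ((\<lambda>y. drift P y * m y * f y) has_real_derivative E x) (at x)" by metis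
  have d1: "((\<lambda>y. drift P y * p y) has_real_derivative E x) (at x)" if x: "x \<in> S" for x
  proof -
    have "\<forall>\<^sub>F y in nhds x. drift P y * p y = drift P y * m y * f y"
      using near[OF x] by eventually_elim (simp add: p)
    then show ?thesis using E[OF x] by (simp only: DERIV_cong_ev[OF refl _ refl])
  qed
  have d2: "((\<lambda>y. diffusion P y * p y) has_real_derivative drift P x * m x * f x + scale_density P x * f1 x) (at x)"
    if x: "x \<in> S" for x
  proof -
    have "\<forall>\<^sub>F y in nhds x. diffusion P y * p y = scale_density P y * f y"
      using near[OF x] by eventually_elim (simp add: p scale_density_def)
    then show ?thesis
      using DERIV_mult[OF scale_density_deriv[OF params x] f[OF x]]
      by (simp only: DERIV_cong_ev[OF refl _ refl] mult.commute[of "f1 x"])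
  qed
  have d3: "(deriv (\<lambda>y. diffusion P y * p y) has_real_derivative
      E x + (drift P x * m x * f1 x + scale_density P x * f2 x)) (at x)" if x: "x \<in> S" for x
  proof -
    have "\<forall>\<^sub>F y in nhds x. deriv (\<lambda>y. diffusion P y * p y) y = drift P y * m y * f y + scale_density P y * f1 y"
      using near[OF x] by eventually_elim (rule DERIV_imp_deriv[OF d2])
    then show ?thesis
      using DERIV_add[OF E[OF x] DERIV_mult[OF scale_density_deriv[OF params x] f1[OF x]]]
      by (simp only: DERIV_cong_ev[OF refl _ refl] mult.commute[of "f2 x"])
  qed
  show "fokker_planck_defined P p"
    unfolding fokker_planck_defined_def using d1 d2 d3 by (auto simp: field_differentiable_def)
  show "fokker_planck P p x = m x * (drift P x * f1 x + diffusion P x * f2 x)" if x: "x \<in> S"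
    unfolding fokker_planck_def using DERIV_imp_deriv[OF d1[OF x]] DERIV_imp_deriv[OF d3[OF x]]
    by (simp add: scale_density_def algebra_simps)
qed

end

section \<open>The solution of the Cauchy problem\<close>

locale fractional_cauchy = pearson_basis P Q + kilbas_saigo_params \<alpha> \<gamma>
  for P :: pearson and Q :: "nat \<Rightarrow> real poly" and \<alpha> \<gamma> :: real +
  fixes h :: "real \<Rightarrow> real"
  assumes h_meas: "set_borel_measurable lborel (state_space P) h"
    and h_L2: "set_integrable lborel (state_space P) (\<lambda>x. (h x / stat_density P x)\<^sup>2 * stat_density P x)"
    and h_unif: "\<And>c d. {c..d} \<subseteq> state_space P \<Longrightarrow>
           uniform_limit {c..d} (\<lambda>N x. \<Sum>n<N. fourier_coeff P Q h n * poly (Q n) x)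
             (\<lambda>x. h x / stat_density P x) sequentially"
begin

abbreviation "a \<equiv> fourier_coeff P Q h"

lemma time_factor_eq: "time_factor P \<alpha> \<gamma> n t = ks0 (lam n * t powr kappa)"
proof -
  have "1 + \<alpha> * (real k * (1 + \<gamma> / \<alpha>) + \<gamma> / \<alpha>) = 1 + real k * kappa + \<gamma>"
    "1 + \<alpha> * (real k * (1 + \<gamma> / \<alpha>) + \<gamma> / \<alpha> + 1) = 1 + real (Suc k) * kappa" for k
    using alpha by (simp_all add: kappa_def field_simps)
  then have "(\<Prod>k<n. Gamma (1 + \<alpha> * (real k * (1 + \<gamma> / \<alpha>) + \<gamma> / \<alpha>)) /
      Gamma (1 + \<alpha> * (real k * (1 + \<gamma> / \<alpha>) + \<gamma> / \<alpha> + 1))) = coef n" for n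
    by (simp only: coef_def)
  then have "kilbas_saigo \<alpha> (1 + \<gamma> / \<alpha>) (\<gamma> / \<alpha>) (- z) = ks0 z" for z
    unfolding kilbas_saigo_def ks0_def ks_def power_series_def ks_coeff_def
    by (simp add: power_minus[of z] mult_ac)
  then show ?thesis by (simp add: time_factor_def kappa_def)
qed

text \<open>Boundedness of z E(-z) gives lam n E \<le> C / z with z = t^kappa, and adding E \<le> 1
  gives (1 + lam n) E \<le> 1 + C / z.\<close>

lemma time_factor_bounds:
  assumes t: "0 < t"
  obtains D where "0 \<le> D" "\<And>n. 0 \<le> time_factor P \<alpha> \<gamma> n t" "\<And>n. time_factor P \<alpha> \<gamma> n t \<le> D / (1 + lam n)"
    "\<And>n. time_factor P \<alpha> \<gamma> n t \<le> 1"
proof -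
  define z where "z = t powr kappa"
  have z: "0 < z" using t by (simp add: z_def)
  obtain C U V where UV: "bounded_mono C U" "bounded_mono C V" and w: "\<And>z. 0 \<le> z \<Longrightarrow> z * ks0 z = U z - V z"
    using bounded_mono_diff_ks(3) unfolding bounded_mono_diff_def by blast
  have C: "0 \<le> C" using UV(1) unfolding bounded_mono_def by (auto intro: order_trans)
  have lz: "0 \<le> lam n * z" for n using eigval_nonneg[OF params] z by simp
  have "lam n * z * ks0 (lam n * z) \<le> C" for n
    using w[OF lz] UV lz unfolding bounded_mono_def by (smt (verit))
  then have "lam n * ks0 (lam n * z) \<le> C / z" for n using z by (simp add: field_simps)
  then have "(1 + lam n) * ks0 (lam n * z) \<le> 1 + C / z" for n
    using ks0_le[OF lz[of n]] by (simp add: distrib_right add_mono)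
  moreover have "0 < 1 + lam n" for n using eigval_nonneg[OF params, of n] by simp
  ultimately have "ks0 (lam n * z) \<le> (1 + C / z) / (1 + lam n)" for n
    by (simp add: pos_le_divide_eq mult.commute)
  then show ?thesis
    using that[of "1 + C / z"] C z ks0_nonneg[OF lz] ks0_le[OF lz] by (simp add: time_factor_eq z_def)
qed

text \<open>The product Q_n(x) Q_n(y) is split into squares, and the decay 1/(1 + lam n) of the time
  factor is what \<open>summable_Q_squared\<close> needs at x and at y.\<close>

lemma kernel_summable:
  assumes t: "0 < t" and x: "x \<in> S" and y: "y \<in> S"
  shows "summable (\<lambda>n. time_factor P \<alpha> \<gamma> n t * poly (Q n) x * poly (Q n) y)"
proof -
  obtain D where D: "0 \<le> D" "\<And>n. 0 \<le> time_factor P \<alpha> \<gamma> n t" "\<And>n. time_factor P \<alpha> \<gamma> n t \<le> D / (1 + lam n)"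
    using time_factor_bounds[OF t] by metis
  have l: "0 < 1 + lam n" for n using eigval_nonneg[OF params, of n] by simp
  show ?thesis
  proof (rule summable_comparison_test')
    show "summable (\<lambda>n. D * ((poly (Q n) x)\<^sup>2 / (1 + lam n) + (poly (Q n) y)\<^sup>2 / (1 + lam n)))"
      by (intro summable_mult summable_add summable_Q_squared x y)
    fix n
    have "norm (time_factor P \<alpha> \<gamma> n t * poly (Q n) x * poly (Q n) y) = time_factor P \<alpha> \<gamma> n t * \<bar>poly (Q n) x * poly (Q n) y\<bar>"
      using D(2)[of n] by (simp add: abs_mult)
    also have "\<dots> \<le> D / (1 + lam n) * ((poly (Q n) x)\<^sup>2 + (poly (Q n) y)\<^sup>2)"
      using abs_mult_le_weighted_squares[of 1 "poly (Q n) x" "poly (Q n) y"] D l[of n]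
      by (intro mult_mono) (auto simp: less_imp_le)
    also have "\<dots> = D * ((poly (Q n) x)\<^sup>2 / (1 + lam n) + (poly (Q n) y)\<^sup>2 / (1 + lam n))"
      by (simp add: add_divide_distrib distrib_left)
    finally show "norm (time_factor P \<alpha> \<gamma> n t * poly (Q n) x * poly (Q n) y) \<le>
        D * ((poly (Q n) x)\<^sup>2 / (1 + lam n) + (poly (Q n) y)\<^sup>2 / (1 + lam n))" .
  qed
qed

text \<open>Sum and integral are exchanged in L2. The functions Q_n sqrt(m) are orthonormal for
  Lebesgue measure, h / sqrt(m) is square integrable, and the coefficients \<beta> are square
  summable, since a time factor in [0, 1] has its square below D / (1 + lam n).\<close>

lemma kernel_integral:
  assumes t: "0 < t" and x: "x \<in> S"
  shows "set_integrable lborel S (\<lambda>y. trans_density P Q \<alpha> \<gamma> x t y * h y)"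
    and "(LINT y:S|lborel. trans_density P Q \<alpha> \<gamma> x t y * h y) =
           m x * (\<Sum>n. time_factor P \<alpha> \<gamma> n t * poly (Q n) x * a n)"
proof -
  \<comment> \<open>Extending m by 0 outside S puts everything on the whole line; there f is 0 as
    well, thanks to its indicator.\<close>
  define r where "r = (\<lambda>y. indicator S y * m y)"
  define \<phi> where "\<phi> = (\<lambda>n y. poly (Q n) y * sqrt (r y))"
  define \<beta> where "\<beta> = (\<lambda>n. time_factor P \<alpha> \<gamma> n t * poly (Q n) x)"
  define T where "T = (\<lambda>y. (if y \<in> S then \<Sum>n. \<beta> n * poly (Q n) y else 0) * sqrt (r y))"
  define f where "f = (\<lambda>y. indicator S y * h y / sqrt (r y))"
  have r_S: "r y = m y" "0 < r y" if "y \<in> S" for y using that stat_density_pos[OF params that] by (auto simp: r_def)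
  have r_out: "r y = 0" if "y \<notin> S" for y using that by (simp add: r_def)
  have r0: "0 \<le> r y" for y using r_S r_out by (cases "y \<in> S") (auto intro: less_imp_le)
  have mr [measurable]: "r \<in> borel_measurable borel" unfolding r_def by (rule measurable_m)
  have m\<phi>: "\<phi> n \<in> borel_measurable lborel" for n unfolding \<phi>_def by measurable
  have mh: "(\<lambda>y. indicator S y * h y) \<in> borel_measurable lborel"
    using h_meas by (simp add: set_borel_measurable_def)
  have mf: "f \<in> borel_measurable lborel" unfolding f_def using mh by measurable
  have \<phi>\<phi>: "\<phi> n y * \<phi> k y = indicator S y *\<^sub>R (poly (Q n * Q k) y * m y)" for n k y
    using r0[of y] by (simp add: \<phi>_def r_def mult_ac)
  have i\<phi>: "integrable lborel (\<lambda>y. (\<phi> n y)\<^sup>2)" for n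
    using integrable_poly[of "Q n * Q n"] unfolding power2_eq_square \<phi>\<phi> set_integrable_def .
  have orth: "(\<integral>y. \<phi> n y * \<phi> k y \<partial>lborel) = (if n = k then 1 else 0)" for n k
    using Q_orthonormal[of n k] unfolding \<phi>\<phi> set_lebesgue_integral_def by simp
  have f2: "(f y)\<^sup>2 = indicator S y *\<^sub>R ((h y / m y)\<^sup>2 * m y)" for y
    using r_S[of y] r_out[of y] by (cases "y \<in> S") (auto simp: f_def power2_eq_square)
  have if2: "integrable lborel (\<lambda>y. (f y)\<^sup>2)" using h_L2 unfolding f2 set_integrable_def .
  have \<beta>: "summable (\<lambda>n. (\<beta> n)\<^sup>2)"
  proof -
    obtain D where D: "0 \<le> D" "\<And>n. 0 \<le> time_factor P \<alpha> \<gamma> n t" "\<And>n. time_factor P \<alpha> \<gamma> n t \<le> D / (1 + lam n)"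
      "\<And>n. time_factor P \<alpha> \<gamma> n t \<le> 1"
      using time_factor_bounds[OF t] by metis
    show ?thesis
    proof (rule summable_comparison_test')
      show "summable (\<lambda>n. D * ((poly (Q n) x)\<^sup>2 / (1 + lam n)))" by (intro summable_mult summable_Q_squared x)
      fix n
      have "(time_factor P \<alpha> \<gamma> n t)\<^sup>2 \<le> 1 * (D / (1 + lam n))"
        unfolding power2_eq_square using D by (intro mult_mono) auto
      from mult_right_mono[OF this, of "(poly (Q n) x)\<^sup>2"]
      show "norm ((\<beta> n)\<^sup>2) \<le> D * ((poly (Q n) x)\<^sup>2 / (1 + lam n))"
        by (simp add: \<beta>_def power_mult_distrib)
    qed
  qed
  have T: "(\<lambda>n. \<beta> n * \<phi> n y) sums T y" for y
  proof (cases "y \<in> S")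
    case True
    have "(\<lambda>n. \<beta> n * poly (Q n) y * sqrt (r y)) sums ((\<Sum>n. \<beta> n * poly (Q n) y) * sqrt (r y))"
      using kernel_summable[OF t x True] unfolding \<beta>_def by (intro sums_mult2 summable_sums)
    then show ?thesis using True by (simp add: T_def \<phi>_def mult.assoc)
  qed (simp add: T_def \<phi>_def r_out)
  note series = orthonormal_series_integral[OF m\<phi> i\<phi> orth \<beta> T mf if2]
  have Tf: "m x * (T y * f y) = indicator S y *\<^sub>R (trans_density P Q \<alpha> \<gamma> x t y * h y)" for y
    using r_S[of y] by (cases "y \<in> S") (auto simp: T_def f_def trans_density_def \<beta>_def)
  have \<phi>f: "\<phi> n y * f y = indicator S y *\<^sub>R (h y * poly (Q n) y)" for n y
    using r_S[of y] by (cases "y \<in> S") (auto simp: \<phi>_def f_def)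
  have a: "(\<integral>y. \<phi> n y * f y \<partial>lborel) = a n" for n
    unfolding \<phi>f fourier_coeff_def set_lebesgue_integral_def ..
  have "integrable lborel (\<lambda>y. m x * (T y * f y))" using series(1) by simp
  then show "set_integrable lborel S (\<lambda>y. trans_density P Q \<alpha> \<gamma> x t y * h y)"
    unfolding Tf set_integrable_def .
  have "(LINT y:S|lborel. trans_density P Q \<alpha> \<gamma> x t y * h y) = m x * (\<integral>y. T y * f y \<partial>lborel)"
    unfolding set_lebesgue_integral_def Tf[symmetric] by simp
  also have "(\<integral>y. T y * f y \<partial>lborel) = (\<Sum>n. \<beta> n * a n)"
    using series(2) unfolding a by (rule sums_unique)
  finally show "(LINT y:S|lborel. trans_density P Q \<alpha> \<gamma> x t y * h y) =
      m x * (\<Sum>n. time_factor P \<alpha> \<gamma> n t * poly (Q n) x * a n)"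
    by (simp add: \<beta>_def)
qed

definition coords :: "real \<Rightarrow> nat \<Rightarrow> real" where "coords x n = a n * poly (Q n) x"

text \<open>One series represents both the spectral value at t = 0 and the kernel integral for t >
  0, so the case distinction disappears from here on.\<close>

lemma cauchy_solution_eq:
  assumes "0 \<le> t" "x \<in> S"
  shows "cauchy_solution P Q \<alpha> \<gamma> h t x = m x * eigensum lam (coords x) t"
  using assms kernel_integral(2)[of t x]
  by (simp add: cauchy_solution_def eigensum_def coords_def time_factor_eq mult_ac)

text \<open>Uniform convergence on the degenerate interval \<open>{x..x}\<close> is convergence at
  x.\<close>

lemma coords_sums: "x \<in> S \<Longrightarrow> coords x sums (h x / m x)"
  using tendsto_uniform_limitI[OF h_unif[of x x], of x] by (simp add: sums_def coords_def)

lemma eigensum_coords: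
  assumes "x \<in> S"
  shows "0 < t \<Longrightarrow> (eigensum lam (coords x) has_real_derivative
            (\<Sum>n. coords x n * ks1 (lam n * t powr kappa)) * (kappa / t)) (at t)"
    and "0 < t \<Longrightarrow> summable (\<lambda>n. coords x n * (lam n * ks0 (lam n * t powr kappa)))"
    and "0 < t \<Longrightarrow> \<exists>C. lipschitz_end C (eigensum lam (coords x)) t"
    and "0 < t \<Longrightarrow> marchaud \<alpha> (eigensum lam (coords x)) t =
           - Gamma (1 - \<alpha>) * t powr \<gamma> * (\<Sum>n. coords x n * (lam n * ks0 (lam n * t powr kappa)))"
  using eigensum_properties[OF sums_summable[OF coords_sums[OF assms]] mono_eigval[OF params] eigval_nonneg[OF params]] by auto

lemma initial_value: "x \<in> S \<Longrightarrow> cauchy_solution P Q \<alpha> \<gamma> h 0 x = h x"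
  using cauchy_solution_eq[of 0 x] sums_unique[OF coords_sums[of x], symmetric] stat_density_pos[OF params, of x]
  by (simp add: eigensum_def)

text \<open>The factors t^\<gamma> and Gamma(1 - \<alpha>) from the relaxation equation cancel
  against the normalization of \<open>stretched_caputo\<close>.\<close>

lemma time_side:
  assumes t: "0 < t" and x: "x \<in> S"
  shows "stretched_caputo_defined \<alpha> (\<lambda>s. cauchy_solution P Q \<alpha> \<gamma> h s x) t"
    and "stretched_caputo \<alpha> \<gamma> (\<lambda>s. cauchy_solution P Q \<alpha> \<gamma> h s x) t =
      - m x * (\<Sum>n. coords x n * (lam n * ks0 (lam n * t powr kappa)))"
proof -
  define F where "F = (\<lambda>s. cauchy_solution P Q \<alpha> \<gamma> h s x)"
  define e' where "e' = (\<lambda>s. (\<Sum>n. coords x n * ks1 (lam n * s powr kappa)) * (kappa / s))"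
  have d: "(F has_real_derivative m x * e' s) (at s)" if s: "0 < s" for s
  proof -
    have "((\<lambda>s. m x * eigensum lam (coords x) s) has_real_derivative m x * e' s) (at s)"
      unfolding e'_def by (intro DERIV_cmult eigensum_coords(1)[OF x s])
    moreover have "\<forall>\<^sub>F y in nhds s. F y = m x * eigensum lam (coords x) y"
      by (rule eventually_mono[OF eventually_nhds_in_open[of "{0<..}" s]])
         (use s x in \<open>auto simp: F_def cauchy_solution_eq\<close>)
    ultimately show ?thesis by (simp only: DERIV_cong_ev[OF refl _ refl])
  qed
  obtain C where C: "lipschitz_end C (eigensum lam (coords x)) t" using eigensum_coords(3)[OF x t] by blast
  have "((\<lambda>s. e' s / (t - s) powr \<alpha>) has_integral marchaud \<alpha> (eigensum lam (coords x)) t) {0..t}"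
    unfolding e'_def by (intro marchaud_has_integral[OF C alpha t] eigensum_coords(1)[OF x]) simp
  from has_integral_mult_right[OF this, of "m x"]
  have I: "((\<lambda>s. deriv F s / (t - s) powr \<alpha>) has_integral m x * marchaud \<alpha> (eigensum lam (coords x)) t) {0..t}"
  \<comment> \<open>The value of \<open>deriv F\<close> at 0 is not controlled, since F near 0 also
    involves negative times; one point does not affect the integral.\<close>
  proof (rule has_integral_spike_finite[of "{0}", rotated -1])
    show "deriv F s / (t - s) powr \<alpha> = m x * (e' s / (t - s) powr \<alpha>)" if "s \<in> {0..t} - {0}" for s
      using DERIV_imp_deriv[OF d[of s]] that by simp
  qed simp
  show "stretched_caputo_defined \<alpha> (\<lambda>s. cauchy_solution P Q \<alpha> \<gamma> h s x) t"
    unfolding stretched_caputo_defined_def F_def[symmetric]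
    using d I unfolding field_differentiable_def by fastforce
  have G: "Gamma (1 - \<alpha>) \<noteq> 0" using alpha Gamma_real_pos[of "1 - \<alpha>"] by linarith
  have "t powr (- \<gamma>) * t powr \<gamma> = 1" using t by (simp add: powr_add[symmetric])
  then show "stretched_caputo \<alpha> \<gamma> (\<lambda>s. cauchy_solution P Q \<alpha> \<gamma> h s x) t =
      - m x * (\<Sum>n. coords x n * (lam n * ks0 (lam n * t powr kappa)))"
    unfolding stretched_caputo_def F_def[symmetric] integral_unique[OF I] eigensum_coords(4)[OF x t]
    using G by (simp add: field_simps)
qed

text \<open>The partial sums are polynomials on which the generator acts by eigenvalues. The
  multipliers ks0 and z ks0 make them and their images converge uniformly on compact intervals, so
  \<open>generator_limit\<close> applies, and \<open>fokker_planck_density\<close> translates the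
  result.\<close>

lemma space_side:
  assumes t: "0 < t"
  shows "fokker_planck_defined P (cauchy_solution P Q \<alpha> \<gamma> h t)"
    and "x \<in> S \<Longrightarrow> fokker_planck P (cauchy_solution P Q \<alpha> \<gamma> h t) x =
      - m x * (\<Sum>n. coords x n * (lam n * ks0 (lam n * t powr kappa)))"
proof -
  define z where "z = t powr kappa"
  have z: "0 < z" using t by (simp add: z_def)
  define g where "g = (\<lambda>N. \<Sum>n<N. smult (a n * ks0 (lam n * z)) (Q n))"
  have gx: "poly (g N) x = (\<Sum>n<N. coords x n * ks0 (lam n * z))" for N x
    by (simp add: g_def poly_sum coords_def mult_ac)
  \<comment> \<open>The factor z is inserted to form the multiplier z ks0 at lam n z, and removed
    again by - 1 / z.\<close>
  have Gx: "poly (gen_poly (g N)) x = (\<Sum>n<N. coords x n * (lam n * z * ks0 (lam n * z))) * (- 1 / z)" if "x \<in> S" for N x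
    unfolding g_def gen_poly_sum poly_sum sum_distrib_right
    using z that by (intro sum.cong) (auto simp: gen_poly_Q coords_def)
  obtain C0 C2 where C: "bounded_mono_diff C0 ks0" "bounded_mono_diff C2 (\<lambda>z. z * ks0 z)"
    using bounded_mono_diff_ks by blast
  have lim: "uniform_limit {c..d} (\<lambda>N x. \<Sum>n<N. coords x n * w (lam n * z)) (\<lambda>x. \<Sum>n. coords x n * w (lam n * z)) sequentially"
    if w: "bounded_mono_diff C w" and cd: "{c..d} \<subseteq> S" for w C c d
    using uniform_limit_reparametrize[OF abel_uniform_limit[OF w mono_eigval[OF params] eigval_nonneg[OF params] h_unif[OF cd]],
        of "{c..d}" "\<lambda>x. (x, z)"] z by (simp add: coords_def)
  have unif0: "uniform_limit {c..d} (\<lambda>N. poly (g N)) (\<lambda>x. \<Sum>n. coords x n * ks0 (lam n * z)) sequentially"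
    if "{c..d} \<subseteq> S" for c d
    unfolding gx[abs_def] by (rule lim[OF C(1) that])
  have unif1: "uniform_limit {c..d} (\<lambda>N. poly (gen_poly (g N)))
      (\<lambda>x. (\<Sum>n. coords x n * (lam n * z * ks0 (lam n * z))) * (- 1 / z)) sequentially"
    if cd: "{c..d} \<subseteq> S" for c d
  proof -
    have "uniform_limit {c..d} (\<lambda>N x. (\<Sum>n<N. coords x n * (lam n * z * ks0 (lam n * z))) * (- 1 / z))
        (\<lambda>x. (\<Sum>n. coords x n * (lam n * z * ks0 (lam n * z))) * (- 1 / z)) sequentially"
      by (rule uniform_limit_mult_bounded[OF lim[OF C(2) cd] order_refl])
    then show ?thesis
      by (rule uniform_limit_cong'[THEN iffD1, rotated -1]) (use cd Gx in auto)
  qed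
  obtain f f1 f2 where f: "\<And>x. x \<in> S \<Longrightarrow> (\<lambda>N. poly (g N) x) \<longlonglongrightarrow> f x"
    "\<And>x. x \<in> S \<Longrightarrow> (f has_real_derivative f1 x) (at x)"
    "\<And>x. x \<in> S \<Longrightarrow> (f1 has_real_derivative f2 x) (at x)"
    "\<And>x. x \<in> S \<Longrightarrow> (\<lambda>N. poly (gen_poly (g N)) x) \<longlonglongrightarrow> drift P x * f1 x + diffusion P x * f2 x"
  proof (rule generator_limit)
    show "uniformly_Cauchy_on {c..d} (\<lambda>N. poly (g N))" if "{c..d} \<subseteq> S" for c d
      by (rule uniformly_convergent_Cauchy[OF uniformly_convergentI[OF unif0[OF that]]])
    show "uniformly_Cauchy_on {c..d} (\<lambda>N. poly (gen_poly (g N)))" if "{c..d} \<subseteq> S" for c d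
      by (rule uniformly_convergent_Cauchy[OF uniformly_convergentI[OF unif1[OF that]]])
  qed blast
  have p: "cauchy_solution P Q \<alpha> \<gamma> h t x = m x * f x" if x: "x \<in> S" for x
  proof -
    have "(\<lambda>N. poly (g N) x) \<longlonglongrightarrow> (\<Sum>n. coords x n * ks0 (lam n * z))"
      using tendsto_uniform_limitI[OF unif0[of x x], of x] x by simp
    then have "f x = eigensum lam (coords x) t"
      using f(1)[OF x] LIMSEQ_unique unfolding eigensum_def z_def by blast
    then show ?thesis using t x by (simp add: cauchy_solution_eq)
  qed
  show "fokker_planck_defined P (cauchy_solution P Q \<alpha> \<gamma> h t)"
    by (rule fokker_planck_density(1)[OF p f(2,3)])
  show "fokker_planck P (cauchy_solution P Q \<alpha> \<gamma> h t) x =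
      - m x * (\<Sum>n. coords x n * (lam n * ks0 (lam n * t powr kappa)))" if x: "x \<in> S"
  proof -
    have "(\<lambda>N. \<Sum>n<N. coords x n * (lam n * ks0 (lam n * z))) \<longlonglongrightarrow> (\<Sum>n. coords x n * (lam n * ks0 (lam n * z)))"
      using summable_LIMSEQ[OF eigensum_coords(2)[OF x t]] unfolding z_def .
    then have "(\<lambda>N. - (\<Sum>n<N. coords x n * (lam n * ks0 (lam n * z)))) \<longlonglongrightarrow> - (\<Sum>n. coords x n * (lam n * ks0 (lam n * z)))"
      by (rule tendsto_minus)
    moreover have "poly (gen_poly (g N)) x = - (\<Sum>n<N. coords x n * (lam n * ks0 (lam n * z)))" for N
      unfolding Gx[OF x] sum_distrib_right sum_negf[symmetric] using z by (intro sum.cong) auto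
    ultimately have "drift P x * f1 x + diffusion P x * f2 x = - (\<Sum>n. coords x n * (lam n * ks0 (lam n * z)))"
      using f(4)[OF x] LIMSEQ_unique by (simp only:) blast
    then show ?thesis
      using fokker_planck_density(2)[OF p f(2,3) x] by (simp add: z_def)
  qed
qed

lemma solves_cauchy_problem_solution: "solves_cauchy_problem P \<alpha> \<gamma> h (cauchy_solution P Q \<alpha> \<gamma> h)"
  unfolding solves_cauchy_problem_def using time_side space_side initial_value by simp

end

theorem theorem6p3:
  fixes P :: pearson and Q :: "nat \<Rightarrow> real poly" and \<alpha> \<gamma> :: real and h :: "real \<Rightarrow> real"
  assumes "0 < \<alpha>" "\<alpha> < 1" "\<gamma> \<ge> 0" "0 < \<alpha> + \<gamma>" "\<alpha> + \<gamma> \<le> 1"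
    and "pearson_params P"
    and "orthonormal_eigenpolys P Q"
    and "set_borel_measurable lborel (state_space P) h"
    and "set_integrable lborel (state_space P) (\<lambda>x. (h x / stat_density P x)\<^sup>2 * stat_density P x)"
    and "\<And>c d. {c..d} \<subseteq> state_space P \<Longrightarrow>
           uniform_limit {c..d} (\<lambda>N x. \<Sum>n<N. fourier_coeff P Q h n * poly (Q n) x)
             (\<lambda>x. h x / stat_density P x) sequentially"
  shows "(\<forall>t>0. \<forall>x\<in>state_space P.
            (\<forall>y\<in>state_space P. summable (\<lambda>n. time_factor P \<alpha> \<gamma> n t * poly (Q n) x * poly (Q n) y)) \<and>
            set_integrable lborel (state_space P) (\<lambda>y. trans_density P Q \<alpha> \<gamma> x t y * h y)) \<and>
         solves_cauchy_problem P \<alpha> \<gamma> h (cauchy_solution P Q \<alpha> \<gamma> h)"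
proof -
  interpret fractional_cauchy P Q \<alpha> \<gamma> h
    by unfold_locales fact+
  show ?thesis
    by (intro conjI allI impI ballI kernel_summable kernel_integral(1) solves_cauchy_problem_solution)
qed

end
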